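(* Let $\mathcal{G}$ be the property that a graph contains a spanning maximal planar bipartite subgraph. Then the threshold for $G_{n,p}\in\mathcal{G}$ is contained in the interval $\left(c_1 n^{-1/2},\, c_2(\log n)^{1/2}n^{-1/2}\right)$ for some constants $c_1,c_2>0$. That is, there are constants $c_1,c_2>0$ such that if $p\le c_1 n^{-1/2}$ then $\Pr[G_{n,p}\in\mathcal{G}]\to 0$ as $n\to\infty$, and if $p\ge c_2(\log n)^{1/2}n^{-1/2}$ then $\Pr[G_{n,p}\in\mathcal{G}]\to 1$ as $n\to\infty$.
   Context: $G_{n,p}$ is the Erdős–Rényi random graph on $n$ vertices, each edge present independently with probability $p$. A subgraph is spanning if it contains all vertices. A planar graph of girth $g$ on $N$ vertices has at most $\frac{g}{g-2}(N-2)$ edges; it is called maximal when equality holds. A maximal planar bipartite graph on $N$ vertices is a planar bipartite graph (girth $4$) with exactly $2N-4$ edges. A threshold for a property $\mathcal{G}$ is a function $f(n)$ such that $p=o(f(n))$ implies $G_{n,p}\notin\mathcal{G}$ with probability tending to $1$, and $f(n)=o(p)$ implies $G_{n,p}\in\mathcal{G}$ with probability tending to $1$. *)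

theory Defs
  imports "HOL-Analysis.Analysis"
begin

definition simple_graph :: "'a set \<Rightarrow> 'a set set \<Rightarrow> bool" where
  "simple_graph V E \<longleftrightarrow> (\<forall>e\<in>E. e \<subseteq> V \<and> card e = 2)"

definition bipartite :: "'a set \<Rightarrow> 'a set set \<Rightarrow> bool" where
  "bipartite V E \<longleftrightarrow> (\<exists>A \<subseteq> V. \<forall>e\<in>E. card (e \<inter> A) = 1 \<and> card (e \<inter> (V - A)) = 1)"

definition planar :: "'a set \<Rightarrow> 'a set set \<Rightarrow> bool" where
  "planar V E \<longleftrightarrow>
     (\<exists>(pos :: 'a \<Rightarrow> complex) (\<gamma> :: 'a set \<Rightarrow> real \<Rightarrow> complex).
        inj_on pos V \<and>
        (\<forall>e\<in>E. arc (\<gamma> e) \<and> {pathstart (\<gamma> e), pathfinish (\<gamma> e)} = pos ` e) \<and>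
        (\<forall>e\<in>E. \<forall>v\<in>V. pos v \<in> path_image (\<gamma> e) \<longrightarrow> v \<in> e) \<and>
        (\<forall>e\<in>E. \<forall>e'\<in>E. e \<noteq> e' \<longrightarrow>
            path_image (\<gamma> e) \<inter> path_image (\<gamma> e') \<subseteq> pos ` (e \<inter> e')))"

definition maximal_planar_bipartite :: "'a set \<Rightarrow> 'a set set \<Rightarrow> bool" where
  "maximal_planar_bipartite V E \<longleftrightarrow>
     simple_graph V E \<and> planar V E \<and> bipartite V E \<and>
     int (card E) = 2 * int (card V) - 4"

definition has_spanning_mpb :: "'a set \<Rightarrow> 'a set set \<Rightarrow> bool" where
  "has_spanning_mpb V E \<longleftrightarrow> (\<exists>H \<subseteq> E. maximal_planar_bipartite V H)"

definition all_edges :: "nat \<Rightarrow> nat set set" where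
  "all_edges n = {{i, j} | i j. i < n \<and> j < n \<and> i \<noteq> j}"

definition gnp_prob :: "nat \<Rightarrow> real \<Rightarrow> (nat set set \<Rightarrow> bool) \<Rightarrow> real" where
  "gnp_prob n p P =
     (\<Sum>E\<in>Pow (all_edges n).
        if P E then p ^ card E * (1 - p) ^ (card (all_edges n) - card E) else 0)"

end

theory Submission
  imports Defs
begin

text \<open>
  Upper bound for the probability: a planar graph has no $K_6$ minor, because $K_{3,3}$ cannot be drawn
  in the plane. A graph without a $K_6$ minor can be shrunk by a constant factor, by contracting
  edges and identifying vertices with the same neighbourhood, and it is recovered from the smaller
  graph and the shrinking map with $O(n)$ bits. By induction there are at most $c^n n^n$ such graphs on $n$
  given vertices. Hence the expected number of spanning maximal planar bipartite subgraphs, which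
  have $2n - 4$ edges, is at most $c^n n^n p^{2n-4}$, and this tends to $0$ if $p^2 \<le> 1/(2cn)$.

  Lower bound: consider a sequence of pairs of vertices, consecutive pairs forming a $K_{2,2}$
  (these are nested quadrilaterals), and let every other vertex be joined to both vertices of one of
  the pairs. This graph is planar and bipartite with $2n - 4$ edges. Two such sequences (ladders) of linear length,
  starting from the same pair, are found greedily in two disjoint halves of the vertex set: a step
  fails with probability at most $2(1 - p^2)^{n/16}$. Every remaining vertex attaches to some pair of the ladder
  in the other half, through edges that have not been exposed yet.
\<close>

section \<open>Random subsets\<close>

text \<open>The order \<open>c^n n^n\<close> of the count is essential: choosing
  \<open>2n - 4\<close> arbitrary pairs of vertices gives about \<open>(cn)^(2n)\<close> edge sets,
  and a first moment with that number works only for \<open>p\<close> of order \<open>1/n\<close>.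
  The saving comes from the shrinking map. It fixes the surviving set \<open>U\<close>, so there are
  at most \<open>n^|V - U|\<close> such maps, and together with the inductive \<open>n^|U|\<close>
  this is exactly \<open>n^n\<close>. All other choices cost \<open>2^O(n)\<close>, which is
  affordable because \<open>|V - U|\<close> is a fixed fraction of \<open>n\<close>. The induction
  runs over graphs without a K_6 minor, not over planar graphs, since deletion and contraction then
  need no redrawing. With six branch sets, split three against three, only K_{3,3} has to be
  excluded in the plane. The factor \<open>(log n)^(1/2)\<close> in the other bound comes from union
  bounds: linearly many rungs and vertices must all succeed, each failing with probability
  \<open>(1 - p^2)^k\<close> up to a constant, \<open>k\<close> linear in \<open>n\<close>. Two
  ladders are used because the edges from a vertex to the ladder in its own half are already exposed
  when that ladder is found.\<close>

definition bernoulli_weight :: "real \<Rightarrow> 'e set \<Rightarrow> 'e set \<Rightarrow> real" where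
  "bernoulli_weight p X F = p ^ card F * (1 - p) ^ (card X - card F)"

definition subset_prob :: "real \<Rightarrow> 'e set \<Rightarrow> ('e set \<Rightarrow> bool) \<Rightarrow> real" where
  "subset_prob p X P = (\<Sum>F\<in>Pow X. if P F then bernoulli_weight p X F else 0)"

lemma gnp_prob_eq: "gnp_prob n p P = subset_prob p (all_edges n) P"
  by (simp add: gnp_prob_def subset_prob_def bernoulli_weight_def cong: if_cong)

lemma bernoulli_weight_nonneg: "0 \<le> p \<Longrightarrow> p \<le> 1 \<Longrightarrow> 0 \<le> bernoulli_weight p X F"
  by (simp add: bernoulli_weight_def)

lemma bernoulli_weight_Un:
  assumes "finite X" "finite Y" "X \<inter> Y = {}" "F \<subseteq> X" "G \<subseteq> Y"
  shows "bernoulli_weight p (X \<union> Y) (F \<union> G) = bernoulli_weight p X F * bernoulli_weight p Y G"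
proof -
  have fin: "finite F" "finite G" "F \<inter> G = {}"
    using assms finite_subset by auto
  have "card F \<le> card X" "card G \<le> card Y"
    using assms by (simp_all add: card_mono)
  then have "card X + card Y - (card F + card G) = (card X - card F) + (card Y - card G)"
    by simp
  then show ?thesis
    using assms fin by (simp add: bernoulli_weight_def card_Un_disjoint power_add)
qed

text \<open>Independence of disjoint edge sets, written as conditioning on the outcome
  \<open>F\<close> in \<open>X\<close>.\<close>

lemma subset_prob_Un:
  assumes "finite X" "finite Y" "X \<inter> Y = {}"
  shows "subset_prob p (X \<union> Y) P =
    (\<Sum>F\<in>Pow X. bernoulli_weight p X F * subset_prob p Y (\<lambda>G. P (F \<union> G)))"
proof -
  have inj: "inj_on (\<lambda>(F, G). F \<union> G) (Pow X \<times> Pow Y)"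
    using assms(3) by (auto simp: inj_on_def) blast+
  have img: "(\<lambda>(F, G). F \<union> G) ` (Pow X \<times> Pow Y) = Pow (X \<union> Y)"
  proof (intro equalityI subsetI)
    fix A assume "A \<in> Pow (X \<union> Y)"
    then show "A \<in> (\<lambda>(F, G). F \<union> G) ` (Pow X \<times> Pow Y)"
      by (intro image_eqI[of _ _ "(A \<inter> X, A \<inter> Y)"]) auto
  qed auto
  have "subset_prob p (X \<union> Y) P =
      (\<Sum>(F, G)\<in>Pow X \<times> Pow Y. if P (F \<union> G) then bernoulli_weight p (X \<union> Y) (F \<union> G) else 0)"
    unfolding subset_prob_def img[symmetric]
    by (subst sum.reindex[OF inj]) (auto simp: case_prod_unfold intro!: sum.cong)
  also have "\<dots> = (\<Sum>(F, G)\<in>Pow X \<times> Pow Y.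
      bernoulli_weight p X F * (if P (F \<union> G) then bernoulli_weight p Y G else 0))"
    using assms by (intro sum.cong) (auto simp: bernoulli_weight_Un)
  also have "\<dots> = (\<Sum>F\<in>Pow X. bernoulli_weight p X F * subset_prob p Y (\<lambda>G. P (F \<union> G)))"
    by (simp add: sum.cartesian_product[symmetric] subset_prob_def sum_distrib_left)
  finally show ?thesis .
qed

lemma sum_bernoulli_weight:
  assumes "finite X"
  shows "(\<Sum>F\<in>Pow X. bernoulli_weight p X F) = 1"
proof -
  have "(\<Sum>F\<in>Pow X. bernoulli_weight p X F) = (\<Sum>F\<in>Pow X. (\<Prod>e\<in>F. p) * (\<Prod>e\<in>X - F. 1 - p))"
    using assms
    by (intro sum.cong) (auto simp: bernoulli_weight_def card_Diff_subset finite_subset)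
  also have "\<dots> = (\<Prod>e\<in>X. p + (1 - p))"
    by (rule prod_add[OF assms, symmetric])
  finally show ?thesis by simp
qed

lemma subset_prob_True: "finite X \<Longrightarrow> subset_prob p X (\<lambda>_. True) = 1"
  by (simp add: subset_prob_def sum_bernoulli_weight)

lemma subset_prob_nonneg: "0 \<le> p \<Longrightarrow> p \<le> 1 \<Longrightarrow> 0 \<le> subset_prob p X P"
  by (auto simp: subset_prob_def bernoulli_weight_nonneg intro!: sum_nonneg)

lemma subset_prob_mono:
  assumes "0 \<le> p" "p \<le> 1" "\<And>F. F \<subseteq> X \<Longrightarrow> P F \<Longrightarrow> Q F"
  shows "subset_prob p X P \<le> subset_prob p X Q"
  unfolding subset_prob_def using assms by (intro sum_mono) (auto simp: bernoulli_weight_nonneg)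

lemma subset_prob_le_1: "finite X \<Longrightarrow> 0 \<le> p \<Longrightarrow> p \<le> 1 \<Longrightarrow> subset_prob p X P \<le> 1"
  using subset_prob_mono[of p X P "\<lambda>_. True"] by (simp add: subset_prob_True)

lemma subset_prob_not:
  "finite X \<Longrightarrow> subset_prob p X (\<lambda>F. \<not> P F) = 1 - subset_prob p X P"
  unfolding sum_bernoulli_weight[of X p, symmetric] subset_prob_def
  by (auto simp: sum_subtractf[symmetric] intro!: sum.cong)

lemma subset_prob_disj:
  assumes "0 \<le> p" "p \<le> 1"
  shows "subset_prob p X (\<lambda>F. P F \<or> Q F) \<le> subset_prob p X P + subset_prob p X Q"
  unfolding subset_prob_def sum.distrib[symmetric]
  using assms by (intro sum_mono) (auto simp: bernoulli_weight_nonneg)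

lemma subset_prob_Ex:
  assumes "0 \<le> p" "p \<le> 1" "finite I"
  shows "subset_prob p X (\<lambda>F. \<exists>i\<in>I. P i F) \<le> (\<Sum>i\<in>I. subset_prob p X (P i))"
  using assms(3)
proof (induction I)
  case empty
  then show ?case by (simp add: subset_prob_def)
next
  case (insert i I)
  have "subset_prob p X (\<lambda>F. P i F \<or> (\<exists>i\<in>I. P i F))
      \<le> subset_prob p X (P i) + subset_prob p X (\<lambda>F. \<exists>i\<in>I. P i F)"
    by (rule subset_prob_disj) (use assms in auto)
  then show ?case using insert by simp
qed

lemma subset_prob_subset:
  assumes "finite X" "H \<subseteq> X"
  shows "subset_prob p X (\<lambda>F. H \<subseteq> F) = p ^ card H"
proof -
  have fin: "finite H" "finite (X - H)" using assms finite_subset by auto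
  have "subset_prob p X (\<lambda>F. H \<subseteq> F) = subset_prob p (H \<union> (X - H)) (\<lambda>F. H \<subseteq> F)"
    using assms by (simp add: Un_absorb1)
  also have "\<dots> = (\<Sum>F\<in>Pow H. bernoulli_weight p H F * subset_prob p (X - H) (\<lambda>G. H \<subseteq> F \<union> G))"
    by (rule subset_prob_Un) (use fin in auto)
  also have "\<dots> = (\<Sum>F\<in>Pow H. if F = H then bernoulli_weight p H F else 0)"
  proof (intro sum.cong refl)
    fix F assume F: "F \<in> Pow H"
    have "subset_prob p (X - H) (\<lambda>G. H \<subseteq> F \<union> G) = (if F = H then 1 else 0)"
    proof (cases "F = H")
      case True
      then show ?thesis using fin by (simp add: subset_prob_True)
    next
      case False
      then have "\<not> H \<subseteq> F \<union> G" if "G \<subseteq> X - H" for G using F that by auto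
      then show ?thesis using False by (simp add: subset_prob_def sum.neutral)
    qed
    then show "bernoulli_weight p H F * subset_prob p (X - H) (\<lambda>G. H \<subseteq> F \<union> G) =
        (if F = H then bernoulli_weight p H F else 0)" by simp
  qed
  also have "\<dots> = p ^ card H" using fin by (simp add: bernoulli_weight_def)
  finally show ?thesis .
qed

text \<open>Two-round exposure: bad outcomes on \<open>X\<close> are charged in full, with
  conditional probability bounded by 1, and the others average to at most \<epsilon>. Both the
  search for rungs and the final attachment are run this way.\<close>

lemma subset_prob_le_cond:
  assumes "finite X" "finite Y" "X \<inter> Y = {}" "0 \<le> p" "p \<le> 1" "0 \<le> \<epsilon>"
    and good: "\<And>F. F \<subseteq> X \<Longrightarrow> \<not> B F \<Longrightarrow> subset_prob p Y (\<lambda>G. P (F \<union> G)) \<le> \<epsilon>"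
  shows "subset_prob p (X \<union> Y) P \<le> subset_prob p X B + \<epsilon>"
proof -
  have "subset_prob p (X \<union> Y) P \<le> (\<Sum>F\<in>Pow X. (if B F then bernoulli_weight p X F else 0)
      + bernoulli_weight p X F * \<epsilon>)"
    unfolding subset_prob_Un[OF assms(1-3)]
  proof (rule sum_mono)
    fix F assume F: "F \<in> Pow X"
    have w: "0 \<le> bernoulli_weight p X F" using assms by (simp add: bernoulli_weight_nonneg)
    show "bernoulli_weight p X F * subset_prob p Y (\<lambda>G. P (F \<union> G))
        \<le> (if B F then bernoulli_weight p X F else 0) + bernoulli_weight p X F * \<epsilon>"
    proof (cases "B F")
      case True
      have "bernoulli_weight p X F * subset_prob p Y (\<lambda>G. P (F \<union> G)) \<le> bernoulli_weight p X F * 1"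
        using w assms by (intro mult_left_mono subset_prob_le_1) auto
      moreover have "0 \<le> bernoulli_weight p X F * \<epsilon>" using w assms by simp
      ultimately show ?thesis using True by simp
    next
      case False
      then show ?thesis using good[of F] F w by (simp add: mult_left_mono)
    qed
  qed
  also have "\<dots> = subset_prob p X B + \<epsilon>"
    by (simp add: sum.distrib subset_prob_def sum_distrib_right[symmetric]
        sum_bernoulli_weight assms)
  finally show ?thesis .
qed

text \<open>Disjointness makes the events \<open>D i \<subseteq> F\<close> independent, each of
  probability \<open>p^2\<close>; the induction reveals one \<open>D i\<close> at a time. In the
  applications \<open>D i\<close> consists of the two edges joining a vertex to both members of a
  pair.\<close>

lemma subset_prob_no_pair:
  assumes "finite I" "finite X" "0 \<le> p" "p \<le> 1" "\<And>i. i \<in> I \<Longrightarrow> D i \<subseteq> X \<and> card (D i) = 2"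
    and "disjoint_family_on D I"
  shows "subset_prob p X (\<lambda>F. \<forall>i\<in>I. \<not> D i \<subseteq> F) \<le> (1 - p\<^sup>2) ^ card I"
  using assms(1,2,5,6)
proof (induction I arbitrary: X)
  case empty
  then show ?case by (simp add: subset_prob_True)
next
  case (insert i I)
  let ?Y = "X - D i"
  have Di: "D i \<subseteq> X" "card (D i) = 2" using insert.prems by auto
  have disj: "D j \<inter> D i = {}" if "j \<in> I" for j
    using insert.prems(3) insert.hyps(2) that unfolding disjoint_family_on_def
    by (metis insertCI)
  have IH: "subset_prob p ?Y (\<lambda>F. \<forall>j\<in>I. \<not> D j \<subseteq> F) \<le> (1 - p\<^sup>2) ^ card I"
    using insert.prems disj by (intro insert.IH) (auto simp: disjoint_family_on_def)
  have p2: "0 \<le> p\<^sup>2" "p\<^sup>2 \<le> 1" using assms by (simp_all add: power_le_one)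
  have finD: "finite (D i)" using Di insert.prems(1) finite_subset by blast
  have "subset_prob p (D i \<union> ?Y) (\<lambda>F. \<forall>j\<in>insert i I. \<not> D j \<subseteq> F)
     = (\<Sum>F\<in>Pow (D i). bernoulli_weight p (D i) F *
          subset_prob p ?Y (\<lambda>G. \<forall>j\<in>insert i I. \<not> D j \<subseteq> F \<union> G))"
    using insert.prems finD by (intro subset_prob_Un) auto
  also have "\<dots> \<le> (\<Sum>F\<in>Pow (D i).
      (if \<not> D i \<subseteq> F then bernoulli_weight p (D i) F else 0) * (1 - p\<^sup>2) ^ card I)"
  proof (rule sum_mono)
    fix F assume F: "F \<in> Pow (D i)"
    show "bernoulli_weight p (D i) F * subset_prob p ?Y (\<lambda>G. \<forall>j\<in>insert i I. \<not> D j \<subseteq> F \<union> G)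
       \<le> (if \<not> D i \<subseteq> F then bernoulli_weight p (D i) F else 0) * (1 - p\<^sup>2) ^ card I"
    proof (cases "D i \<subseteq> F")
      case True
      then have "subset_prob p ?Y (\<lambda>G. \<forall>j\<in>insert i I. \<not> D j \<subseteq> F \<union> G) = 0"
        unfolding subset_prob_def by (intro sum.neutral) auto
      then show ?thesis using True by simp
    next
      case False
      have "subset_prob p ?Y (\<lambda>G. \<forall>j\<in>insert i I. \<not> D j \<subseteq> F \<union> G)
          \<le> subset_prob p ?Y (\<lambda>G. \<forall>j\<in>I. \<not> D j \<subseteq> G)"
        by (rule subset_prob_mono) (use assms in auto)
      then show ?thesis using False IH
        by (simp add: mult_left_mono bernoulli_weight_nonneg assms)
    qed
  qed
  also have "\<dots> = subset_prob p (D i) (\<lambda>F. \<not> D i \<subseteq> F) * (1 - p\<^sup>2) ^ card I"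
    by (simp add: subset_prob_def sum_distrib_right)
  also have "subset_prob p (D i) (\<lambda>F. \<not> D i \<subseteq> F) = 1 - p\<^sup>2"
    using finD Di by (simp add: subset_prob_not subset_prob_subset)
  finally have "subset_prob p (D i \<union> ?Y) (\<lambda>F. \<forall>j\<in>insert i I. \<not> D j \<subseteq> F) \<le> (1 - p\<^sup>2) ^ Suc (card I)"
    by simp
  then show ?case using Di insert.hyps by (simp add: Un_absorb1)
qed

section \<open>Drawing nested quadrilaterals\<close>

lemma axis_segment_cases:
  fixes z :: complex and x y :: real
  assumes "z \<in> path_image (linepath (of_real x) (\<i> * of_real y))"
  obtains t where "0 \<le> t" "t \<le> 1" "Re z = (1 - t) * x" "Im z = t * y"
proof -
  obtain t where "0 \<le> t" "t \<le> 1" "z = (1 - t) *\<^sub>R of_real x + t *\<^sub>R (\<i> * of_real y)"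
    using assms by (auto simp: linepath_def path_image_def)
  then show ?thesis using that[of t] by simp
qed

text \<open>A common point with parameters \<open>t\<close> and \<open>s\<close> satisfies
  \<open>(1 - t) |x| = (1 - s) |x'|\<close> and \<open>t |y| = s |y'|\<close>. If
  \<open>0 < t < 1\<close>, nested intercepts force \<open>t \<le> s\<close> by the first equation
  and \<open>s \<le> t\<close> by the second, so the segments coincide. Only endpoints on the axes
  remain.\<close>

lemma axis_segments_Int:
  fixes z :: complex and x y x' y' :: real
  assumes nz: "x \<noteq> 0" "y \<noteq> 0" "x' \<noteq> 0" "y' \<noteq> 0" and ne: "(x, y) \<noteq> (x', y')"
    and z: "z \<in> path_image (linepath (of_real x) (\<i> * of_real y))"
      "z \<in> path_image (linepath (of_real x') (\<i> * of_real y'))"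
    and cmp: "\<bar>x\<bar> \<le> \<bar>x'\<bar> \<and> \<bar>y\<bar> \<le> \<bar>y'\<bar> \<or> \<bar>x'\<bar> \<le> \<bar>x\<bar> \<and> \<bar>y'\<bar> \<le> \<bar>y\<bar>"
  shows "x = x' \<and> z = of_real x \<or> y = y' \<and> z = \<i> * of_real y"
proof -
  have main: "x = x' \<and> z = of_real x \<or> y = y' \<and> z = \<i> * of_real y"
    if nz: "x \<noteq> 0" "y \<noteq> 0" "x' \<noteq> 0" "y' \<noteq> 0" and ne: "(x, y) \<noteq> (x', y')"
    and z: "z \<in> path_image (linepath (of_real x) (\<i> * of_real y))"
      "z \<in> path_image (linepath (of_real x') (\<i> * of_real y'))"
    and cmp: "\<bar>x\<bar> \<le> \<bar>x'\<bar>" "\<bar>y\<bar> \<le> \<bar>y'\<bar>" for x y x' y' :: real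
  proof -
    obtain t where t: "0 \<le> t" "t \<le> 1" "Re z = (1 - t) * x" "Im z = t * y"
      using axis_segment_cases[OF z(1)] .
    obtain s where s: "0 \<le> s" "s \<le> 1" "Re z = (1 - s) * x'" "Im z = s * y'"
      using axis_segment_cases[OF z(2)] .
    have eqs: "(1 - t) * x = (1 - s) * x'" "t * y = s * y'" using t s by auto
    consider "t = 0" | "t = 1" | "0 < t" "t < 1" using t by linarith
    then show ?thesis
    proof cases
      case 1
      then have "s = 0" using eqs nz by auto
      then show ?thesis using 1 eqs t by (auto simp: complex_eq_iff)
    next
      case 2
      then have "s = 1" using eqs nz by auto
      then show ?thesis using 2 eqs t by (auto simp: complex_eq_iff)
    next
      case 3
      have abs: "(1 - t) * \<bar>x\<bar> = (1 - s) * \<bar>x'\<bar>" "t * \<bar>y\<bar> = s * \<bar>y'\<bar>"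
        using arg_cong[OF eqs(1), of abs] arg_cong[OF eqs(2), of abs] 3 s
        by (auto simp: abs_mult)
      have pos: "0 < s" "s < 1"
        using 3 eqs nz s by (auto simp: less_le)
      have "(1 - s) * \<bar>x'\<bar> \<le> (1 - t) * \<bar>x'\<bar>"
        unfolding abs(1)[symmetric] using cmp 3 by (intro mult_left_mono) auto
      then have "t \<le> s" using nz by simp
      have "s * \<bar>y'\<bar> \<le> t * \<bar>y'\<bar>"
        unfolding abs(2)[symmetric] using cmp 3 by (intro mult_left_mono) auto
      then have "s \<le> t" using nz by simp
      then have "s = t" using \<open>t \<le> s\<close> by simp
      then have "x = x'" "y = y'" using eqs 3 by auto
      then show ?thesis using ne by simp
    qed
  qed
  show ?thesis
    using cmp main[OF nz ne z] main[OF nz(3,4,1,2) ne[symmetric] z(2,1)] by auto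
qed

text \<open>A vertex of level $l$ is placed on the real or the imaginary axis, according to the parity of
  $l$, at distance in $(l, l + 1]$ from the origin; edges are straight. Within a quadrant the
  segments are ordered by their intercepts, so they can only meet on an axis.\<close>
lemma planar_axis_drawing:
  fixes lev :: "'a \<Rightarrow> nat" and r :: "'a \<Rightarrow> real"
  assumes inj: "inj_on (\<lambda>v. (lev v, r v)) V"
    and r: "\<And>v. v \<in> V \<Longrightarrow> real (lev v) < \<bar>r v\<bar> \<and> \<bar>r v\<bar> \<le> real (lev v) + 1"
    and E: "\<And>e. e \<in> E \<Longrightarrow> \<exists>c\<in>V. \<exists>v\<in>V. e = {c, v} \<and> lev v = Suc (lev c) \<and> \<bar>r c\<bar> = real (lev v)"
  shows "planar V E"
proof -
  define pos where "pos v = (if even (lev v) then of_real (r v) else \<i> * of_real (r v))" for v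
  \<comment> \<open>\<open>X e\<close> and \<open>Y e\<close> are the endpoints of \<open>e\<close>
    on the real and on the imaginary axis; adjacent levels have different parity, so each edge has
    exactly one of both.\<close>
  define X where "X e = (THE v. v \<in> e \<and> even (lev v))" for e
  define Y where "Y e = (THE v. v \<in> e \<and> odd (lev v))" for e
  define \<gamma> where "\<gamma> e = linepath (complex_of_real (r (X e))) (\<i> * of_real (r (Y e)))" for e
  have nz: "r v \<noteq> 0" if "v \<in> V" for v using r[OF that] by auto
  have inj_pos: "v = w" if "v \<in> V" "w \<in> V" "pos v = pos w" for v w
  proof -
    have *: "even (lev v) = even (lev w)" "r v = r w"
      using that nz[of v] nz[of w] by (auto simp: pos_def complex_eq_iff split: if_splits)
    then have "real (lev v) < real (lev w) + 1" "real (lev w) < real (lev v) + 1"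
      using r[OF that(1)] r[OF that(2)] by auto
    then have "lev v = lev w" by linarith
    then show ?thesis using inj * that by (auto simp: inj_on_def)
  qed
  have XY: "X e \<in> V \<and> Y e \<in> V \<and> e = {X e, Y e} \<and> even (lev (X e)) \<and> odd (lev (Y e)) \<and>
      (lev (Y e) = Suc (lev (X e)) \<and> \<bar>r (X e)\<bar> = real (lev (Y e)) \<or>
       lev (X e) = Suc (lev (Y e)) \<and> \<bar>r (Y e)\<bar> = real (lev (X e)))" if "e \<in> E" for e
  proof -
    obtain c v where cv: "c \<in> V" "v \<in> V" "e = {c, v}" "lev v = Suc (lev c)" "\<bar>r c\<bar> = real (lev v)"
      using E[OF \<open>e \<in> E\<close>] by blast
    show ?thesis
    proof (cases "even (lev c)")
      case True
      then have "X e = c" "Y e = v" unfolding X_def Y_def using cv by auto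
      then show ?thesis using True cv by auto
    next
      case False
      then have "X e = v" "Y e = c" unfolding X_def Y_def using cv by auto
      then show ?thesis using False cv by auto
    qed
  qed
  have XY_lev: "lev (Y e) = Suc (lev (X e)) \<and> \<bar>r (X e)\<bar> = real (lev (Y e)) \<or>
       lev (X e) = Suc (lev (Y e)) \<and> \<bar>r (Y e)\<bar> = real (lev (X e))" if "e \<in> E" for e
    using XY[OF that] by blast
  have pX: "pos (X e) = of_real (r (X e))" and pY: "pos (Y e) = \<i> * of_real (r (Y e))"
    if "e \<in> E" for e using XY[OF that] by (auto simp: pos_def)
  have arc: "arc (\<gamma> e)" if "e \<in> E" for e
    using XY[OF that] nz by (auto simp: \<gamma>_def complex_eq_iff intro!: arc_linepath)
  have ends: "{pathstart (\<gamma> e), pathfinish (\<gamma> e)} = pos ` e" if "e \<in> E" for e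
  proof -
    have "pos ` e = pos ` {X e, Y e}" using XY[OF that] by metis
    then show ?thesis using pX[OF that] pY[OF that] by (simp add: \<gamma>_def)
  qed
  have inc: "v \<in> e" if "e \<in> E" "v \<in> V" and pv: "pos v \<in> path_image (\<gamma> e)" for e v
  proof -
    obtain t where t: "0 \<le> t" "t \<le> 1" "Re (pos v) = (1 - t) * r (X e)" "Im (pos v) = t * r (Y e)"
      using pv unfolding \<gamma>_def by (rule axis_segment_cases)
    note nzs = nz[OF that(2)] XY[OF that(1)]
    have "pos v = pos (X e) \<or> pos v = pos (Y e)"
      unfolding pX[OF that(1)] pY[OF that(1)] using t nzs nz
      by (auto simp: pos_def complex_eq_iff split: if_splits)
    then show ?thesis using inj_pos[OF that(2)] XY[OF that(1)] by (metis insertCI)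
  qed
  have cross: "path_image (\<gamma> e) \<inter> path_image (\<gamma> e') \<subseteq> pos ` (e \<inter> e')"
    if e: "e \<in> E" "e' \<in> E" "e \<noteq> e'" for e e'
  proof
    fix z assume z: "z \<in> path_image (\<gamma> e) \<inter> path_image (\<gamma> e')"
    note 1 = XY[OF e(1)] and 2 = XY[OF e(2)]
    have V: "X e \<in> V" "Y e \<in> V" "X e' \<in> V" "Y e' \<in> V" using 1 2 by auto
    have ne: "(r (X e), r (Y e)) \<noteq> (r (X e'), r (Y e'))"
    proof
      assume "(r (X e), r (Y e)) = (r (X e'), r (Y e'))"
      then have "pos (X e) = pos (X e')" "pos (Y e) = pos (Y e')" using pX pY e by auto
      then show False using 1 2 e(3) inj_pos V by metis
    qed
    \<comment> \<open>An edge whose lower level is \<open>m\<close> has inner radius exactly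
      \<open>m + 1\<close> and outer radius in \<open>(m + 1, m + 2]\<close>. So for
      \<open>m < m'\<close> both radii of \<open>e\<close> are at most \<open>m' + 1\<close>. For
      \<open>m = m'\<close> parity puts the inner endpoints on the same axis with equal radii, and
      the outer radii decide.\<close>
    have cmp: "\<bar>r (X e)\<bar> \<le> \<bar>r (X e')\<bar> \<and> \<bar>r (Y e)\<bar> \<le> \<bar>r (Y e')\<bar> \<or>
        \<bar>r (X e')\<bar> \<le> \<bar>r (X e)\<bar> \<and> \<bar>r (Y e')\<bar> \<le> \<bar>r (Y e)\<bar>"
    proof -
      define m m' where "m = min (lev (X e)) (lev (Y e))" and "m' = min (lev (X e')) (lev (Y e'))"
      consider "m < m'" | "m' < m" | "m = m'" by linarith
      then show ?thesis
      proof cases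
        case 1
        then show ?thesis using XY_lev[OF e(1)] XY_lev[OF e(2)] r[OF V(1)] r[OF V(2)] r[OF V(3)] r[OF V(4)]
          unfolding m_def m'_def by (auto split: if_splits)
      next
        case 2
        then show ?thesis using XY_lev[OF e(1)] XY_lev[OF e(2)] r[OF V(1)] r[OF V(2)] r[OF V(3)] r[OF V(4)]
          unfolding m_def m'_def by (auto split: if_splits)
      next
        case 3
        moreover have "even (lev (X e))" "odd (lev (Y e))" "even (lev (X e'))" "odd (lev (Y e'))"
          using XY e by blast+
        ultimately have "lev (X e) = lev (X e')" "lev (Y e) = lev (Y e')"
          using XY_lev[OF e(1)] XY_lev[OF e(2)] unfolding m_def m'_def
          by (auto simp: min_def split: if_splits)
        then show ?thesis using XY_lev[OF e(1)] XY_lev[OF e(2)] by linarith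
      qed
    qed
    have "r (X e) = r (X e') \<and> z = of_real (r (X e)) \<or> r (Y e) = r (Y e') \<and> z = \<i> * of_real (r (Y e))"
      by (rule axis_segments_Int) (use z ne cmp nz V in \<open>auto simp: \<gamma>_def\<close>)
    then have "pos (X e) = pos (X e') \<and> z = pos (X e) \<or> pos (Y e) = pos (Y e') \<and> z = pos (Y e)"
      using pX pY e by auto
    then have "X e = X e' \<and> z = pos (X e) \<or> Y e = Y e' \<and> z = pos (Y e)"
      using inj_pos V by blast
    then show "z \<in> pos ` (e \<inter> e')" using 1 2 by (metis IntI image_eqI insertCI)
  qed
  show ?thesis
    unfolding planar_def using inj_pos arc ends inc cross
    by (intro exI[of _ pos] exI[of _ \<gamma>]) (auto simp: inj_on_def)
qed

text \<open>The layer $j$ is the pair $a_j, b_j$, at level $j$. Every vertex of level $j + 1$, be it in the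
  next layer or not, is joined to both $a_j$ and $b_j$; this gives two edges for each vertex outside
  the first layer.\<close>
lemma has_spanning_mpb_layers:
  fixes a b :: "nat \<Rightarrow> 'a" and lev :: "'a \<Rightarrow> nat" and r :: "'a \<Rightarrow> real"
  assumes fin: "finite V"
    and inj: "inj_on (\<lambda>v. (lev v, r v)) V"
    and r: "\<And>v. v \<in> V \<Longrightarrow> real (lev v) < \<bar>r v\<bar> \<and> \<bar>r v\<bar> \<le> real (lev v) + 1"
    and a: "\<And>j. j < K \<Longrightarrow> a j \<in> V \<and> lev (a j) = j \<and> r (a j) = real (Suc j)"
    and b: "\<And>j. j < K \<Longrightarrow> b j \<in> V \<and> lev (b j) = j \<and> r (b j) = - real (Suc j)"
    and lev: "\<And>v. v \<in> V \<Longrightarrow> lev v \<le> K"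
    and lev0: "{v \<in> V. lev v = 0} = {a 0, b 0}" and K: "0 < K"
    and E: "\<And>v j. v \<in> V \<Longrightarrow> lev v = Suc j \<Longrightarrow> {a j, v} \<in> E \<and> {b j, v} \<in> E"
  shows "has_spanning_mpb V E"
proof -
  define W where "W = {v \<in> V. lev v \<noteq> 0}"
  define f where "f = (\<lambda>(c, v). {c (lev v - 1), v})"
  define H where "H = f ` ({a, b} \<times> W)"
  have jW: "lev v - 1 < K" "Suc (lev v - 1) = lev v" "v \<in> V" if "v \<in> W" for v
    using that lev[of v] K by (auto simp: W_def)
  have H: "\<exists>c\<in>V. \<exists>v\<in>V. e = {c, v} \<and> lev v = Suc (lev c) \<and> \<bar>r c\<bar> = real (lev v)" if "e \<in> H" for e
  proof -
    obtain c v where cv: "c = a \<or> c = b" "v \<in> W" "e = {c (lev v - 1), v}"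
      using \<open>e \<in> H\<close> by (auto simp: H_def f_def)
    show ?thesis
      using cv jW[of v] a[of "lev v - 1"] b[of "lev v - 1"]
      by (intro bexI[of _ "c (lev v - 1)"] bexI[of _ v]) auto
  qed
  have ab: "a j \<noteq> b j" if "j < K" for j using a[OF that] b[OF that] by auto
  then have "a \<noteq> b" using K by auto
  \<comment> \<open>The upper endpoint of an edge is recognised by its level, and
    \<open>a j \<noteq> b j\<close> then recovers the lower one. Hence \<open>H\<close> has exactly
    two edges for each vertex of \<open>W\<close>.\<close>
  have injf: "inj_on f ({a, b} \<times> W)"
  proof (rule inj_onI, clarsimp simp only: mem_Times_iff split_paired_all fst_conv snd_conv)
    fix c v c' v' assume cv: "c \<in> {a, b}" "v \<in> W" "c' \<in> {a, b}" "v' \<in> W" "f (c, v) = f (c', v')"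
    have l: "lev (c (lev v - 1)) = lev v - 1" "lev (c' (lev v' - 1)) = lev v' - 1"
      using cv jW a b by auto
    have "v = v'"
      using cv(5) l jW(2)[OF cv(2)] jW(2)[OF cv(4)] unfolding f_def
      by (auto simp: doubleton_eq_iff)
    moreover have "c (lev v - 1) = c' (lev v - 1)"
      using cv(5) calculation by (auto simp: f_def doubleton_eq_iff)
    then have "c = c'" using cv ab[OF jW(1)[OF cv(2)]] by auto
    ultimately show "c = c' \<and> v = v'" by simp
  qed
  have "card V = 2 + card W"
  proof -
    have "V = {a 0, b 0} \<union> W" unfolding W_def lev0[symmetric] by blast
    moreover have "{a 0, b 0} \<inter> W = {}" unfolding W_def lev0[symmetric] by blast
    moreover have "card {a 0, b 0} = 2" using ab[OF K] by simp
    moreover have "finite W" using fin by (simp add: W_def)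
    ultimately show ?thesis using card_Un_disjoint[of "{a 0, b 0}" W] by simp
  qed
  then have card: "int (card H) = 2 * int (card V) - 4"
    using \<open>a \<noteq> b\<close> by (simp add: H_def card_image[OF injf] card_cartesian_product)
  have sub: "H \<subseteq> E"
  proof
    fix e assume "e \<in> H"
    then obtain c v where cv: "c = a \<or> c = b" "v \<in> W" "e = {c (lev v - 1), v}"
      by (auto simp: H_def f_def)
    then show "e \<in> E" using E[OF jW(3) jW(2)[symmetric], OF cv(2,2)] by auto
  qed
  have simple: "simple_graph V H"
    unfolding simple_graph_def
  proof
    fix e assume "e \<in> H"
    from H[OF this] obtain c v where cv: "c\<in>V" "v\<in>V" "e = {c, v}" "lev v = Suc (lev c)" by blast
    then have "c \<noteq> v" by auto
    then show "e \<subseteq> V \<and> card e = 2" using cv by auto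
  qed
  have bip: "bipartite V H"
    unfolding bipartite_def
  proof (intro exI[of _ "{v \<in> V. even (lev v)}"] conjI ballI)
    fix e assume "e \<in> H"
    from H[OF this] obtain c v where cv: "c\<in>V" "v\<in>V" "e = {c, v}" "lev v = Suc (lev c)" by blast
    show "card (e \<inter> {v \<in> V. even (lev v)}) = 1"
    proof (cases "even (lev c)")
      case True then have "e \<inter> {v \<in> V. even (lev v)} = {c}" using cv by auto
      then show ?thesis by simp
    next
      case False then have "e \<inter> {v \<in> V. even (lev v)} = {v}" using cv by auto
      then show ?thesis by simp
    qed
    show "card (e \<inter> (V - {v \<in> V. even (lev v)})) = 1"
    proof (cases "even (lev c)")
      case True then have "e \<inter> (V - {v \<in> V. even (lev v)}) = {v}" using cv by auto
      then show ?thesis by simp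
    next
      case False then have "e \<inter> (V - {v \<in> V. even (lev v)}) = {c}" using cv by auto
      then show ?thesis by simp
    qed
  qed auto
  have "planar V H" using inj r H by (rule planar_axis_drawing)
  then show ?thesis
    unfolding has_spanning_mpb_def maximal_planar_bipartite_def
    using sub simple bip card by blast
qed

text \<open>Supplies coordinates for purely combinatorial data: the pair \<open>j\<close> goes to
  level \<open>j\<close> at the signed radii \<open>j + 1\<close> and \<open>-(j + 1)\<close>, and
  any other vertex goes one level above the pair \<open>par v\<close> that it is attached
  to.\<close>

lemma has_spanning_mpb_attach:
  fixes a b :: "nat \<Rightarrow> 'a"
  assumes fin: "finite V" and K: "0 < K"
    and inj: "inj_on a {..<K}" "inj_on b {..<K}" and disj: "a ` {..<K} \<inter> b ` {..<K} = {}"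
    and sub: "a ` {..<K} \<subseteq> V" "b ` {..<K} \<subseteq> V"
    and lad: "\<And>j. Suc j < K \<Longrightarrow> {a j, a (Suc j)} \<in> E \<and> {b j, a (Suc j)} \<in> E \<and>
                {a j, b (Suc j)} \<in> E \<and> {b j, b (Suc j)} \<in> E"
    and att: "\<And>v. v \<in> V \<Longrightarrow> v \<notin> a ` {..<K} \<Longrightarrow> v \<notin> b ` {..<K} \<Longrightarrow>
                \<exists>j<K. {a j, v} \<in> E \<and> {b j, v} \<in> E"
  shows "has_spanning_mpb V E"
proof -
  let ?A = "a ` {..<K}" and ?B = "b ` {..<K}"
  obtain g :: "'a \<Rightarrow> nat" where g: "inj_on g V"
    using finite_imp_inj_to_nat_seg[OF fin] by blast
  \<comment> \<open>Distinct offsets strictly between 0 and 1 separate the attached vertices of a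
    level from each other and from the ladder vertex at offset 1.\<close>
  define t where "t v = 1 / (real (g v) + 2)" for v
  have t: "0 < t v" "t v < 1" for v by (simp_all add: t_def)
  have t_inj: "v = w" if "v \<in> V" "w \<in> V" "t v = t w" for v w
    using that g by (auto simp: t_def inj_on_def)
  obtain par where par: "\<And>v. v \<in> V \<Longrightarrow> v \<notin> ?A \<Longrightarrow> v \<notin> ?B \<Longrightarrow>
      par v < K \<and> {a (par v), v} \<in> E \<and> {b (par v), v} \<in> E"
    using att by metis
  define lev where "lev v = (if v \<in> ?A then the_inv_into {..<K} a v
      else if v \<in> ?B then the_inv_into {..<K} b v else Suc (par v))" for v
  define r where "r v = (if v \<in> ?A then real (Suc (lev v))
      else if v \<in> ?B then - real (Suc (lev v)) else real (lev v) + t v)" for v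
  have la: "lev (a j) = j \<and> r (a j) = real (Suc j)" if "j < K" for j
    using that inj by (simp add: lev_def r_def the_inv_into_f_f)
  have lb: "lev (b j) = j \<and> r (b j) = - real (Suc j)" if "j < K" for j
  proof -
    have "b j \<notin> ?A" "b j \<in> ?B" using that disj by blast+
    then show ?thesis using that inj by (simp add: lev_def r_def the_inv_into_f_f)
  qed
  have lo: "lev v = Suc (par v) \<and> r v = real (lev v) + t v" if "v \<notin> ?A" "v \<notin> ?B" for v
    using that by (simp add: lev_def r_def)
  have cases: "(\<exists>j<K. v = a j) \<or> (\<exists>j<K. v = b j) \<or> (v \<in> V \<and> v \<notin> ?A \<and> v \<notin> ?B)" if "v \<in> V" for v
    using that by auto
  have r: "real (lev v) < \<bar>r v\<bar> \<and> \<bar>r v\<bar> \<le> real (lev v) + 1" if "v \<in> V" for v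
    using cases[OF that] la lb lo[of v] t[of v] by auto
  have pos: "r v = real (lev v) + 1 \<longleftrightarrow> v \<in> ?A" if "v \<in> V" for v
    using cases[OF that] la lb lo[of v] t[of v] disj by auto
  have neg: "r v < 0 \<longleftrightarrow> v \<in> ?B" if "v \<in> V" for v
    using cases[OF that] la lb lo[of v] t[of v] disj by auto
  have injr: "inj_on (\<lambda>v. (lev v, r v)) V"
  proof (rule inj_onI)
    fix v w assume vw: "v \<in> V" "w \<in> V" "(lev v, r v) = (lev w, r w)"
    then have "v \<in> ?A \<longleftrightarrow> w \<in> ?A" "v \<in> ?B \<longleftrightarrow> w \<in> ?B"
      using pos[of v] pos[of w] neg[of v] neg[of w] by auto
    then consider "v \<in> ?A" "w \<in> ?A" | "v \<in> ?B" "w \<in> ?B" | "v \<notin> ?A" "v \<notin> ?B" "w \<notin> ?A" "w \<notin> ?B"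
      by blast
    then show "v = w"
    proof cases
      case 1
      then show ?thesis using la vw by auto
    next
      case 2
      then show ?thesis using lb vw by auto
    next
      case 3
      then show ?thesis using lo[of v] lo[of w] vw t_inj by auto
    qed
  qed
  show ?thesis
  proof (rule has_spanning_mpb_layers[OF fin injr r])
    show "a j \<in> V \<and> lev (a j) = j \<and> r (a j) = real (Suc j)" if "j < K" for j
      using that la sub by auto
    show "b j \<in> V \<and> lev (b j) = j \<and> r (b j) = - real (Suc j)" if "j < K" for j
      using that lb sub by auto
    show "lev v \<le> K" if "v \<in> V" for v
      using cases[OF that] la lb lo[of v] par[of v] by fastforce
    show "{v \<in> V. lev v = 0} = {a 0, b 0}"
    proof (intro equalityI subsetI)
      fix v assume "v \<in> {v \<in> V. lev v = 0}"
      then show "v \<in> {a 0, b 0}" using cases[of v] la lb lo[of v] by auto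
    next
      fix v assume "v \<in> {a 0, b 0}"
      then show "v \<in> {v \<in> V. lev v = 0}" using la lb sub K by auto
    qed
    show "{a j, v} \<in> E \<and> {b j, v} \<in> E" if "v \<in> V" "lev v = Suc j" for v j
      using cases[OF that(1)]
    proof (elim disjE)
      assume "\<exists>j<K. v = a j" then show ?thesis using la lad[of j] that(2) by auto
    next
      assume "\<exists>j<K. v = b j" then show ?thesis using lb lad[of j] that(2) by auto
    next
      assume "v \<in> V \<and> v \<notin> ?A \<and> v \<notin> ?B" then show ?thesis using lo[of v] par[of v] that(2) by auto
    qed
  qed (use K in auto)
qed

section \<open>Ladders in the random graph\<close>

text \<open>The ranges start at 1 because the pair of index 0 is the common starting pair of both
  ladders and lies outside \<open>A\<close> and \<open>B\<close>.\<close>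

definition ladder :: "nat \<Rightarrow> (nat \<Rightarrow> 'a) \<Rightarrow> (nat \<Rightarrow> 'a) \<Rightarrow> 'a set \<Rightarrow> 'a set \<Rightarrow> 'a set set \<Rightarrow> bool" where
  "ladder k x y A B F \<longleftrightarrow> x ` {1..k} \<subseteq> A \<and> y ` {1..k} \<subseteq> B \<and> inj_on x {1..k} \<and> inj_on y {1..k} \<and>
     (\<forall>j<k. {x j, x (Suc j)} \<in> F \<and> {y j, x (Suc j)} \<in> F \<and>
            {x j, y (Suc j)} \<in> F \<and> {y j, y (Suc j)} \<in> F)"

lemma ladder_mono: "ladder k x y A B F \<Longrightarrow> F \<subseteq> F' \<Longrightarrow> ladder k x y A B F'"
  unfolding ladder_def by blast

text \<open>The new pair is put in front, so that a random search can begin by exposing the edges at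
  the starting pair. The old starting pair becomes rung 1; the rest of the old ladder must avoid it
  to keep injectivity.\<close>

lemma ladder_Suc:
  assumes "ladder k x y (A - {x 0}) (B - {y 0}) F" "x 0 \<in> A" "y 0 \<in> B"
    and "{a, x 0} \<in> F" "{b, x 0} \<in> F" "{a, y 0} \<in> F" "{b, y 0} \<in> F"
  shows "ladder (Suc k) (case_nat a x) (case_nat b y) A B F"
proof -
  have im: "case_nat c z ` {1..Suc k} = insert (z 0) (z ` {1..k})" for c and z :: "nat \<Rightarrow> 'a"
  proof -
    have "{1..Suc k} = Suc ` {0..k}" by (simp add: image_Suc_atLeastAtMost)
    also have "{0..k} = insert 0 {1..k}" by auto
    finally have eq: "{1..Suc k} = Suc ` insert 0 {1..k}" .
    show ?thesis unfolding eq by (simp only: image_image nat.case image_insert)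
  qed
  have inj: "inj_on (case_nat c z) {1..Suc k}" if "inj_on z {1..k}" "z 0 \<notin> z ` {1..k}"
    for c and z :: "nat \<Rightarrow> 'a"
  proof -
    have eq: "{0..k} = insert 0 {1..k}" by auto
    have "inj_on z {0..k}" unfolding eq using that by (subst inj_on_insert) auto
    then have "inj_on (case_nat c z \<circ> Suc) {0..k}" by (simp add: inj_on_def)
    then have "inj_on (case_nat c z) (Suc ` {0..k})" by (rule inj_on_imageI)
    then show ?thesis by (simp add: image_Suc_atLeastAtMost)
  qed
  show ?thesis
    unfolding ladder_def im using assms unfolding ladder_def
    by (intro conjI inj allI impI) (auto split: nat.split)
qed

text \<open>Exposing the edges at $a$ and $b$ determines the next rung; the edges inside $A \<union> B$ remain
  fresh, so the argument can be repeated.\<close>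
lemma subset_prob_no_ladder:
  assumes "0 \<le> p" "p \<le> 1" "finite X" "finite A" "finite B"
    and "a \<noteq> b" "A \<inter> B = {}" "{a, b} \<inter> (A \<union> B) = {}"
    and "m + k \<le> card A" "m + k \<le> card B"
    and "\<And>u v. u \<in> {a, b} \<union> A \<union> B \<Longrightarrow> v \<in> A \<union> B \<Longrightarrow> u \<noteq> v \<Longrightarrow> {u, v} \<in> X"
  shows "subset_prob p X (\<lambda>F. \<not> (\<exists>x y. x 0 = a \<and> y 0 = b \<and> ladder k x y A B F))
     \<le> 2 * real k * (1 - p\<^sup>2) ^ m"
  using assms(3-)
proof (induction k arbitrary: X A B a b)
  case 0
  have "ladder 0 (\<lambda>_. a) (\<lambda>_. b) A B F" for F by (simp add: ladder_def)
  then have "\<exists>x y. x 0 = a \<and> y 0 = b \<and> ladder 0 x y A B F" for F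
    by (metis (full_types))
  then have "subset_prob p X (\<lambda>F. \<not> (\<exists>x y. x 0 = a \<and> y 0 = b \<and> ladder 0 x y A B F)) = 0"
    unfolding subset_prob_def by (intro sum.neutral) auto
  then show ?case by simp
next
  case (Suc k)
  let ?q = "1 - p\<^sup>2"
  let ?D = "\<lambda>v. {{a, v}, {b, v}}"
  have q: "0 \<le> ?q" "?q \<le> 1" using assms(1,2) by (simp_all add: power_le_one)
  define Xs where "Xs = (\<Union>v\<in>A \<union> B. ?D v)"
  have XsX: "Xs \<subseteq> X" using Suc.prems(9) Suc.prems(6) unfolding Xs_def by auto
  define bad where "bad F \<longleftrightarrow> (\<forall>v\<in>A. \<not> ?D v \<subseteq> F) \<or> (\<forall>v\<in>B. \<not> ?D v \<subseteq> F)" for F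
  have finXs: "finite Xs" using XsX Suc.prems(1) finite_subset by blast
  \<comment> \<open>Each rung uses up one vertex of \<open>A\<close> and one of \<open>B\<close>, so
    with \<open>m + k\<close> vertices at the beginning there are at least \<open>m\<close>
    candidates on both sides at every step.\<close>
  have no: "subset_prob p Xs (\<lambda>F. \<forall>v\<in>C. \<not> ?D v \<subseteq> F) \<le> ?q ^ m"
    if C: "C \<subseteq> A \<union> B" "m + Suc k \<le> card C" for C
  proof -
    have finC: "finite C" using C Suc.prems finite_subset by blast
    have "subset_prob p Xs (\<lambda>F. \<forall>v\<in>C. \<not> ?D v \<subseteq> F) \<le> ?q ^ card C"
    proof (rule subset_prob_no_pair[OF finC finXs assms(1,2)])
      show "?D v \<subseteq> Xs \<and> card (?D v) = 2" if "v \<in> C" for v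
        using that C Suc.prems by (auto simp: Xs_def doubleton_eq_iff card_insert_if)
      show "disjoint_family_on ?D C"
        using C Suc.prems(6) unfolding disjoint_family_on_def
        by (fastforce simp: doubleton_eq_iff)
    qed
    also have "\<dots> \<le> ?q ^ m" using q C(2) by (intro power_decreasing) auto
    finally show ?thesis .
  qed
  have "subset_prob p (Xs \<union> (X - Xs))
      (\<lambda>F. \<not> (\<exists>x y. x 0 = a \<and> y 0 = b \<and> ladder (Suc k) x y A B F))
     \<le> subset_prob p Xs bad + 2 * real k * ?q ^ m"
  proof (rule subset_prob_le_cond)
    fix F assume F: "F \<subseteq> Xs" "\<not> bad F"
    then obtain v w where vw: "v \<in> A" "?D v \<subseteq> F" "w \<in> B" "?D w \<subseteq> F"
      unfolding bad_def by blast
    have "subset_prob p (X - Xs)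
        (\<lambda>G. \<not> (\<exists>x y. x 0 = a \<and> y 0 = b \<and> ladder (Suc k) x y A B (F \<union> G)))
      \<le> subset_prob p (X - Xs)
        (\<lambda>G. \<not> (\<exists>x y. x 0 = v \<and> y 0 = w \<and> ladder k x y (A - {v}) (B - {w}) G))"
    proof (rule subset_prob_mono[OF assms(1,2)], erule contrapos_nn, elim exE conjE)
      fix G x y assume G: "x 0 = v" "y 0 = w" "ladder k x y (A - {v}) (B - {w}) G"
      have "ladder (Suc k) (case_nat a x) (case_nat b y) A B (F \<union> G)"
        using ladder_mono[OF G(3), of "F \<union> G"] vw G(1,2) by (intro ladder_Suc) auto
      then show "\<exists>x y. x 0 = a \<and> y 0 = b \<and> ladder (Suc k) x y A B (F \<union> G)"
        by (intro exI[of _ "case_nat a x"] exI[of _ "case_nat b y"]) auto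
    qed
    also have "\<dots> \<le> 2 * real k * ?q ^ m"
    proof (rule Suc.IH)
      show "v \<noteq> w" "(A - {v}) \<inter> (B - {w}) = {}" "{v, w} \<inter> (A - {v} \<union> (B - {w})) = {}"
        using vw Suc.prems by auto
      show "m + k \<le> card (A - {v})" "m + k \<le> card (B - {w})"
        using vw Suc.prems by (simp_all add: card_Diff_singleton)
      show "{u', v'} \<in> X - Xs" if "u' \<in> {v, w} \<union> (A - {v}) \<union> (B - {w})"
        "v' \<in> A - {v} \<union> (B - {w})" "u' \<noteq> v'" for u' v'
      proof -
        have in': "u' \<in> A \<union> B" "v' \<in> A \<union> B" using that vw by auto
        then have "{u', v'} \<in> X" using Suc.prems(9) that(3) by auto
        moreover have "{u', v'} \<notin> Xs"
          using in' Suc.prems(6) by (auto simp: Xs_def doubleton_eq_iff)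
        ultimately show ?thesis by simp
      qed
    qed (use Suc.prems in auto)
    finally show "subset_prob p (X - Xs)
        (\<lambda>G. \<not> (\<exists>x y. x 0 = a \<and> y 0 = b \<and> ladder (Suc k) x y A B (F \<union> G)))
      \<le> 2 * real k * ?q ^ m" .
  qed (use Suc.prems finXs assms q in auto)
  also have "subset_prob p Xs bad \<le> ?q ^ m + ?q ^ m"
    unfolding bad_def
    by (rule order_trans[OF subset_prob_disj[OF assms(1,2)]])
       (use no[of A] no[of B] Suc.prems in \<open>intro add_mono; auto\<close>)
  finally show ?case using XsX by (simp add: Un_absorb1 algebra_simps)
qed

text \<open>The two ladders join at their common starting pair into one ladder of
  \<open>2 * k + 1\<close> pairs, because a ladder read backwards is again a ladder. Vertices of
  either half attach to the part of it that lies in the other half.\<close>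

lemma has_spanning_mpb_two_ladders:
  fixes V :: "'a set"
  assumes fin: "finite V" and V: "V = {a, b} \<union> (A \<union> B) \<union> (A' \<union> B')"
    and ab: "a \<noteq> b" "{a, b} \<inter> (A \<union> B \<union> A' \<union> B') = {}"
    and disj: "A \<inter> B = {}" "A' \<inter> B' = {}" "(A \<union> B) \<inter> (A' \<union> B') = {}"
    and x: "x 0 = a" "y 0 = b" "ladder k x y A B E"
    and x': "x' 0 = a" "y' 0 = b" "ladder k x' y' A' B' E"
    and att: "\<And>v. v \<in> A \<union> B \<Longrightarrow> \<exists>j\<in>{1..k}. {{x' j, v}, {y' j, v}} \<subseteq> E"
    and att': "\<And>v. v \<in> A' \<union> B' \<Longrightarrow> \<exists>j\<in>{1..k}. {{x j, v}, {y j, v}} \<subseteq> E"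
  shows "has_spanning_mpb V E"
proof -
  \<comment> \<open>The first ladder is traversed from its far end down to rung 1, then index
    \<open>k\<close> is the common pair \<open>z' 0\<close>, and the second ladder follows.\<close>
  define f where "f = (\<lambda>z z' :: nat \<Rightarrow> 'a. \<lambda>i. if i < k then z (k - i) else z' (i - k))"
  have split: "{..<2 * k + 1} = {..<k} \<union> {k} \<union> {Suc k..<2 * k + 1}" by auto
  have im: "f z z' ` {..<2 * k + 1} = insert (z' 0) (z ` {1..k} \<union> z' ` {1..k})" for z z'
  proof -
    have 1: "z ` {1..k} = f z z' ` {..<k}"
    proof (intro equalityI subsetI)
      fix u assume "u \<in> z ` {1..k}"
      then obtain i where "i \<in> {1..k}" "u = z i" by auto
      then show "u \<in> f z z' ` {..<k}"
        by (intro image_eqI[of _ _ "k - i"]) (auto simp: f_def)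
    qed (auto simp: f_def)
    have 2: "z' ` {1..k} = f z z' ` {Suc k..<2 * k + 1}"
    proof (intro equalityI subsetI)
      fix u assume "u \<in> z' ` {1..k}"
      then obtain i where "i \<in> {1..k}" "u = z' i" by auto
      then show "u \<in> f z z' ` {Suc k..<2 * k + 1}"
        by (intro image_eqI[of _ _ "k + i"]) (auto simp: f_def)
    next
      fix u assume "u \<in> f z z' ` {Suc k..<2 * k + 1}"
      then obtain i where i: "i \<in> {Suc k..<2 * k + 1}" "u = f z z' i" by auto
      then show "u \<in> z' ` {1..k}"
        by (intro image_eqI[of _ _ "i - k"]) (auto simp: f_def)
    qed
    show ?thesis unfolding 1 2 split by (auto simp: f_def)
  qed
  have inj: "inj_on (f z z') {..<2 * k + 1}"
    if "inj_on z {1..k}" "inj_on z' {1..k}" "z ` {1..k} \<inter> z' ` {1..k} = {}"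
      "z' 0 \<notin> z ` {1..k}" "z' 0 \<notin> z' ` {1..k}" for z z'
  proof (rule inj_onI)
    have inj': "inj_on z' {0..k}"
    proof -
      have eq: "{0..k} = insert 0 {1..k}" by auto
      show ?thesis unfolding eq using that by (subst inj_on_insert) auto
    qed
    have disj': "z ` {1..k} \<inter> z' ` {0..k} = {}"
    proof -
      have eq: "{0..k} = insert 0 {1..k}" by auto
      show ?thesis unfolding eq using that(3,4) by (simp add: Int_insert_right)
    qed
    fix i j assume ij: "i \<in> {..<2 * k + 1}" "j \<in> {..<2 * k + 1}" "f z z' i = f z z' j"
    consider "i < k" "j < k" | "i < k" "\<not> j < k" | "\<not> i < k" "j < k" | "\<not> i < k" "\<not> j < k"
      by blast
    then show "i = j"
    proof cases
      case 1
      then have "z (k - i) = z (k - j)" using ij by (simp add: f_def)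
      then have "k - i = k - j" by (rule inj_onD[OF that(1)]) (use 1 in auto)
      then show ?thesis using 1 by simp
    next
      case 2
      then have "k - i \<in> {1..k}" "j - k \<in> {0..k}" using ij(1,2) by auto
      then have "z (k - i) \<noteq> z' (j - k)" using disj' by blast
      then show ?thesis using ij(3) 2 by (simp add: f_def)
    next
      case 3
      then have "k - j \<in> {1..k}" "i - k \<in> {0..k}" using ij(1,2) by auto
      then have "z (k - j) \<noteq> z' (i - k)" using disj' by blast
      then show ?thesis using ij(3) 3 by (simp add: f_def)
    next
      case 4
      then have "z' (i - k) = z' (j - k)" using ij by (simp add: f_def)
      then have "i - k = j - k" by (rule inj_onD[OF inj']) (use ij in auto)
      then show ?thesis using 4 by simp
    qed
  qed
  have X: "x ` {1..k} \<subseteq> A" "y ` {1..k} \<subseteq> B" "inj_on x {1..k}" "inj_on y {1..k}"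
    and X': "x' ` {1..k} \<subseteq> A'" "y' ` {1..k} \<subseteq> B'" "inj_on x' {1..k}" "inj_on y' {1..k}"
    using x(3) x'(3) by (auto simp: ladder_def)
  have step: "{x j, x (Suc j)} \<in> E \<and> {y j, x (Suc j)} \<in> E \<and> {x j, y (Suc j)} \<in> E \<and> {y j, y (Suc j)} \<in> E"
    and step': "{x' j, x' (Suc j)} \<in> E \<and> {y' j, x' (Suc j)} \<in> E \<and> {x' j, y' (Suc j)} \<in> E \<and> {y' j, y' (Suc j)} \<in> E"
    if "j < k" for j
    using x(3) x'(3) that unfolding ladder_def by blast+
  show ?thesis
  proof (rule has_spanning_mpb_attach[OF fin, of "2 * k + 1" "f x x'" "f y y'"])
    have "x' 0 \<notin> x ` {1..k}" "x' 0 \<notin> x' ` {1..k}" "x ` {1..k} \<inter> x' ` {1..k} = {}"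
      unfolding x'(1) using X(1) X'(1) ab(2) disj(3) by blast+
    then show "inj_on (f x x') {..<2 * k + 1}" using X(3) X'(3) by (intro inj)
    have "y' 0 \<notin> y ` {1..k}" "y' 0 \<notin> y' ` {1..k}" "y ` {1..k} \<inter> y' ` {1..k} = {}"
      unfolding x'(2) using X(2) X'(2) ab(2) disj(3) by blast+
    then show "inj_on (f y y') {..<2 * k + 1}" using X(4) X'(4) by (intro inj)
    show "f x x' ` {..<2 * k + 1} \<inter> f y y' ` {..<2 * k + 1} = {}"
    proof -
      have "a \<notin> y ` {1..k} \<union> y' ` {1..k}" "b \<notin> x ` {1..k} \<union> x' ` {1..k}"
        using X(1,2) X'(1,2) ab(2) by blast+
      moreover have "(x ` {1..k} \<union> x' ` {1..k}) \<inter> (y ` {1..k} \<union> y' ` {1..k}) = {}"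
        using X(1,2) X'(1,2) disj by blast
      ultimately show ?thesis unfolding im x' using ab(1) by simp
    qed
    show "f x x' ` {..<2 * k + 1} \<subseteq> V" "f y y' ` {..<2 * k + 1} \<subseteq> V"
      unfolding im x' V using X(1,2) X'(1,2) by auto
    show "{f x x' j, f x x' (Suc j)} \<in> E \<and> {f y y' j, f x x' (Suc j)} \<in> E \<and>
        {f x x' j, f y y' (Suc j)} \<in> E \<and> {f y y' j, f y y' (Suc j)} \<in> E"
      if "Suc j < 2 * k + 1" for j
    proof (cases "j < k")
      case True
      have "f x x' (Suc j) = x (k - Suc j)" "f y y' (Suc j) = y (k - Suc j)"
        using True x x' by (cases "Suc j < k"; simp add: f_def)+
      moreover have "f x x' j = x (Suc (k - Suc j))" "f y y' j = y (Suc (k - Suc j))"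
        using True by (auto simp: f_def Suc_diff_Suc)
      ultimately show ?thesis using step[of "k - Suc j"] True by (simp add: insert_commute)
    next
      case False
      then have "f x x' (Suc j) = x' (Suc (j - k))" "f y y' (Suc j) = y' (Suc (j - k))"
        by (auto simp: f_def Suc_diff_le)
      moreover have "f x x' j = x' (j - k)" "f y y' j = y' (j - k)"
        using False by (auto simp: f_def)
      ultimately show ?thesis using step'[of "j - k"] False that by simp
    qed
    show "\<exists>j<2 * k + 1. {f x x' j, v} \<in> E \<and> {f y y' j, v} \<in> E"
      if v: "v \<in> V" "v \<notin> f x x' ` {..<2 * k + 1}" "v \<notin> f y y' ` {..<2 * k + 1}" for v
    proof -
      have "v \<noteq> a" "v \<noteq> b" using v(2,3) unfolding im x' by auto
      then consider "v \<in> A \<union> B" | "v \<in> A' \<union> B'" using v(1) V by auto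
      then show ?thesis
      proof cases
        case 1
        from att[OF this] obtain j where "j \<in> {1..k}" "{x' j, v} \<in> E" "{y' j, v} \<in> E" by auto
        then show ?thesis by (intro exI[of _ "k + j"]) (auto simp: f_def)
      next
        case 2
        from att'[OF this] obtain j where "j \<in> {1..k}" "{x j, v} \<in> E" "{y j, v} \<in> E" by auto
        then show ?thesis by (intro exI[of _ "k - j"]) (auto simp: f_def)
      qed
    qed
  qed simp
qed

text \<open>Union bound over \<open>C\<close>. For a fixed \<open>v\<close> the \<open>k\<close>
  pairs of edges to the rungs are disjoint, since the rungs are.\<close>

lemma subset_prob_no_attach:
  assumes "0 \<le> p" "p \<le> 1" "finite X" and sub: "x ` {1..k} \<subseteq> A" "y ` {1..k} \<subseteq> B"
    and inj: "inj_on x {1..k}" "inj_on y {1..k}" and "A \<inter> B = {}"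
    and fin: "finite C" and disj: "C \<inter> (A \<union> B) = {}"
    and X: "\<And>u v. u \<in> A \<union> B \<Longrightarrow> v \<in> C \<Longrightarrow> {u, v} \<in> X"
  shows "subset_prob p X (\<lambda>F. \<exists>v\<in>C. \<forall>j\<in>{1..k}. \<not> {{x j, v}, {y j, v}} \<subseteq> F)
    \<le> real (card C) * (1 - p\<^sup>2) ^ k"
proof -
  have xA: "x j \<in> A" and yB: "y j \<in> B" if "j \<in> {1..k}" for j using sub that by auto
  have "subset_prob p X (\<lambda>F. \<exists>v\<in>C. \<forall>j\<in>{1..k}. \<not> {{x j, v}, {y j, v}} \<subseteq> F)
     \<le> (\<Sum>v\<in>C. subset_prob p X (\<lambda>F. \<forall>j\<in>{1..k}. \<not> {{x j, v}, {y j, v}} \<subseteq> F))"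
    by (rule subset_prob_Ex) (use assms in auto)
  also have "\<dots> \<le> (\<Sum>v\<in>C. (1 - p\<^sup>2) ^ card {1..k})"
  proof (intro sum_mono subset_prob_no_pair)
    fix v assume v: "v \<in> C"
    show "{{x j, v}, {y j, v}} \<subseteq> X \<and> card {{x j, v}, {y j, v}} = 2" if "j \<in> {1..k}" for j
    proof -
      have "x j \<noteq> y j" using xA[OF that] yB[OF that] assms(8) by auto
      then have "{x j, v} \<noteq> {y j, v}" by (auto simp: doubleton_eq_iff)
      then show ?thesis using X v xA[OF that] yB[OF that] by auto
    qed
    show "disjoint_family_on (\<lambda>j. {{x j, v}, {y j, v}}) {1..k}"
      unfolding disjoint_family_on_def
    proof (intro ballI impI)
      fix i j assume ij: "i \<in> {1..k}" "j \<in> {1..k}" "i \<noteq> j"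
      then have "x i \<noteq> x j" "y i \<noteq> y j" using inj inj_onD by metis+
      moreover have "x i \<noteq> y j" "y i \<noteq> x j"
        using xA[OF ij(1)] xA[OF ij(2)] yB[OF ij(1)] yB[OF ij(2)] assms(8) by auto
      ultimately show "{{x i, v}, {y i, v}} \<inter> {{x j, v}, {y j, v}} = {}"
        by (auto simp: doubleton_eq_iff)
    qed
  qed (use assms in auto)
  finally show ?thesis by simp
qed

text \<open>The two ladders use no edge between $A \<union> B$ and $A' \<union> B'$, so these edges are still fresh when the
  remaining vertices of each side are attached to the ladder of the other side.\<close>
lemma subset_prob_not_has_spanning_mpb:
  fixes V :: "'a set"
  assumes p: "0 \<le> p" "p \<le> 1" and fin: "finite V" and V: "V = {a, b} \<union> (A \<union> B) \<union> (A' \<union> B')"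
    and ab: "a \<noteq> b" "{a, b} \<inter> (A \<union> B \<union> A' \<union> B') = {}"
    and disj: "A \<inter> B = {}" "A' \<inter> B' = {}" "(A \<union> B) \<inter> (A' \<union> B') = {}"
    and card: "2 * k \<le> card A" "2 * k \<le> card B" "2 * k \<le> card A'" "2 * k \<le> card B'"
  shows "subset_prob p {{u, v} | u v. u \<in> V \<and> v \<in> V \<and> u \<noteq> v} (\<lambda>F. \<not> has_spanning_mpb V F)
     \<le> (4 * real k + real (card V)) * (1 - p\<^sup>2) ^ k"
proof -
  let ?Z = "{{u, v} | u v. u \<in> V \<and> v \<in> V \<and> u \<noteq> v}"
  let ?q = "1 - p\<^sup>2"
  have q: "0 \<le> ?q" using p by (simp add: power_le_one)
  define Y where "Y = {{u, v} | u v. u \<in> A \<union> B \<and> v \<in> A' \<union> B'}"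
  define X where "X = ?Z - Y"
  have "?Z \<subseteq> Pow V" by auto
  then have finZ: "finite ?Z" using fin finite_subset by blast
  have YZ: "Y \<subseteq> ?Z" unfolding Y_def V using disj by blast
  have Z: "?Z = X \<union> Y" using YZ by (auto simp: X_def)
  have fins: "finite X" "finite Y" "finite A" "finite B" "finite A'" "finite B'"
    using finZ YZ fin V finite_subset unfolding X_def by auto
  define has1 where "has1 F \<longleftrightarrow> (\<exists>x y. x 0 = a \<and> y 0 = b \<and> ladder k x y A B F)" for F
  define has2 where "has2 F \<longleftrightarrow> (\<exists>x y. x 0 = a \<and> y 0 = b \<and> ladder k x y A' B' F)" for F
  have n1: "subset_prob p X (\<lambda>F. \<not> has1 F) \<le> 2 * real k * ?q ^ k" unfolding has1_def
  proof (rule subset_prob_no_ladder[OF p fins(1,3,4)])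
    show "{u, v} \<in> X" if "u \<in> {a, b} \<union> A \<union> B" "v \<in> A \<union> B" "u \<noteq> v" for u v
    proof -
      have "{u, v} \<in> ?Z" using that V by blast
      moreover have "{u, v} \<notin> Y" using that ab disj by (auto simp: Y_def doubleton_eq_iff)
      ultimately show ?thesis by (simp add: X_def)
    qed
  qed (use ab disj card in auto)
  have n2: "subset_prob p X (\<lambda>F. \<not> has2 F) \<le> 2 * real k * ?q ^ k" unfolding has2_def
  proof (rule subset_prob_no_ladder[OF p fins(1,5,6)])
    show "{u, v} \<in> X" if "u \<in> {a, b} \<union> A' \<union> B'" "v \<in> A' \<union> B'" "u \<noteq> v" for u v
    proof -
      have "{u, v} \<in> ?Z" using that V by blast
      moreover have "{u, v} \<notin> Y" using that ab disj by (auto simp: Y_def doubleton_eq_iff)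
      ultimately show ?thesis by (simp add: X_def)
    qed
  qed (use ab disj card in auto)
  \<comment> \<open>First round: both ladders are sought in \<open>X\<close>, at a cost of
    \<open>2 * k\<close> failure terms each. Second round: the edges \<open>Y\<close> between the
    halves attach all vertices, at a cost of one term per vertex.\<close>
  have "subset_prob p (X \<union> Y) (\<lambda>F. \<not> has_spanning_mpb V F)
    \<le> subset_prob p X (\<lambda>F. \<not> has1 F \<or> \<not> has2 F) + real (card V) * ?q ^ k"
  proof (rule subset_prob_le_cond)
    fix F assume F: "F \<subseteq> X" "\<not> (\<not> has1 F \<or> \<not> has2 F)"
    then obtain x y x' y' where x: "x 0 = a" "y 0 = b" "ladder k x y A B F"
      and x': "x' 0 = a" "y' 0 = b" "ladder k x' y' A' B' F"
      unfolding has1_def has2_def by blast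
    let ?P = "\<lambda>G. \<exists>v\<in>A \<union> B. \<forall>j\<in>{1..k}. \<not> {{x' j, v}, {y' j, v}} \<subseteq> G"
    let ?P' = "\<lambda>G. \<exists>v\<in>A' \<union> B'. \<forall>j\<in>{1..k}. \<not> {{x j, v}, {y j, v}} \<subseteq> G"
    have "subset_prob p Y (\<lambda>G. \<not> has_spanning_mpb V (F \<union> G)) \<le> subset_prob p Y (\<lambda>G. ?P G \<or> ?P' G)"
    proof (rule subset_prob_mono[OF p], rule ccontr)
      fix G assume G: "\<not> has_spanning_mpb V (F \<union> G)" "\<not> (?P G \<or> ?P' G)"
      have l: "ladder k x y A B (F \<union> G)" "ladder k x' y' A' B' (F \<union> G)"
        using ladder_mono[OF x(3), of "F \<union> G"] ladder_mono[OF x'(3), of "F \<union> G"] by auto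
      have "has_spanning_mpb V (F \<union> G)"
      proof (rule has_spanning_mpb_two_ladders[OF fin V ab disj x(1,2) l(1) x'(1,2) l(2)])
        show "\<exists>j\<in>{1..k}. {{x' j, v}, {y' j, v}} \<subseteq> F \<union> G" if "v \<in> A \<union> B" for v
          using G(2) that by (meson le_supI2)
        show "\<exists>j\<in>{1..k}. {{x j, v}, {y j, v}} \<subseteq> F \<union> G" if "v \<in> A' \<union> B'" for v
          using G(2) that by (meson le_supI2)
      qed
      then show False using G by simp
    qed
    also have "\<dots> \<le> subset_prob p Y ?P + subset_prob p Y ?P'"
      by (rule subset_prob_disj[OF p])
    also have "\<dots> \<le> real (card (A \<union> B)) * ?q ^ k + real (card (A' \<union> B')) * ?q ^ k"
    proof (rule add_mono)
      show "subset_prob p Y ?P \<le> real (card (A \<union> B)) * ?q ^ k"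
      proof (rule subset_prob_no_attach[OF p fins(2)])
        show "{u, v} \<in> Y" if "u \<in> A' \<union> B'" "v \<in> A \<union> B" for u v
          unfolding Y_def using that by (intro CollectI exI[of _ v] exI[of _ u]) auto
      qed (use x'(3) disj fins in \<open>auto simp: ladder_def\<close>)
      show "subset_prob p Y ?P' \<le> real (card (A' \<union> B')) * ?q ^ k"
      proof (rule subset_prob_no_attach[OF p fins(2)])
        show "{u, v} \<in> Y" if "u \<in> A \<union> B" "v \<in> A' \<union> B'" for u v
          using that unfolding Y_def by auto
      qed (use x(3) disj fins in \<open>auto simp: ladder_def\<close>)
    qed
    also have "\<dots> = real (card ((A \<union> B) \<union> (A' \<union> B'))) * ?q ^ k"
      using disj fins by (subst card_Un_disjoint[of "A \<union> B"]) (auto simp: algebra_simps)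
    also have "\<dots> \<le> real (card V) * ?q ^ k"
      using q fin V by (intro mult_right_mono) (auto intro!: card_mono)
    finally show "subset_prob p Y (\<lambda>G. \<not> has_spanning_mpb V (F \<union> G)) \<le> real (card V) * ?q ^ k" .
  qed (use fins p q in \<open>auto simp: X_def\<close>)
  also have "subset_prob p X (\<lambda>F. \<not> has1 F \<or> \<not> has2 F) \<le> 2 * real k * ?q ^ k + 2 * real k * ?q ^ k"
    using subset_prob_disj[OF p, of X "\<lambda>F. \<not> has1 F" "\<lambda>F. \<not> has2 F"] n1 n2 by linarith
  finally show ?thesis unfolding Z by (simp add: algebra_simps)
qed

lemma gnp_prob_not_has_spanning_mpb:
  assumes p: "0 \<le> p" "p \<le> 1" and n: "2 \<le> n"
  defines "k \<equiv> (n - 2) div 8"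
  shows "1 - gnp_prob n p (has_spanning_mpb {0..<n}) \<le> 5 * real n * (1 - p\<^sup>2) ^ k"
proof -
  have k: "8 * k \<le> n - 2" unfolding k_def by simp
  \<comment> \<open>Vertices 0 and 1 form the starting pair. The four blocks need size
    \<open>2 * k\<close>, for ladders of length \<open>k\<close> with \<open>k\<close> spare
    candidates at every step; the last block also absorbs the remainder of the division.\<close>
  define A B A' B' where "A = {2..<2 + 2 * k}" and "B = {2 + 2 * k..<2 + 4 * k}"
    and "A' = {2 + 4 * k..<2 + 6 * k}" and "B' = {2 + 6 * k..<n}"
  have eq: "all_edges n = {{u, v} | u v. u \<in> {0..<n} \<and> v \<in> {0..<n} \<and> u \<noteq> v}"
    by (simp add: all_edges_def)
  have "finite (all_edges n)" by (rule finite_subset[of _ "Pow {0..<n}"]) (auto simp: all_edges_def)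
  then have "1 - gnp_prob n p (has_spanning_mpb {0..<n}) =
      subset_prob p (all_edges n) (\<lambda>F. \<not> has_spanning_mpb {0..<n} F)"
    by (simp add: gnp_prob_eq subset_prob_not)
  also have "\<dots> \<le> (4 * real k + real (card {0..<n})) * (1 - p\<^sup>2) ^ k"
    unfolding eq
    by (rule subset_prob_not_has_spanning_mpb[OF p, where a = 0 and b = 1 and A = A and B = B
          and A' = A' and B' = B'])
       (use k n in \<open>auto simp: A_def B_def A'_def B'_def\<close>)
  also have "\<dots> \<le> 5 * real n * (1 - p\<^sup>2) ^ k"
    using p k n by (intro mult_right_mono) (auto simp: power_le_one)
  finally show ?thesis .
qed

text \<open>The constant 8 gives \<open>p^2 \<ge> 64 ln n / n\<close>; as
  \<open>k \<ge> n / 16\<close>, this yields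
  \<open>(1 - p^2)^k \<le> exp (- k p^2) \<le> n^(-4)\<close>, more than enough against the
  prefactor \<open>5 n\<close>.\<close>

lemma gnp_prob_has_spanning_mpb_tendsto_1:
  fixes p :: "nat \<Rightarrow> real"
  assumes p: "\<And>n. 0 \<le> p n \<and> p n \<le> 1"
    and large: "eventually (\<lambda>n. p n \<ge> 8 * ln (real n) powr (1/2) * real n powr (-1/2)) sequentially"
  shows "(\<lambda>n. gnp_prob n (p n) (has_spanning_mpb {0..<n})) \<longlonglongrightarrow> 1"
proof -
  have bound: "eventually (\<lambda>n. 1 - gnp_prob n (p n) (has_spanning_mpb {0..<n}) \<le> 5 / real n) sequentially"
    using large eventually_ge_at_top[of 20]
  proof eventually_elim
    case (elim n)
    define k where "k = (n - 2) div 8"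
    \<comment> \<open>The division gives \<open>k > (n - 10) / 8\<close>, and this is at least
      \<open>n / 16\<close> from \<open>n = 20\<close> on.\<close>
    have k: "real n / 16 \<le> real k"
    proof -
      have "n - 2 < 8 * (k + 1)" using dividend_less_div_times[of 8 "n - 2"] unfolding k_def by simp
      then have "n < 8 * k + 10" using elim(2) by arith
      then have "real n < real (8 * k + 10)" by (simp only: of_nat_less_iff)
      then have "real n < 8 * real k + 10" by simp
      then show ?thesis using elim by linarith
    qed
    have ln: "0 \<le> ln (real n)" using elim by simp
    have "0 \<le> p n" "p n \<le> 1" using p by auto
    have "(8 * ln (real n) powr (1/2) * real n powr (-1/2))\<^sup>2 \<le> (p n)\<^sup>2"
      using elim ln by (intro power_mono) auto
    moreover have "(8 * ln (real n) powr (1/2) * real n powr (-1/2))\<^sup>2 = 64 * ln (real n) / real n"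
      using ln elim by (simp add: power_mult_distrib powr_half_sqrt powr_minus_divide power_divide)
    ultimately have p2: "64 * ln (real n) / real n \<le> (p n)\<^sup>2" by simp
    have "1 - (p n)\<^sup>2 \<le> exp (- (p n)\<^sup>2)" using exp_ge_add_one_self[of "- (p n)\<^sup>2"] by simp
    then have "(1 - (p n)\<^sup>2) ^ k \<le> exp (- (p n)\<^sup>2) ^ k"
      using \<open>0 \<le> p n\<close> \<open>p n \<le> 1\<close> by (intro power_mono) (auto simp: power_le_one)
    also have "\<dots> = exp (- (real k * (p n)\<^sup>2))" by (simp add: exp_of_nat_mult[symmetric])
    also have "\<dots> \<le> exp (- (4 * ln (real n)))"
    proof -
      have "4 * ln (real n) = real n / 16 * (64 * ln (real n) / real n)" using elim by simp
      also have "\<dots> \<le> real k * (p n)\<^sup>2" using k p2 ln by (intro mult_mono) auto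
      finally show ?thesis by simp
    qed
    also have "\<dots> = inverse (real n ^ 4)"
      using elim exp_of_nat_mult[of 4 "ln (real n)"] by (simp add: exp_minus)
    also have "\<dots> \<le> inverse (real n ^ 2)"
      using elim by (intro le_imp_inverse_le power_increasing) auto
    finally have "5 * real n * (1 - (p n)\<^sup>2) ^ k \<le> 5 * real n * inverse (real n ^ 2)"
      by (intro mult_left_mono) auto
    also have "\<dots> = 5 / real n" using elim by (simp add: field_simps power2_eq_square)
    finally show ?case
      using gnp_prob_not_has_spanning_mpb[of "p n" n] p elim unfolding k_def by fastforce
  qed
  have upper: "gnp_prob n (p n) (has_spanning_mpb {0..<n}) \<le> 1" for n
  proof -
    have "finite (all_edges n)" by (rule finite_subset[of _ "Pow {0..<n}"]) (auto simp: all_edges_def)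
    then show ?thesis using p by (simp add: gnp_prob_eq subset_prob_le_1)
  qed
  have lim: "(\<lambda>n. 1 - 5 / real n) \<longlonglongrightarrow> 1"
    using tendsto_diff[OF tendsto_const lim_const_over_n[of "5 :: real"], of 1] by simp
  show ?thesis
  proof (rule tendsto_sandwich[OF _ _ lim tendsto_const])
    show "\<forall>\<^sub>F n in sequentially. 1 - 5 / real n \<le> gnp_prob n (p n) (has_spanning_mpb {0..<n})"
      using bound by eventually_elim simp
  qed (use upper in auto)
qed

section \<open>Clique minors\<close>

text \<open>Connectivity is expressed by cuts instead of paths: the lifting of minors and the
  drawing argument both use it by producing an edge across a given cut.\<close>

definition connected_in :: "'a set set \<Rightarrow> 'a set \<Rightarrow> bool" where
  "connected_in E B \<longleftrightarrow> B \<noteq> {} \<and> (\<forall>S. S \<subseteq> B \<and> S \<noteq> {} \<and> S \<noteq> B \<longrightarrow> (\<exists>x\<in>S. \<exists>y\<in>B - S. {x, y} \<in> E))"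

definition clique_minor :: "nat \<Rightarrow> 'a set \<Rightarrow> 'a set set \<Rightarrow> bool" where
  "clique_minor t V E \<longleftrightarrow> (\<exists>\<B>. card \<B> = t \<and> finite \<B> \<and> (\<forall>B\<in>\<B>. B \<subseteq> V \<and> connected_in E B) \<and>
     (\<forall>B\<in>\<B>. \<forall>B'\<in>\<B>. B \<noteq> B' \<longrightarrow> B \<inter> B' = {} \<and> (\<exists>x\<in>B. \<exists>y\<in>B'. {x, y} \<in> E)))"

lemma connected_in_singleton: "connected_in E {x}"
  unfolding connected_in_def by auto

lemma connected_in_star:
  assumes "c \<in> B" "\<And>x. x \<in> B \<Longrightarrow> x \<noteq> c \<Longrightarrow> {x, c} \<in> E"
  shows "connected_in E B"
  unfolding connected_in_def
proof (intro conjI allI impI)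
  fix S assume S: "S \<subseteq> B \<and> S \<noteq> {} \<and> S \<noteq> B"
  show "\<exists>x\<in>S. \<exists>y\<in>B - S. {x, y} \<in> E"
  proof (cases "c \<in> S")
    case True
    obtain x where "x \<in> B - S" using S by blast
    then have "{c, x} \<in> E" using assms(2)[of x] True by (auto simp: insert_commute)
    then show ?thesis using True \<open>x \<in> B - S\<close> by blast
  next
    case False
    obtain x where "x \<in> S" using S by blast
    then have "{x, c} \<in> E" using assms(2)[of x] False S by auto
    then show ?thesis using False \<open>x \<in> S\<close> assms(1) by blast
  qed
qed (use assms in auto)

lemma connected_in_insert:
  assumes "connected_in E B" "u \<in> B" "{u, x} \<in> E"
  shows "connected_in E (insert x B)"
  unfolding connected_in_def
proof (intro conjI allI impI)
  fix S assume S: "S \<subseteq> insert x B \<and> S \<noteq> {} \<and> S \<noteq> insert x B"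
  show "\<exists>x'\<in>S. \<exists>y\<in>insert x B - S. {x', y} \<in> E"
  proof (cases "S \<inter> B \<noteq> {} \<and> S \<inter> B \<noteq> B")
    case True
    then obtain y z where "y \<in> S \<inter> B" "z \<in> B - S \<inter> B" "{y, z} \<in> E"
      using assms(1) unfolding connected_in_def by (meson inf.cobounded2)
    then show ?thesis by blast
  next
    case False
    then consider "S \<inter> B = {}" | "B \<subseteq> S" by blast
    then show ?thesis
    proof cases
      case 1
      then have "S = {x}" using S by blast
      moreover have "u \<noteq> x" using 1 assms(2) calculation by blast
      ultimately show ?thesis using assms by (auto simp: insert_commute)
    next
      case 2
      then have "x \<notin> S" using S by blast
      then show ?thesis using 2 assms by blast
    qed
  qed
qed simp

text \<open>A cut \<open>S\<close> either splits some fibre, which is connected, or is a union of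
  fibres. In the second case it comes from a cut of \<open>B\<close>, and an edge of
  \<open>E'\<close> across that cut lifts.\<close>

lemma connected_in_preimage:
  assumes "connected_in E' B" and B: "B \<subseteq> U"
    and fib: "\<And>u. u \<in> U \<Longrightarrow> connected_in E {v \<in> V. \<phi> v = u}"
    and edge: "\<And>u w. u \<in> U \<Longrightarrow> w \<in> U \<Longrightarrow> u \<noteq> w \<Longrightarrow> {u, w} \<in> E' \<Longrightarrow>
      \<exists>x\<in>V. \<exists>y\<in>V. \<phi> x = u \<and> \<phi> y = w \<and> {x, y} \<in> E"
  shows "connected_in E {v \<in> V. \<phi> v \<in> B}"
  unfolding connected_in_def
proof (intro conjI allI impI)
  obtain u where "u \<in> B" using assms(1) by (auto simp: connected_in_def)
  then show "{v \<in> V. \<phi> v \<in> B} \<noteq> {}" using fib[of u] B by (auto simp: connected_in_def)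
next
  fix S assume S: "S \<subseteq> {v \<in> V. \<phi> v \<in> B} \<and> S \<noteq> {} \<and> S \<noteq> {v \<in> V. \<phi> v \<in> B}"
  let ?F = "\<lambda>u. {v \<in> V. \<phi> v = u}"
  show "\<exists>x\<in>S. \<exists>y\<in>{v \<in> V. \<phi> v \<in> B} - S. {x, y} \<in> E"
  proof (cases "\<exists>u\<in>B. ?F u \<inter> S \<noteq> {} \<and> ?F u \<inter> S \<noteq> ?F u")
    case True
    then obtain u where u: "u \<in> B" "?F u \<inter> S \<noteq> {}" "?F u \<inter> S \<noteq> ?F u" by blast
    have "connected_in E (?F u)" using fib u B by blast
    then obtain x y where "x \<in> ?F u \<inter> S" "y \<in> ?F u - (?F u \<inter> S)" "{x, y} \<in> E"
      using u(2,3) unfolding connected_in_def by (meson inf.cobounded1)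
    then show ?thesis using u(1) by (intro bexI[of _ x] bexI[of _ y]) auto
  next
    case False
    define T where "T = {u \<in> B. ?F u \<inter> S \<noteq> {}}"
    have full: "?F u \<subseteq> S" if "u \<in> T" for u using False that unfolding T_def by blast
    have "T \<noteq> {}" using S unfolding T_def by blast
    moreover have "T \<noteq> B"
    proof
      assume "T = B"
      then have "{v \<in> V. \<phi> v \<in> B} \<subseteq> S" using full by blast
      then show False using S by blast
    qed
    moreover have "T \<subseteq> B" by (auto simp: T_def)
    ultimately obtain u w where uw: "u \<in> T" "w \<in> B - T" "{u, w} \<in> E'"
      using assms(1) unfolding connected_in_def by meson
    then have "u \<in> U" "w \<in> U" "u \<noteq> w" using B unfolding T_def by auto
    from edge[OF this uw(3)] obtain x y where xy: "x \<in> V" "y \<in> V" "\<phi> x = u" "\<phi> y = w" "{x, y} \<in> E"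
      by blast
    have "x \<in> S" using full[OF uw(1)] xy by blast
    moreover have "y \<notin> S" using uw xy unfolding T_def by blast
    ultimately show ?thesis using xy uw by blast
  qed
qed

text \<open>A minor of a minor is a minor: vertices outside \<open>V'\<close> are deleted and the
  fibres of \<phi> are contracted. Both shrinking constructions preserve minor-freeness through this
  lemma.\<close>

lemma clique_minor_lift:
  assumes "clique_minor t U E'" "V' \<subseteq> V"
    and fib: "\<And>u. u \<in> U \<Longrightarrow> connected_in E {v \<in> V'. \<phi> v = u}"
    and edge: "\<And>u w. u \<in> U \<Longrightarrow> w \<in> U \<Longrightarrow> u \<noteq> w \<Longrightarrow> {u, w} \<in> E' \<Longrightarrow>
      \<exists>x\<in>V'. \<exists>y\<in>V'. \<phi> x = u \<and> \<phi> y = w \<and> {x, y} \<in> E"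
  shows "clique_minor t V E"
proof -
  obtain \<B> where \<B>: "card \<B> = t" "finite \<B>" "\<And>B. B \<in> \<B> \<Longrightarrow> B \<subseteq> U \<and> connected_in E' B"
    and adj: "\<And>B B'. B \<in> \<B> \<Longrightarrow> B' \<in> \<B> \<Longrightarrow> B \<noteq> B' \<Longrightarrow>
      B \<inter> B' = {} \<and> (\<exists>x\<in>B. \<exists>y\<in>B'. {x, y} \<in> E')"
    using assms(1) unfolding clique_minor_def by metis
  define f where "f B = {v \<in> V'. \<phi> v \<in> B}" for B
  have conn: "connected_in E (f B)" if "B \<in> \<B>" for B
    unfolding f_def using \<B>(3)[OF that] fib edge
    by (intro connected_in_preimage[of E' B U]) blast+
  have inj: "inj_on f \<B>"
  proof (rule inj_onI, rule ccontr)
    fix B B' assume BB: "B \<in> \<B>" "B' \<in> \<B>" "f B = f B'" "B \<noteq> B'"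
    then have "f B = {}" using adj[OF BB(1,2,4)] unfolding f_def by blast
    then show False using conn[OF BB(1)] by (simp add: connected_in_def)
  qed
  show ?thesis
    unfolding clique_minor_def
  proof (intro exI[of _ "f ` \<B>"] conjI ballI impI)
    show "card (f ` \<B>) = t" using inj \<B>(1) by (simp add: card_image)
    show "connected_in E B" if "B \<in> f ` \<B>" for B using that conn by blast
    show "B \<subseteq> V" if "B \<in> f ` \<B>" for B using that assms(2) unfolding f_def by blast
    fix C C' assume C: "C \<in> f ` \<B>" "C' \<in> f ` \<B>" "C \<noteq> C'"
    then obtain B B' where B: "B \<in> \<B>" "B' \<in> \<B>" "C = f B" "C' = f B'" "B \<noteq> B'" by blast
    note ad = adj[OF B(1,2,5)]
    show "C \<inter> C' = {}" using ad unfolding B(3,4) f_def by blast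
    obtain u w where uw: "u \<in> B" "w \<in> B'" "{u, w} \<in> E'" using ad by blast
    then have "u \<in> U" "w \<in> U" "u \<noteq> w" using \<B>(3) B ad by blast+
    from edge[OF this uw(3)] show "\<exists>x\<in>C. \<exists>y\<in>C'. {x, y} \<in> E"
      using uw unfolding B(3,4) f_def by blast
  qed (use \<B> in auto)
qed

lemma clique_minor_mono: "clique_minor t U E \<Longrightarrow> U \<subseteq> V \<Longrightarrow> clique_minor t V E"
  unfolding clique_minor_def by (elim exE, rule exI) (use order_trans in blast)

text \<open>\<open>U\<close> becomes one more branch set; it is adjacent to every vertex of
  \<open>N\<close>, hence to every branch set inside \<open>N\<close>.\<close>

lemma clique_minor_Suc:
  assumes "clique_minor t N E" "N \<subseteq> V" "U \<subseteq> V" "U \<inter> N = {}" "connected_in E U"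
    and adj: "\<And>x. x \<in> N \<Longrightarrow> \<exists>u\<in>U. {u, x} \<in> E"
  shows "clique_minor (Suc t) V E"
proof -
  obtain \<B> where \<B>: "card \<B> = t" "finite \<B>" "\<And>B. B \<in> \<B> \<Longrightarrow> B \<subseteq> N \<and> connected_in E B"
    and adj': "\<And>B B'. B \<in> \<B> \<Longrightarrow> B' \<in> \<B> \<Longrightarrow> B \<noteq> B' \<Longrightarrow>
      B \<inter> B' = {} \<and> (\<exists>x\<in>B. \<exists>y\<in>B'. {x, y} \<in> E)"
    using assms(1) unfolding clique_minor_def by metis
  have "U \<noteq> {}" using assms(5) by (simp add: connected_in_def)
  have U: "U \<notin> \<B>"
    using \<B>(3)[of U] \<open>U \<noteq> {}\<close> assms(4) by blast
  have UB: "U \<inter> B = {} \<and> (\<exists>u\<in>U. \<exists>x\<in>B. {u, x} \<in> E)" if "B \<in> \<B>" for B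
  proof -
    obtain x where "x \<in> B" using \<B>(3)[OF \<open>B \<in> \<B>\<close>] by (auto simp: connected_in_def)
    moreover have "x \<in> N" using \<B>(3)[OF that] calculation by blast
    ultimately show ?thesis using adj[of x] \<B>(3)[OF that] assms(4) by blast
  qed
  then have BU: "B \<inter> U = {} \<and> (\<exists>x\<in>B. \<exists>u\<in>U. {x, u} \<in> E)" if "B \<in> \<B>" for B
    using that by (metis inf_commute insert_commute)
  show ?thesis
    unfolding clique_minor_def
  proof (intro exI[of _ "insert U \<B>"] conjI)
    show "card (insert U \<B>) = Suc t" using U \<B> by simp
    show "\<forall>B\<in>insert U \<B>. B \<subseteq> V \<and> connected_in E B"
      using \<B>(3) assms by auto
    show "\<forall>B\<in>insert U \<B>. \<forall>B'\<in>insert U \<B>. B \<noteq> B' \<longrightarrow>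
        B \<inter> B' = {} \<and> (\<exists>x\<in>B. \<exists>y\<in>B'. {x, y} \<in> E)"
      using adj' UB BU by simp
  qed (use \<B> in auto)
qed

section \<open>Edge density forces clique minors\<close>

definition edges_in :: "'a set set \<Rightarrow> 'a set \<Rightarrow> 'a set set" where
  "edges_in E W = {e \<in> E. e \<subseteq> W}"

definition nbrs :: "'a set set \<Rightarrow> 'a set \<Rightarrow> 'a \<Rightarrow> 'a set" where
  "nbrs E W x = {y \<in> W. {x, y} \<in> E}"

lemma finite_edges_in: "finite W \<Longrightarrow> finite (edges_in E W)"
  by (rule finite_subset[of _ "Pow W"]) (auto simp: edges_in_def)

lemma card_edges_in_insert:
  assumes "\<And>e. e \<in> E \<Longrightarrow> card e = 2" "finite W" "x \<notin> W"
  shows "card (edges_in E (insert x W)) = card (edges_in E W) + card (nbrs E W x)"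
proof -
  have "edges_in E (insert x W) = edges_in E W \<union> (\<lambda>y. {x, y}) ` nbrs E W x"
  proof (intro equalityI subsetI)
    fix e assume e: "e \<in> edges_in E (insert x W)"
    then have eE: "e \<in> E" "e \<subseteq> insert x W" by (auto simp: edges_in_def)
    obtain a b where ab: "e = {a, b}" "a \<noteq> b" using assms(1)[OF eE(1)] by (meson card_2_iff)
    show "e \<in> edges_in E W \<union> (\<lambda>y. {x, y}) ` nbrs E W x"
    proof (cases "x \<in> e")
      case True
      then obtain y where "e = {x, y}" "y \<noteq> x" using ab by auto
      then show ?thesis using eE by (auto simp: nbrs_def)
    next
      case False
      then show ?thesis using eE by (auto simp: edges_in_def)
    qed
  qed (use assms(3) in \<open>auto simp: edges_in_def nbrs_def\<close>)
  moreover have "edges_in E W \<inter> (\<lambda>y. {x, y}) ` nbrs E W x = {}"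
    using assms(3) by (auto simp: edges_in_def)
  moreover have "inj_on (\<lambda>y. {x, y}) (nbrs E W x)"
    by (auto simp: inj_on_def doubleton_eq_iff)
  moreover have "finite (nbrs E W x)" using assms(2) by (simp add: nbrs_def)
  ultimately show ?thesis
    using assms(2) by (simp add: card_Un_disjoint finite_edges_in card_image)
qed

lemma sum_card_nbrs:
  assumes "\<And>e. e \<in> E \<Longrightarrow> card e = 2" "finite W"
  shows "(\<Sum>x\<in>W. card (nbrs E W x)) = 2 * card (edges_in E W)"
  using assms(2)
proof (induction W)
  case empty
  have "edges_in E {} = {}" using assms(1) by (fastforce simp: edges_in_def)
  then show ?case by simp
next
  case (insert x W)
  have "x \<notin> nbrs E (insert x W) x" using assms(1)[of "{x}"] by (auto simp: nbrs_def)
  then have nx: "nbrs E (insert x W) x = nbrs E W x" by (auto simp: nbrs_def)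
  have ny: "card (nbrs E (insert x W) y) = card (nbrs E W y) + (if y \<in> nbrs E W x then 1 else 0)"
    if "y \<in> W" for y
  proof (cases "y \<in> nbrs E W x")
    case True
    then have "nbrs E (insert x W) y = insert x (nbrs E W y)"
      by (auto simp: nbrs_def insert_commute)
    then show ?thesis using True insert.hyps by (simp add: nbrs_def)
  next
    case False
    then have "nbrs E (insert x W) y = nbrs E W y"
      using that by (auto simp: nbrs_def insert_commute)
    then show ?thesis using False by simp
  qed
  have "(\<Sum>y\<in>W. card (nbrs E (insert x W) y)) =
      (\<Sum>y\<in>W. card (nbrs E W y)) + (\<Sum>y\<in>W. if y \<in> nbrs E W x then 1 else 0)"
    using ny by (simp add: sum.distrib)
  also have "(\<Sum>y\<in>W. if y \<in> nbrs E W x then 1 else 0) = card (W \<inter> nbrs E W x)"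
    using insert.hyps by (simp flip: sum.inter_restrict)
  also have "W \<inter> nbrs E W x = nbrs E W x" by (auto simp: nbrs_def)
  finally show ?case
    using insert card_edges_in_insert[OF assms(1) insert.hyps] nx by simp
qed

text \<open>Mader's argument, with a branch set $U$ in place of a contraction: as long as $U$ stays
  connected, the graph obtained by contracting $U$ to a point keeps its density. If $U$ is maximal,
  adding a vertex of its neighbourhood $N$ lowers the density, so this vertex has many neighbours
  in $N$.\<close>
lemma clique_minor_if_dense:
  fixes E :: "'a set set"
  assumes E: "\<And>e. e \<in> E \<Longrightarrow> card e = 2"
    and "finite V" "V \<noteq> {}" "2 ^ t * card V \<le> card (edges_in E V)"
  shows "clique_minor (t + 2) V E"
  using assms(2-)
proof (induction t arbitrary: V)
  case 0
  then have "edges_in E V \<noteq> {}" by auto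
  then obtain e where e: "e \<in> E" "e \<subseteq> V" by (auto simp: edges_in_def)
  then obtain x y where "e = {x, y}" "x \<noteq> y" using E by (meson card_2_iff)
  then show ?case using e
    by (auto simp: clique_minor_def connected_in_singleton insert_commute intro!: exI[of _ "{{x}, {y}}"])
next
  case (Suc t)
  note IHt = Suc.IH
  define k :: nat where "k = 2 ^ Suc t"
  have k: "0 < k" by (simp add: k_def)
  show ?case using Suc.prems
  proof (induction "card V" arbitrary: V rule: less_induct)
    case less
    note fin = less.prems(1)
    define N where "N U = {v \<in> V - U. \<exists>u\<in>U. {u, v} \<in> E}" for U
    \<comment> \<open>After contraction of \<open>U\<close> to a point there are
      \<open>card V - card U + 1\<close> vertices, and the edges are those avoiding \<open>U\<close>
      plus one for each vertex of \<open>N U\<close>. \<open>Q U\<close> says that the density is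
      still at least \<open>k\<close>.\<close>
    define Q where "Q U \<longleftrightarrow> U \<subseteq> V \<and> connected_in E U \<and>
      k * (card V - card U + 1) \<le> card (edges_in E (V - U)) + card (N U)" for U
    obtain v0 where v0: "v0 \<in> V" using less.prems by auto
    have "Q {v0}"
    proof -
      have "N {v0} = nbrs E (V - {v0}) v0" by (auto simp: N_def nbrs_def)
      moreover have "card (edges_in E (insert v0 (V - {v0}))) =
          card (edges_in E (V - {v0})) + card (nbrs E (V - {v0}) v0)"
        using fin by (intro card_edges_in_insert E) auto
      moreover have "insert v0 (V - {v0}) = V" using v0 by auto
      moreover have "card V - card {v0} + 1 = card V"
        using fin v0 by (simp add: card_gt_0_iff) (metis card_gt_0_iff empty_iff Suc_pred)
      ultimately show ?thesis using less.prems(3) v0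
        unfolding Q_def k_def by (simp add: connected_in_singleton)
    qed
    moreover have "\<forall>U. Q U \<longrightarrow> card U < Suc (card V)"
      using fin by (auto simp: Q_def less_Suc_eq_le card_mono)
    ultimately have "\<exists>U. Q U \<and> (\<forall>U'. Q U' \<longrightarrow> card U' \<le> card U)"
      by (rule ex_has_greatest_nat)
    then obtain U where U: "Q U" and max: "\<And>U'. Q U' \<Longrightarrow> card U' \<le> card U" by blast
    have UV: "U \<subseteq> V" "connected_in E U" "U \<noteq> {}" "finite U"
      using U fin finite_subset unfolding Q_def connected_in_def by auto
    have cU: "card U \<le> card V" "0 < card U" using UV fin by (auto simp: card_mono card_gt_0_iff)
    show ?case
    \<comment> \<open>If \<open>N U\<close> is empty, the contracted point is isolated, so
      \<open>V - U\<close> alone is dense and has fewer vertices: the inner induction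
      applies.\<close>
    proof (cases "N U = {}")
      case True
      have cVU: "card (V - U) = card V - card U" using UV by (simp add: card_Diff_subset)
      have ineq: "k * (card (V - U) + 1) \<le> card (edges_in E (V - U))"
        using U True unfolding Q_def cVU by simp
      have ne: "V - U \<noteq> {}"
      proof
        assume empty: "V - U = {}"
        have "edges_in E {} = {}" using E by (fastforce simp: edges_in_def)
        then show False using ineq[unfolded empty] k by simp
      qed
      have "clique_minor (Suc t + 2) (V - U) E"
      proof (rule less.hyps)
        show "card (V - U) < card V" unfolding cVU using cU by linarith
        show "2 ^ Suc t * card (V - U) \<le> card (edges_in E (V - U))"
          using ineq unfolding k_def by simp
      qed (use fin ne in auto)
      then show ?thesis by (rule clique_minor_mono) auto
    next
      case False
      have finN: "finite (N U)" using fin by (simp add: N_def)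
      \<comment> \<open>Absorbing \<open>x\<close> into \<open>U\<close> removes one vertex and
        destroys the edge from the contracted point to \<open>x\<close> as well as one edge for each
        common neighbour. By maximality this loss exceeds \<open>k\<close>, so \<open>x\<close> has
        at least \<open>k\<close> neighbours in \<open>N U\<close>.\<close>
      have deg: "k \<le> card (nbrs E (N U) x)" if x: "x \<in> N U" for x
      proof -
        obtain u where u: "u \<in> U" "{u, x} \<in> E" "x \<in> V" "x \<notin> U" using x by (auto simp: N_def)
        let ?U = "insert x U" and ?D = "nbrs E (V - insert x U) x"
        have cins: "card ?U = Suc (card U)" using UV u by simp
        have "card ?U \<le> card V" using fin UV u by (intro card_mono) auto
        have "connected_in E ?U" using connected_in_insert[OF UV(2) u(1,2)] .
        moreover have "?U \<subseteq> V" using UV u by auto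
        moreover have "\<not> Q ?U" using max[of ?U] cins by auto
        ultimately have notQ: "card (edges_in E (V - ?U)) + card (N ?U) < k * (card V - card U)"
          using \<open>card ?U \<le> card V\<close> cins unfolding Q_def by (simp add: Suc_diff_Suc not_le)
        have eq: "V - U = insert x (V - ?U)" using u by auto
        have 1: "card (edges_in E (V - U)) = card (edges_in E (V - ?U)) + card ?D"
          unfolding eq by (rule card_edges_in_insert[OF E]) (use fin in auto)
        have Nins: "N ?U = (N U - {x}) \<union> ?D"
          by (auto simp: N_def nbrs_def)
        have NxD: "nbrs E (N U) x = (N U - {x}) \<inter> ?D"
        proof -
          have "x \<notin> nbrs E (N U) x" using E[of "{x}"] by (auto simp: nbrs_def)
          then show ?thesis by (auto simp: N_def nbrs_def)
        qed
        have "card (N U - {x}) + card ?D = card (N ?U) + card (nbrs E (N U) x)"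
          unfolding Nins NxD using finN fin by (intro card_Un_Int) (auto simp: nbrs_def)
        moreover have "card (N U) = Suc (card (N U - {x}))"
          using x finN by (metis card.remove)
        moreover have "k * (card V - card U) + k \<le> card (edges_in E (V - U)) + card (N U)"
          using U unfolding Q_def by simp
        ultimately show ?thesis using 1 notQ by linarith
      qed
      \<comment> \<open>Summing degrees counts each edge twice, so minimum degree
        \<open>2 ^ Suc t\<close> becomes density \<open>2 ^ t\<close>, as required for the outer
        induction; \<open>U\<close> then supplies the additional branch set.\<close>
      have "k * card (N U) \<le> (\<Sum>x\<in>N U. card (nbrs E (N U) x))"
        using sum_bounded_below[of "N U" k "\<lambda>x. card (nbrs E (N U) x)"] deg by (simp add: mult.commute)
      also have "\<dots> = 2 * card (edges_in E (N U))" by (rule sum_card_nbrs[OF E finN])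
      finally have "2 ^ t * card (N U) \<le> card (edges_in E (N U))" by (simp add: k_def)
      then have "clique_minor (t + 2) (N U) E" using IHt[OF finN False] by simp
      then have "clique_minor (Suc (t + 2)) V E"
        by (rule clique_minor_Suc[of _ _ _ _ U]) (use UV in \<open>auto simp: N_def\<close>)
      then show ?thesis by simp
    qed
  qed
qed

text \<open>The case \<open>t = 4\<close>: \<open>6 = 4 + 2\<close> and
  \<open>16 = 2 ^ 4\<close>.\<close>

corollary card_edges_in_le:
  assumes "\<And>e. e \<in> E \<Longrightarrow> card e = 2" "finite V" "\<not> clique_minor 6 V E"
  shows "card (edges_in E V) \<le> 16 * card V"
proof (cases "V = {}")
  case True
  have "edges_in E {} = {}" using assms(1) by (fastforce simp: edges_in_def)
  then show ?thesis using True by simp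
next
  case False
  then show ?thesis using clique_minor_if_dense[OF assms(1,2) False, where t = 4] assms(3) by fastforce
qed

section \<open>Shrinking a minor-free graph\<close>

text \<open>The empty set counts as a clique, since the neighbourhoods compared with cliques later
  may be empty.\<close>

definition cliques :: "'a set set \<Rightarrow> 'a set \<Rightarrow> 'a set set" where
  "cliques H W = {C. C \<subseteq> W \<and> (\<forall>x\<in>C. \<forall>y\<in>C. x \<noteq> y \<longrightarrow> {x, y} \<in> H)}"

lemma finite_cliques: "finite W \<Longrightarrow> finite (cliques H W)"
  by (rule finite_subset[of _ "Pow W"]) (auto simp: cliques_def)

text \<open>The average degree is at most 32, so some \<open>x\<close> has at most 32 neighbours.
  The cliques through \<open>x\<close> are given by subsets of its neighbourhood, at most
  \<open>2 ^ 32\<close>, and \<open>x\<close> can be deleted. The final \<open>+ 1\<close> is the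
  empty clique.\<close>

lemma card_cliques_le:
  assumes H: "\<And>e. e \<in> H \<Longrightarrow> card e = 2" and "finite W" "\<not> clique_minor 6 W H"
  shows "card (cliques H W) \<le> 2 ^ 32 * card W + 1"
  using assms(2,3)
proof (induction "card W" arbitrary: W rule: less_induct)
  case less
  define K :: nat where "K = 2 ^ 32"
  show ?case
  proof (cases "W = {}")
    case True
    then have "cliques H W = {{}}" by (auto simp: cliques_def)
    then show ?thesis by simp
  next
    case False
    have "\<exists>x\<in>W. card (nbrs H W x) \<le> 32"
    proof (rule ccontr)
      assume "\<not> ?thesis"
      then have "33 * card W \<le> (\<Sum>x\<in>W. card (nbrs H W x))"
        using sum_bounded_below[of W 33 "\<lambda>x. card (nbrs H W x)"] by force
      also have "\<dots> \<le> 32 * card W"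
        using sum_card_nbrs[OF H less.prems(1)] card_edges_in_le[OF H less.prems] by simp
      finally show False using False less.prems(1) by simp
    qed
    then obtain x where x: "x \<in> W" "card (nbrs H W x) \<le> 32" by blast
    have cW: "card W = Suc (card (W - {x}))" using x less.prems(1) by (metis card.remove)
    have finN: "finite (nbrs H W x)" using less.prems(1) by (simp add: nbrs_def)
    have "cliques H W \<subseteq> cliques H (W - {x}) \<union> insert x ` Pow (nbrs H W x)"
    proof
      fix C assume C: "C \<in> cliques H W"
      show "C \<in> cliques H (W - {x}) \<union> insert x ` Pow (nbrs H W x)"
      proof (cases "x \<in> C")
        case True
        then have "C = insert x (C - {x})" by auto
        moreover have "C - {x} \<in> Pow (nbrs H W x)"
          using C True by (auto simp: cliques_def nbrs_def)
        ultimately show ?thesis by blast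
      next
        case False
        then show ?thesis using C by (auto simp: cliques_def)
      qed
    qed
    then have "card (cliques H W) \<le> card (cliques H (W - {x})) + card (insert x ` Pow (nbrs H W x))"
      using less.prems(1) finN
      by (intro order_trans[OF card_mono card_Un_le]) (auto simp: finite_cliques)
    also have "card (insert x ` Pow (nbrs H W x)) \<le> 2 ^ card (nbrs H W x)"
      using finN by (metis card_Pow card_image_le finite_Pow_iff)
    also have "(2::nat) ^ card (nbrs H W x) \<le> 2 ^ 32" using x by (intro power_increasing) auto
    also have "card (cliques H (W - {x})) \<le> 2 ^ 32 * card (W - {x}) + 1"
    proof (rule less.hyps)
      show "\<not> clique_minor 6 (W - {x}) H" using less.prems(2) clique_minor_mono by blast
    qed (use cW less.prems in auto)
    finally show ?thesis unfolding cW K_def[symmetric] by simp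
  qed
qed

text \<open>A maximal injective choice of pairs $h(s)$ inside the neighbourhoods gives a minor $H$ on $W$;
  the neighbourhood of every vertex left over is a clique of $H$.\<close>
lemma card_le_if_distinct_nbrs:
  fixes E :: "'a set set"
  assumes E: "\<And>e. e \<in> E \<Longrightarrow> card e = 2" and fin: "finite V" and sub: "W \<subseteq> V" "L \<subseteq> V"
    and disj: "W \<inter> L = {}" and minor: "\<not> clique_minor 6 V E" and inj: "inj_on (nbrs E W) L"
  shows "card L \<le> (16 + 2 ^ 32) * card W + 1"
proof -
  define P where "P S h \<longleftrightarrow> S \<subseteq> L \<and> inj_on h S \<and> (\<forall>s\<in>S. h s \<subseteq> nbrs E W s \<and> card (h s) = 2)"
    for S :: "'a set" and h :: "'a \<Rightarrow> 'a set"
  have finL: "finite L" and finW: "finite W" using fin sub finite_subset by auto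
  have "\<exists>h. P {} h" by (simp add: P_def)
  moreover have "\<forall>S. (\<exists>h. P S h) \<longrightarrow> card S < Suc (card L)"
    using finL by (auto simp: P_def less_Suc_eq_le card_mono)
  ultimately have "\<exists>S. (\<exists>h. P S h) \<and> (\<forall>S'. (\<exists>h. P S' h) \<longrightarrow> card S' \<le> card S)"
    by (rule ex_has_greatest_nat)
  then obtain S h where S: "P S h" and max: "\<And>S' h'. P S' h' \<Longrightarrow> card S' \<le> card S" by blast
  have SL: "S \<subseteq> L" and h: "inj_on h S" "\<And>s. s \<in> S \<Longrightarrow> h s \<subseteq> nbrs E W s" "\<And>s. s \<in> S \<Longrightarrow> card (h s) = 2"
    using S by (auto simp: P_def)
  define H where "H = h ` S"
  have H2: "card e = 2" if "e \<in> H" for e using that h by (auto simp: H_def)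
  have finS: "finite S" using SL finL finite_subset by blast
  have "\<exists>w. w \<in> h s" if "s \<in> S" for s using h(3)[OF that] by (cases "h s = {}") auto
  then obtain g where g: "\<And>s. s \<in> S \<Longrightarrow> g s \<in> h s" by metis
  have sE: "{s, w} \<in> E \<and> w \<in> W" if "s \<in> S" "w \<in> h s" for s w
    using h(2)[OF that(1)] that(2) by (auto simp: nbrs_def)
  have SW: "s \<notin> W" if "s \<in> S" for s using that SL disj by blast
  have minorH: "\<not> clique_minor 6 W H"
  proof
    assume m: "clique_minor 6 W H"
    \<comment> \<open>Contracting \<open>s\<close> into one end \<open>g s\<close> of its pair turns
      the edge from \<open>s\<close> to the other end into the edge \<open>h s\<close> of
      \<open>H\<close>.\<close>
    define \<phi> where "\<phi> v = (if v \<in> S then g v else v)" for v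
    have "clique_minor 6 V E"
    proof (rule clique_minor_lift[OF m, where V' = "W \<union> S" and \<phi> = \<phi>])
      show "W \<union> S \<subseteq> V" using sub SL by auto
      show "connected_in E {v \<in> W \<union> S. \<phi> v = u}" if "u \<in> W" for u
      proof (rule connected_in_star[of u])
        show "u \<in> {v \<in> W \<union> S. \<phi> v = u}" using that SW by (auto simp: \<phi>_def)
        show "{x, u} \<in> E" if "x \<in> {v \<in> W \<union> S. \<phi> v = u}" "x \<noteq> u" for x
        proof -
          have "x \<in> S" "g x = u" using that by (auto simp: \<phi>_def split: if_splits)
          then show ?thesis using sE g by blast
        qed
      qed
      show "\<exists>x\<in>W \<union> S. \<exists>y\<in>W \<union> S. \<phi> x = u \<and> \<phi> y = w \<and> {x, y} \<in> E"
        if uw: "u \<in> W" "w \<in> W" "u \<noteq> w" "{u, w} \<in> H" for u w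
      proof -
        obtain s where s: "s \<in> S" "h s = {u, w}" using uw by (auto simp: H_def)
        have \<phi>: "\<phi> u = u" "\<phi> w = w" using uw SW by (auto simp: \<phi>_def)
        have e: "{s, u} \<in> E" "{s, w} \<in> E" using sE[OF s(1)] s(2) by auto
        have "g s = u \<or> g s = w" using g[OF s(1)] s(2) by auto
        then show ?thesis
        proof
          assume "g s = u"
          then show ?thesis using s \<phi> e uw by (intro bexI[of _ s] bexI[of _ w]) (auto simp: \<phi>_def)
        next
          assume "g s = w"
          then show ?thesis using s \<phi> e uw
            by (intro bexI[of _ u] bexI[of _ s]) (auto simp: \<phi>_def insert_commute)
        qed
      qed
    qed
    then show False using minor by simp
  qed
  have "H = edges_in H W" using h(2) by (auto simp: H_def edges_in_def nbrs_def)
  then have "card H \<le> 16 * card W" using card_edges_in_le[OF H2 finW minorH] by simp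
  \<comment> \<open>The vertices of \<open>S\<close> are counted by the edges of \<open>H\<close>,
    those of \<open>L - S\<close> by the cliques of \<open>H\<close>; the latter count is injective
    because neighbourhoods are distinct.\<close>
  then have cS: "card S \<le> 16 * card W" using h(1) by (simp add: H_def card_image)
  have "nbrs E W ` (L - S) \<subseteq> cliques H W"
  proof
    fix C assume "C \<in> nbrs E W ` (L - S)"
    then obtain v where v: "v \<in> L" "v \<notin> S" "C = nbrs E W v" by blast
    show "C \<in> cliques H W"
      unfolding cliques_def
    proof (intro CollectI conjI ballI impI)
      show "C \<subseteq> W" using v by (auto simp: nbrs_def)
      fix x y assume xy: "x \<in> C" "y \<in> C" "x \<noteq> y"
      show "{x, y} \<in> H"
      proof (rule ccontr)
        assume "{x, y} \<notin> H"
        then have "inj_on (h(v := {x, y})) (insert v S)"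
          using h(1) v(2) by (auto simp: inj_on_def H_def)
        then have "P (insert v S) (h(v := {x, y}))"
          using v xy SL h by (auto simp: P_def)
        from max[OF this] show False using v(2) finS by simp
      qed
    qed
  qed
  moreover have "inj_on (nbrs E W) (L - S)" using inj by (rule inj_on_subset) auto
  ultimately have "card (L - S) \<le> card (cliques H W)"
    using finW by (metis card_image card_mono finite_cliques)
  also have "\<dots> \<le> 2 ^ 32 * card W + 1" by (rule card_cliques_le[OF H2 finW minorH])
  finally have "card (L - S) \<le> 2 ^ 32 * card W + 1" .
  moreover have "card L = card S + card (L - S)"
    using SL finL finS by (simp add: card_Diff_subset card_mono)
  ultimately show ?thesis using cS by (simp only: add_mult_distrib)
qed

text \<open>With \<open>c = 16 + 2 ^ 32\<close> and \<open>y\<close> matched pairs, there are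
  \<open>2 y\<close> matched and at most \<open>2 c y + 1\<close> unmatched vertices. As
  \<open>y \<ge> 1\<close> for at least two vertices, the total is at most
  \<open>(2 c + 3) y\<close>.\<close>

definition shrink_ratio :: nat where "shrink_ratio = 2 * (16 + 2 ^ 32) + 3"

text \<open>A maximal matching among the pairs of vertices that are adjacent or have equal
  neighbourhoods is contracted: the unmatched vertices are independent and have distinct
  neighbourhoods, so they are at most a constant times as many as the matched ones.\<close>
lemma shrinking_map:
  fixes E :: "'a set set"
  assumes simple: "simple_graph V E" and fin: "finite V" and minor: "\<not> clique_minor 6 V E"
    and V: "2 \<le> card V"
  obtains U \<pi> E' where "U \<subseteq> V" "card V \<le> shrink_ratio * card (V - U)"
    "\<And>v. v \<in> V \<Longrightarrow> \<pi> v \<in> U" "\<And>u. u \<in> U \<Longrightarrow> \<pi> u = u"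
    "\<And>u. card {v \<in> V. \<pi> v = u} \<le> 2"
    "simple_graph U E'" "\<not> clique_minor 6 U E'"
    "\<And>e. e \<in> E \<Longrightarrow> \<pi> ` e \<in> E' \<or> (\<exists>u\<in>U. \<pi> ` e = {u})"
proof -
  have E: "\<And>e. e \<in> E \<Longrightarrow> card e = 2" and EV: "\<And>e. e \<in> E \<Longrightarrow> e \<subseteq> V"
    using simple by (auto simp: simple_graph_def)
  define R where "R x y \<longleftrightarrow> x \<noteq> y \<and> ({x, y} \<in> E \<or> nbrs E V x = nbrs E V y)" for x y
  define P where "P Y \<mu> \<longleftrightarrow> Y \<subseteq> V \<and> inj_on \<mu> Y \<and> \<mu> ` Y \<subseteq> V \<and> \<mu> ` Y \<inter> Y = {} \<and> (\<forall>y\<in>Y. R y (\<mu> y))"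
    for Y :: "'a set" and \<mu> :: "'a \<Rightarrow> 'a"
  have "\<exists>\<mu>. P {} \<mu>" by (simp add: P_def)
  moreover have "\<forall>Y. (\<exists>\<mu>. P Y \<mu>) \<longrightarrow> card Y < Suc (card V)"
    using fin by (auto simp: P_def less_Suc_eq_le card_mono)
  ultimately have "\<exists>Y. (\<exists>\<mu>. P Y \<mu>) \<and> (\<forall>Y'. (\<exists>\<mu>. P Y' \<mu>) \<longrightarrow> card Y' \<le> card Y)"
    by (rule ex_has_greatest_nat)
  then obtain Y \<mu> where Y: "P Y \<mu>" and max: "\<And>Y' \<mu>'. P Y' \<mu>' \<Longrightarrow> card Y' \<le> card Y" by blast
  have YV: "Y \<subseteq> V" and \<mu>: "inj_on \<mu> Y" "\<mu> ` Y \<subseteq> V" "\<mu> ` Y \<inter> Y = {}" "\<And>y. y \<in> Y \<Longrightarrow> R y (\<mu> y)"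
    using Y by (auto simp: P_def)
  have finY: "finite Y" using YV fin finite_subset by blast
  \<comment> \<open>\<open>Y\<close> contains one vertex of each matched pair; \<pi> sends it to its
    partner \<mu>, which survives in \<open>U\<close>.\<close>
  define U where "U = V - Y"
  define \<pi> where "\<pi> v = (if v \<in> Y then \<mu> v else v)" for v
  define E' where "E' = {e \<in> (\<lambda>e. \<pi> ` e) ` E. card e = 2}"
  have \<pi>U: "\<pi> v \<in> U" if "v \<in> V" for v using that \<mu> by (auto simp: \<pi>_def U_def)
  have \<mu>U: "\<mu> y \<in> U" if "y \<in> Y" for y using that \<mu> by (auto simp: U_def)
  have id: "\<pi> u = u" if "u \<in> U" for u using that by (auto simp: \<pi>_def U_def)
  define W where "W = Y \<union> \<mu> ` Y"
  define L where "L = V - W"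
  have noR: "\<not> R x y" if "x \<in> L" "y \<in> L" for x y
  proof
    assume R: "R x y"
    have "x \<noteq> y" using R by (simp add: R_def)
    have "inj_on (\<mu>(x := y)) (insert x Y)"
      using \<mu>(1) that by (auto simp: inj_on_def L_def W_def)
    moreover have "(\<mu>(x := y)) ` insert x Y = insert y (\<mu> ` Y)"
      using that by (auto simp: L_def W_def)
    ultimately have "P (insert x Y) (\<mu>(x := y))"
      using YV \<mu> that R \<open>x \<noteq> y\<close> unfolding P_def by (auto simp: L_def W_def)
    from max[OF this] show False using that finY by (simp add: L_def W_def)
  qed
  \<comment> \<open>Unmatched vertices are independent, so all neighbours of one lie in
    \<open>W\<close>. Thus distinct neighbourhoods in \<open>V\<close> are already distinct in
    \<open>W\<close>.\<close>
  have nbW: "nbrs E W x = nbrs E V x" if "x \<in> L" for x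
  proof -
    have "y \<in> W" if "y \<in> V" "{x, y} \<in> E" for y
    proof (rule ccontr)
      assume "y \<notin> W"
      then have "y \<in> L" using that by (simp add: L_def)
      have "x \<noteq> y" using E[OF that(2)] by auto
      then show False using noR[OF \<open>x \<in> L\<close> \<open>y \<in> L\<close>] that(2) by (simp add: R_def)
    qed
    then show ?thesis using YV \<mu> by (auto simp: nbrs_def W_def)
  qed
  have inj: "inj_on (nbrs E W) L"
    using noR nbW by (auto simp: inj_on_def R_def)
  have WV: "W \<subseteq> V" using YV \<mu> by (auto simp: W_def)
  have cW: "card W = 2 * card Y"
    using \<mu>(1,3) finY by (simp add: W_def card_Un_disjoint Int_commute card_image)
  have "card L \<le> (16 + 2 ^ 32) * card W + 1"
    by (rule card_le_if_distinct_nbrs[OF E fin WV _ _ minor inj]) (auto simp: L_def)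
  moreover have "card V = card L + card W"
    using WV fin by (simp add: L_def card_Diff_subset finite_subset card_mono)
  moreover have "V - U = Y" using YV by (auto simp: U_def)
  ultimately have ratio: "card V \<le> shrink_ratio * card (V - U)"
  proof -
    define c :: nat where "c = 16 + 2 ^ 32"
    assume *: "card L \<le> (16 + 2 ^ 32) * card W + 1" "card V = card L + card W" "V - U = Y"
    have "card V \<le> (2 * c + 2) * card Y + 1"
      using *(1,2) cW unfolding c_def[symmetric] by (simp add: algebra_simps)
    moreover have "1 \<le> card Y"
    proof (rule ccontr)
      assume "\<not> 1 \<le> card Y"
      then have "card Y = 0" by simp
      then show False using calculation V by simp
    qed
    ultimately have "card V \<le> (2 * c + 2) * card Y + card Y" by linarith
    then show ?thesis unfolding shrink_ratio_def c_def[symmetric] *(3) by (simp add: algebra_simps)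
  qed
  have fibre: "card {v \<in> V. \<pi> v = u} \<le> 2" for u
  proof -
    have one: "card {y \<in> Y. \<mu> y = u} \<le> 1"
      using finY \<mu>(1) by (auto simp: card_le_Suc0_iff_eq inj_on_def)
    have "{v \<in> V. \<pi> v = u} \<subseteq> {u} \<union> {y \<in> Y. \<mu> y = u}" by (auto simp: \<pi>_def split: if_splits)
    then have "card {v \<in> V. \<pi> v = u} \<le> card ({u} \<union> {y \<in> Y. \<mu> y = u})"
      using finY by (intro card_mono) auto
    also have "\<dots> \<le> card {u} + card {y \<in> Y. \<mu> y = u}" by (rule card_Un_le)
    finally show ?thesis using one by simp
  qed
  have simple': "simple_graph U E'"
    using \<pi>U EV by (fastforce simp: simple_graph_def E'_def)
  have minor': "\<not> clique_minor 6 U E'"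
  proof
    assume m: "clique_minor 6 U E'"
    \<comment> \<open>The vertices matched to a non-adjacent twin are deleted; the other pairs are edges.\<close>
    define V' where "V' = {v \<in> V. v \<in> Y \<longrightarrow> {v, \<mu> v} \<in> E}"
    have "clique_minor 6 V E"
    proof (rule clique_minor_lift[OF m, where V' = V' and \<phi> = \<pi>])
      show "V' \<subseteq> V" by (auto simp: V'_def)
      show "connected_in E {v \<in> V'. \<pi> v = u}" if "u \<in> U" for u
      proof (rule connected_in_star[of u])
        show "u \<in> {v \<in> V'. \<pi> v = u}" using that id by (auto simp: V'_def U_def)
        show "{x, u} \<in> E" if "x \<in> {v \<in> V'. \<pi> v = u}" "x \<noteq> u" for x
          using that by (auto simp: V'_def \<pi>_def split: if_splits)
      qed
      show "\<exists>x\<in>V'. \<exists>y\<in>V'. \<pi> x = u \<and> \<pi> y = w \<and> {x, y} \<in> E"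
        if uw: "u \<in> U" "w \<in> U" "u \<noteq> w" "{u, w} \<in> E'" for u w
      proof -
        obtain e where e: "e \<in> E" "\<pi> ` e = {u, w}" using uw by (auto simp: E'_def)
        obtain a b where ab: "e = {a, b}" "a \<noteq> b" using E[OF e(1)] by (meson card_2_iff)
        have "\<exists>x y. {x, y} \<in> E \<and> \<pi> x = u \<and> \<pi> y = w"
        proof (cases "\<pi> a = u")
          case True
          then have "\<pi> b = w" using e(2) ab uw(3) by (auto simp: doubleton_eq_iff)
          then show ?thesis using True e ab by blast
        next
          case False
          then have "\<pi> a = w" "\<pi> b = u" using e(2) ab uw(3) by (auto simp: doubleton_eq_iff)
          then show ?thesis using e ab by (metis insert_commute)
        qed
        then obtain x y where xy: "{x, y} \<in> E" "\<pi> x = u" "\<pi> y = w" by blast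
        have V': "z \<in> V'" if "z \<in> U" for z using that by (auto simp: V'_def U_def)
        \<comment> \<open>A deleted vertex is replaced by its partner, which has the same neighbours
          and the same image under \<pi>. Applied to one endpoint and then to the other, this brings
          the edge into \<open>V'\<close>.\<close>
        have move: "\<exists>x'\<in>V'. \<pi> x' = \<pi> x \<and> {x', y} \<in> E" if xy: "{x, y} \<in> E" for x y
        proof (cases "x \<in> V'")
          case True
          then show ?thesis using xy by blast
        next
          case False
          have "x \<in> V" "y \<in> V" using EV[OF xy] by auto
          then have x: "x \<in> Y" "{x, \<mu> x} \<notin> E" using False by (auto simp: V'_def)
          then have "nbrs E V x = nbrs E V (\<mu> x)" using \<mu>(4) by (auto simp: R_def)
          moreover have "y \<in> nbrs E V x" using xy \<open>y \<in> V\<close> by (simp add: nbrs_def)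
          ultimately have "{\<mu> x, y} \<in> E" by (auto simp: nbrs_def)
          then show ?thesis using V'[OF \<mu>U[OF x(1)]] id[OF \<mu>U[OF x(1)]] x
            by (intro bexI[of _ "\<mu> x"]) (auto simp: \<pi>_def)
        qed
        obtain x' where x': "x' \<in> V'" "\<pi> x' = u" "{y, x'} \<in> E"
          using move[OF xy(1)] xy by (auto simp: insert_commute)
        obtain y' where "y' \<in> V'" "\<pi> y' = w" "{y', x'} \<in> E"
          using move[OF x'(3)] xy by auto
        then show ?thesis using x' by (auto simp: insert_commute)
      qed
    qed
    then show False using minor by simp
  qed
  have img: "\<pi> ` e \<in> E' \<or> (\<exists>u\<in>U. \<pi> ` e = {u})" if "e \<in> E" for e
  proof -
    obtain a b where ab: "e = {a, b}" "a \<noteq> b" using E[OF \<open>e \<in> E\<close>] by (meson card_2_iff)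
    have in': "a \<in> V" "b \<in> V" using EV[OF \<open>e \<in> E\<close>] ab by auto
    show ?thesis
    proof (cases "\<pi> a = \<pi> b")
      case True
      then show ?thesis using ab \<pi>U[OF in'(1)] by auto
    next
      case False
      then have "card (\<pi> ` e) = 2" using ab by simp
      then show ?thesis using \<open>e \<in> E\<close> by (auto simp: E'_def)
    qed
  qed
  show thesis
    by (rule that[of U \<pi> E']) (use ratio \<pi>U id fibre simple' minor' img in \<open>auto simp: U_def\<close>)
qed

section \<open>Counting minor-free graphs\<close>

definition minor_free :: "'a set \<Rightarrow> 'a set set set" where
  "minor_free V = {E. simple_graph V E \<and> \<not> clique_minor 6 V E}"

lemma finite_simple_graphs: "finite V \<Longrightarrow> finite {E. simple_graph V E}"
  by (rule finite_subset[of _ "Pow (Pow V)"]) (auto simp: simple_graph_def)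

lemma finite_minor_free: "finite V \<Longrightarrow> finite (minor_free V)"
  by (rule finite_subset[OF _ finite_simple_graphs[of V]]) (auto simp: minor_free_def)

text \<open>The candidates for edges of a graph $E$ on $V$ whose image under $\<pi>$ is $E'$: as $\<pi>$ has fibres of
  size at most two, there are only linearly many, and $E$ is determined by $U$, $\<pi>$, $E'$ and a set
  of candidates.\<close>
definition pairs_over :: "'a set \<Rightarrow> ('a \<Rightarrow> 'a) \<Rightarrow> 'a set \<Rightarrow> 'a set set \<Rightarrow> 'a set set" where
  "pairs_over V \<pi> U E' = (\<Union>F\<in>E' \<union> (\<lambda>u. {u}) ` U. Pow {v \<in> V. \<pi> v \<in> F})"

text \<open>\<open>260 = 16 * 16 + 4\<close>: there are at most \<open>16 * card U\<close> edges in
  \<open>E'\<close>, with at most four vertices above each and so \<open>2 ^ 4\<close> subsets, and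
  above each vertex of \<open>U\<close> there are at most two vertices and so \<open>2 ^ 2\<close>
  subsets.\<close>

lemma card_pairs_over_le:
  assumes fin: "finite V" "U \<subseteq> V" and E': "E' \<in> minor_free U"
    and fibre: "\<And>u. card {v \<in> V. \<pi> v = u} \<le> 2"
  shows "card (pairs_over V \<pi> U E') \<le> 260 * card V" "finite (pairs_over V \<pi> U E')"
proof -
  have finU: "finite U" using fin finite_subset by blast
  have E'2: "\<And>e. e \<in> E' \<Longrightarrow> card e = 2" and E'U: "\<And>e. e \<in> E' \<Longrightarrow> e \<subseteq> U"
    using E' by (auto simp: minor_free_def simple_graph_def)
  have finE': "finite E'" by (rule finite_subset[of _ "Pow U"]) (use E'U finU in auto)
  have "edges_in E' U = E'" using E'U by (auto simp: edges_in_def)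
  then have cE': "card E' \<le> 16 * card U"
    using card_edges_in_le[of E' U, OF E'2 finU] E' by (simp add: minor_free_def)
  have single: "card (Pow {v \<in> V. \<pi> v \<in> {u}}) \<le> 4" for u
  proof -
    have "card (Pow {v \<in> V. \<pi> v \<in> {u}}) = 2 ^ card {v \<in> V. \<pi> v = u}" using fin by (simp add: card_Pow)
    also have "\<dots> \<le> 2 ^ 2" using fibre by (intro power_increasing) auto
    finally show ?thesis by simp
  qed
  have double: "card (Pow {v \<in> V. \<pi> v \<in> F}) \<le> 16" if "F \<in> E'" for F
  proof -
    obtain a b where F: "F = {a, b}" using E'2[OF \<open>F \<in> E'\<close>] by (meson card_2_iff)
    have "{v \<in> V. \<pi> v \<in> F} = {v \<in> V. \<pi> v = a} \<union> {v \<in> V. \<pi> v = b}" using F by auto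
    then have "card {v \<in> V. \<pi> v \<in> F} \<le> card {v \<in> V. \<pi> v = a} + card {v \<in> V. \<pi> v = b}"
      using card_Un_le by metis
    then have "card {v \<in> V. \<pi> v \<in> F} \<le> 4" using fibre[of a] fibre[of b] by linarith
    then have "(2::nat) ^ card {v \<in> V. \<pi> v \<in> F} \<le> 2 ^ 4" by (intro power_increasing) auto
    then show ?thesis using fin by (simp add: card_Pow)
  qed
  let ?f = "\<lambda>F. Pow {v \<in> V. \<pi> v \<in> F}"
  have split: "pairs_over V \<pi> U E' = (\<Union>F\<in>E'. ?f F) \<union> (\<Union>u\<in>U. ?f {u})"
    by (auto simp: pairs_over_def)
  have "card (\<Union>F\<in>E'. ?f F) \<le> (\<Sum>F\<in>E'. card (?f F))" by (rule card_UN_le[OF finE'])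
  also have "\<dots> \<le> card E' * 16" using sum_bounded_above[of E' "\<lambda>F. card (?f F)" 16] double by simp
  finally have 1: "card (\<Union>F\<in>E'. ?f F) \<le> 256 * card U" using cE' by linarith
  have "card (\<Union>u\<in>U. ?f {u}) \<le> (\<Sum>u\<in>U. card (?f {u}))" by (rule card_UN_le[OF finU])
  also have "\<dots> \<le> card U * 4" using sum_bounded_above[of U "\<lambda>u. card (?f {u})" 4] single by simp
  finally have 2: "card (\<Union>u\<in>U. ?f {u}) \<le> 4 * card U" by linarith
  have "card U \<le> card V" using fin by (intro card_mono)
  then show "card (pairs_over V \<pi> U E') \<le> 260 * card V"
    using card_Un_le[of "\<Union>F\<in>E'. ?f F" "\<Union>u\<in>U. ?f {u}"] 1 2 unfolding split by linarith
  show "finite (pairs_over V \<pi> U E')"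
    unfolding split using finE' finU fin by auto
qed

text \<open>Chosen so that \<open>growth_rate ^ card (V - U)\<close> dominates
  \<open>2 ^ (261 * n)\<close>: \<open>260 * n\<close> bits for the set of candidate edges and
  \<open>n\<close> bits for the choice of \<open>U\<close>.\<close>

definition growth_rate :: nat where "growth_rate = 2 ^ (261 * shrink_ratio)"

lemma card_minor_free_le:
  assumes "finite V"
  shows "card (minor_free V) \<le> growth_rate ^ card V * card V ^ card V"
  using assms
proof (induction "card V" arbitrary: V rule: less_induct)
  case less
  define n where "n = card V"
  note fin = less.prems
  have n0: "0 < growth_rate" by (simp add: growth_rate_def)
  show ?case
  proof (cases "2 \<le> n")
    case False
    have "E = {}" if simple: "simple_graph V E" for E
    proof (rule ccontr)
      assume "E \<noteq> {}"
      then obtain e where "e \<subseteq> V" "card e = 2" using simple unfolding simple_graph_def by blast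
      then show False using False card_mono[OF fin, of e] by (simp add: n_def)
    qed
    then have "card (minor_free V) \<le> card {{} :: 'a set set}"
      by (intro card_mono) (auto simp: minor_free_def)
    moreover have "1 \<le> growth_rate ^ n * n ^ n" 
    proof -
      have "n = 0 \<or> n = 1" using False by linarith
      then show ?thesis using n0 by auto
    qed
    moreover have "card {{} :: 'a set set} = 1" by simp
    ultimately show ?thesis unfolding n_def by linarith
  next
    case True
    define \<U> where "\<U> = {U \<in> Pow V. n \<le> shrink_ratio * card (V - U)}"
    \<comment> \<open>These maps are fixed on \<open>U\<close>, so only the vertices of
      \<open>V - U\<close> have a choice; extensionality makes them finite in number.\<close>
    define \<M> where "\<M> U = {\<pi> \<in> PiE V (\<lambda>v. if v \<in> U then {v} else U). \<forall>u. card {v \<in> V. \<pi> v = u} \<le> 2}"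
      for U :: "'a set"
    have sub: "minor_free V \<subseteq>
      (\<Union>U\<in>\<U>. \<Union>\<pi>\<in>\<M> U. \<Union>E'\<in>minor_free U. Pow (pairs_over V \<pi> U E'))"
    proof
      fix E assume "E \<in> minor_free V"
      then have E: "simple_graph V E" "\<not> clique_minor 6 V E" by (auto simp: minor_free_def)
      obtain U \<pi> E' where s: "U \<subseteq> V" "card V \<le> shrink_ratio * card (V - U)"
        "\<And>v. v \<in> V \<Longrightarrow> \<pi> v \<in> U" "\<And>u. u \<in> U \<Longrightarrow> \<pi> u = u"
        "\<And>u. card {v \<in> V. \<pi> v = u} \<le> 2"
        "simple_graph U E'" "\<not> clique_minor 6 U E'"
        "\<And>e. e \<in> E \<Longrightarrow> \<pi> ` e \<in> E' \<or> (\<exists>u\<in>U. \<pi> ` e = {u})"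
        using shrinking_map[OF E(1) fin E(2) True[unfolded n_def]] by blast
      define \<rho> where "\<rho> = restrict \<pi> V"
      have \<rho>: "\<rho> v = \<pi> v" if "v \<in> V" for v using that by (simp add: \<rho>_def)
      have fibre_eq: "{v \<in> V. \<rho> v = u} = {v \<in> V. \<pi> v = u}" for u using \<rho> by auto
      have "U \<in> \<U>" using s(1,2) by (simp add: \<U>_def n_def)
      moreover have "\<rho> \<in> \<M> U"
        using s(3-5) fibre_eq by (auto simp: \<M>_def \<rho>_def)
      moreover have "E' \<in> minor_free U" using s by (simp add: minor_free_def)
      moreover have "E \<in> Pow (pairs_over V \<rho> U E')"
      proof
        show "E \<subseteq> pairs_over V \<rho> U E'"
        proof
          fix e assume e: "e \<in> E"
          then have eV: "e \<subseteq> V" using E(1) by (auto simp: simple_graph_def)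
          have "\<pi> ` e \<in> E' \<union> (\<lambda>u. {u}) ` U" using s(8)[OF e] by auto
          moreover have "e \<in> Pow {v \<in> V. \<rho> v \<in> \<pi> ` e}" using eV \<rho> by auto
          ultimately show "e \<in> pairs_over V \<rho> U E'" unfolding pairs_over_def by blast
        qed
      qed
      ultimately show "E \<in> (\<Union>U\<in>\<U>. \<Union>\<pi>\<in>\<M> U. \<Union>E'\<in>minor_free U. Pow (pairs_over V \<pi> U E'))"
        by blast
    qed
    have fin\<U>: "finite \<U>" and c\<U>: "card \<U> \<le> 2 ^ n"
    proof -
      show "finite \<U>" using fin by (simp add: \<U>_def)
      have "card \<U> \<le> card (Pow V)" using fin by (intro card_mono) (auto simp: \<U>_def)
      then show "card \<U> \<le> 2 ^ n" using fin by (simp add: card_Pow n_def)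
    qed
    have bound: "card (\<Union>\<pi>\<in>\<M> U. \<Union>E'\<in>minor_free U. Pow (pairs_over V \<pi> U E'))
        \<le> 2 ^ (260 * n) * (growth_rate ^ card U * n ^ n)"
      and finite_U: "finite (\<Union>\<pi>\<in>\<M> U. \<Union>E'\<in>minor_free U. Pow (pairs_over V \<pi> U E'))"
      if U: "U \<in> \<U>" for U
    proof -
      have UV: "U \<subseteq> V" "n \<le> shrink_ratio * card (V - U)" using U by (auto simp: \<U>_def)
      have finU: "finite U" using UV fin finite_subset by blast
      have cU: "card U \<le> n" using UV fin by (simp add: n_def card_mono)
      have "card (V - U) \<noteq> 0" using UV(2) True by (intro notI) simp
      then have "card U < card V" using UV fin by (simp add: card_Diff_subset finU)
      then have IH: "card (minor_free U) \<le> growth_rate ^ card U * card U ^ card U"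
        using less.hyps finU by blast
      let ?P = "PiE V (\<lambda>v. if v \<in> U then {v} else U)"
      have finP: "finite ?P" using fin finU by (intro finite_PiE) auto
      have fin\<M>: "finite (\<M> U)" by (rule finite_subset[OF _ finP]) (auto simp: \<M>_def)
      have "card (\<M> U) \<le> card ?P" using finP by (intro card_mono) (auto simp: \<M>_def)
      also have "\<dots> = (\<Prod>v\<in>V. card (if v \<in> U then {v} else U))" using fin by (rule card_PiE)
      also have "\<dots> = (\<Prod>v\<in>V. if v \<in> U then 1 else card U)" by (intro prod.cong) auto
      also have "\<dots> = card U ^ card (V - U)"
        using fin UV by (simp add: prod.If_cases Diff_eq)
      also have "\<dots> \<le> n ^ card (V - U)" using cU by (rule power_mono) simp
      finally have c\<M>: "card (\<M> U) \<le> n ^ card (V - U)" .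
      have inner: "card (\<Union>E'\<in>minor_free U. Pow (pairs_over V \<pi> U E'))
          \<le> card (minor_free U) * 2 ^ (260 * n)" if \<pi>: "\<pi> \<in> \<M> U" for \<pi>
      proof -
        have "card (Pow (pairs_over V \<pi> U E')) \<le> 2 ^ (260 * n)" if E': "E' \<in> minor_free U" for E'
        proof -
          have "card (pairs_over V \<pi> U E') \<le> 260 * n" "finite (pairs_over V \<pi> U E')"
            using card_pairs_over_le[OF fin UV(1) E', of \<pi>] \<pi> by (auto simp: \<M>_def n_def)
          then show ?thesis by (simp add: card_Pow power_increasing)
        qed
        then have "(\<Sum>E'\<in>minor_free U. card (Pow (pairs_over V \<pi> U E')))
            \<le> card (minor_free U) * 2 ^ (260 * n)"
          using sum_bounded_above[of "minor_free U" "\<lambda>E'. card (Pow (pairs_over V \<pi> U E'))" "2 ^ (260 * n)"]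
          by simp
        then show ?thesis by (rule order_trans[OF card_UN_le[OF finite_minor_free[OF finU]]])
      qed
      have "card (\<Union>\<pi>\<in>\<M> U. \<Union>E'\<in>minor_free U. Pow (pairs_over V \<pi> U E'))
          \<le> (\<Sum>\<pi>\<in>\<M> U. card (\<Union>E'\<in>minor_free U. Pow (pairs_over V \<pi> U E')))"
        by (rule card_UN_le[OF fin\<M>])
      also have "\<dots> \<le> card (\<M> U) * (card (minor_free U) * 2 ^ (260 * n))"
        using sum_bounded_above[of "\<M> U" _ "card (minor_free U) * 2 ^ (260 * n)"] inner by simp
      also have "\<dots> \<le> n ^ card (V - U) * ((growth_rate ^ card U * n ^ card U) * 2 ^ (260 * n))"
      proof (intro mult_le_mono c\<M> le_refl)
        have "card U ^ card U \<le> n ^ card U" using cU by (rule power_mono) simp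
        then show "card (minor_free U) \<le> growth_rate ^ card U * n ^ card U"
          using IH mult_le_mono2 order_trans by blast
      qed
      also have "\<dots> = 2 ^ (260 * n) * (growth_rate ^ card U * (n ^ card (V - U) * n ^ card U))"
        by (simp only: mult_ac)
      also have "n ^ card (V - U) * n ^ card U = n ^ n"
      proof -
        have "card (V - U) + card U = n" using UV fin by (simp add: n_def card_Diff_subset finU card_mono)
        then show ?thesis by (simp flip: power_add)
      qed
      finally show "card (\<Union>\<pi>\<in>\<M> U. \<Union>E'\<in>minor_free U. Pow (pairs_over V \<pi> U E'))
        \<le> 2 ^ (260 * n) * (growth_rate ^ card U * n ^ n)" .
      show "finite (\<Union>\<pi>\<in>\<M> U. \<Union>E'\<in>minor_free U. Pow (pairs_over V \<pi> U E'))"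
        using fin\<M> finite_minor_free[OF finU] card_pairs_over_le(2)[OF fin UV(1)]
        by (auto simp: \<M>_def)
    qed
    \<comment> \<open>The factor \<open>2 ^ n\<close> pays in advance for the sum over at most
      \<open>2 ^ n\<close> sets \<open>U\<close>.\<close>
    have bound': "card (\<Union>\<pi>\<in>\<M> U. \<Union>E'\<in>minor_free U. Pow (pairs_over V \<pi> U E')) * 2 ^ n
        \<le> growth_rate ^ n * n ^ n" if U: "U \<in> \<U>" for U
    proof -
      have UV: "U \<subseteq> V" "n \<le> shrink_ratio * card (V - U)" using U by (auto simp: \<U>_def)
      have "card (\<Union>\<pi>\<in>\<M> U. \<Union>E'\<in>minor_free U. Pow (pairs_over V \<pi> U E')) * 2 ^ n
         \<le> 2 ^ (260 * n) * (growth_rate ^ card U * n ^ n) * 2 ^ n"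
        using bound[OF U] by (rule mult_le_mono1)
      also have "\<dots> = (2 ^ (260 * n) * 2 ^ n) * (growth_rate ^ card U * n ^ n)"
        by (simp only: mult_ac)
      also have "(2::nat) ^ (260 * n) * 2 ^ n = 2 ^ (261 * n)" by (simp flip: power_add)
      also have "(2::nat) ^ (261 * n) \<le> 2 ^ (261 * (shrink_ratio * card (V - U)))"
        using UV(2) by (intro power_increasing mult_le_mono2) auto
      also have "(2::nat) ^ (261 * (shrink_ratio * card (V - U))) = growth_rate ^ card (V - U)"
        unfolding growth_rate_def power_mult[symmetric] by (simp only: mult_ac)
      also have "growth_rate ^ card (V - U) * (growth_rate ^ card U * n ^ n) = growth_rate ^ n * n ^ n"
      proof -
        have "card (V - U) + card U = n"
          using UV fin by (simp add: n_def card_Diff_subset finite_subset card_mono)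
        then show ?thesis by (simp flip: power_add mult.assoc)
      qed
      finally show ?thesis by simp
    qed
    have "card (minor_free V) \<le> card (\<Union>U\<in>\<U>. \<Union>\<pi>\<in>\<M> U. \<Union>E'\<in>minor_free U. Pow (pairs_over V \<pi> U E'))"
      using sub fin\<U> finite_U by (intro card_mono) auto
    also have "\<dots> \<le> (\<Sum>U\<in>\<U>. card (\<Union>\<pi>\<in>\<M> U. \<Union>E'\<in>minor_free U. Pow (pairs_over V \<pi> U E')))"
      by (rule card_UN_le[OF fin\<U>])
    finally have "card (minor_free V) * 2 ^ n
        \<le> (\<Sum>U\<in>\<U>. card (\<Union>\<pi>\<in>\<M> U. \<Union>E'\<in>minor_free U. Pow (pairs_over V \<pi> U E')) * 2 ^ n)"
      by (simp add: sum_distrib_right[symmetric])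
    also have "\<dots> \<le> card \<U> * (growth_rate ^ n * n ^ n)"
      using sum_bounded_above[of \<U> _ "growth_rate ^ n * n ^ n"] bound' by simp
    also have "\<dots> \<le> 2 ^ n * (growth_rate ^ n * n ^ n)" using c\<U> by (rule mult_le_mono1)
    finally have "2 ^ n * card (minor_free V) \<le> 2 ^ n * (growth_rate ^ n * n ^ n)" by (simp only: mult_ac)
    then show ?thesis unfolding n_def[symmetric] by simp
  qed
qed

section \<open>Planar graphs have no $K_6$ minor\<close>

lemma connected_inside_or_outside:
  assumes "connected K" "K \<inter> S = {}"
  shows "K \<subseteq> inside S \<or> K \<subseteq> outside S"
proof (cases "K \<inter> inside S = {}")
  case True
  then show ?thesis using assms(2) inside_Un_outside[of S] by blast
next
  case False
  then obtain x where x: "x \<in> K" "x \<in> inside S" by blast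
  have "y \<in> inside S" if "y \<in> K" for y
  proof (rule inside_same_component[OF _ x(2)])
    show "connected_component (- S) x y"
      unfolding connected_component_def using assms x(1) that by blast
  qed
  then show ?thesis by blast
qed

lemma simple_path_arcs:
  assumes "arc c1" "arc c2" "pathstart c1 = a" "pathfinish c1 = b" "pathstart c2 = a" "pathfinish c2 = b"
    and "path_image c1 \<inter> path_image c2 = {a, b}"
  shows "simple_path (c1 +++ reversepath c2)"
    "pathfinish (c1 +++ reversepath c2) = pathstart (c1 +++ reversepath c2)"
    "path_image (c1 +++ reversepath c2) = path_image c1 \<union> path_image c2"
  using assms by (auto simp: simple_path_join_loop_eq arc_reversepath path_image_join)

text \<open>The complement of the theta curve consists of the outside of \<open>c1\<close>,
  \<open>c2\<close> and of the two regions into which \<open>c3\<close> cuts their inside.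
  \<open>K\<close> lies in one of the three, and the closure of each region misses the interior of
  one of the arcs.\<close>

lemma theta_inside_no_connected:
  fixes c1 c2 c3 :: "real \<Rightarrow> complex"
  assumes arcs: "arc c1" "arc c2" "arc c3"
    and ends: "pathstart c1 = a" "pathfinish c1 = b" "pathstart c2 = a" "pathfinish c2 = b"
      "pathstart c3 = a" "pathfinish c3 = b"
    and int: "path_image c1 \<inter> path_image c2 = {a, b}" "path_image c1 \<inter> path_image c3 = {a, b}"
      "path_image c2 \<inter> path_image c3 = {a, b}"
    and K: "connected K" "K \<inter> (path_image c1 \<union> path_image c2 \<union> path_image c3) = {}"
    and cl: "closure K \<inter> (path_image c1 - {a, b}) \<noteq> {}" "closure K \<inter> (path_image c2 - {a, b}) \<noteq> {}"
      "closure K \<inter> (path_image c3 - {a, b}) \<noteq> {}"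
    and inside: "path_image c3 \<inter> inside (path_image c1 \<union> path_image c2) \<noteq> {}"
  shows False
proof -
  let ?C = "path_image c1 \<union> path_image c2"
  have "a \<noteq> b" using arc_distinct_ends[OF arcs(1)] ends by simp
  have closed: "closed (path_image c)" if "arc c" for c :: "real \<Rightarrow> complex"
    using that arc_imp_path closed_path_image by blast
  let ?I1 = "inside (path_image c1 \<union> path_image c3)" and ?I2 = "inside (path_image c2 \<union> path_image c3)"
  have split: "?I1 \<inter> ?I2 = {}" "?I1 \<union> ?I2 \<union> (path_image c3 - {a, b}) = inside ?C"
    using split_inside_simple_closed_curve[OF arc_imp_simple_path[OF arcs(1)] ends(1,2)
        arc_imp_simple_path[OF arcs(2)] ends(3,4) arc_imp_simple_path[OF arcs(3)] ends(5,6) \<open>a \<noteq> b\<close>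
        int inside] by blast+
  have op: "open ?I1" "open ?I2" using closed arcs by (auto intro!: open_inside)
  have cl12: "closure ?I1 \<subseteq> path_image c1 \<union> path_image c3 \<union> ?I1"
    "closure ?I2 \<subseteq> path_image c2 \<union> path_image c3 \<union> ?I2"
    using closed arcs by (auto intro!: closure_inside_subset)
  from connected_inside_or_outside[OF K(1), of ?C] K(2)
  consider "K \<subseteq> inside ?C" | "K \<subseteq> outside ?C" by blast
  then show False
  proof cases
    case 1
    then have "K \<subseteq> ?I1 \<union> ?I2" using split(2) K(2) by blast
    then have "K \<subseteq> ?I1 \<or> K \<subseteq> ?I2"
      using connectedD[OF K(1) op] split(1) by blast
    then show False
    proof
      assume "K \<subseteq> ?I1"
      then have "closure K \<subseteq> path_image c1 \<union> path_image c3 \<union> ?I1"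
        using closure_mono cl12(1) by blast
      moreover obtain x where x: "x \<in> closure K" "x \<in> path_image c2" "x \<noteq> a" "x \<noteq> b" using cl(2) by blast
      ultimately have "x \<in> inside ?C" using int split(2) by blast
      then show False using x inside_no_overlap[of ?C] by blast
    next
      assume "K \<subseteq> ?I2"
      then have "closure K \<subseteq> path_image c2 \<union> path_image c3 \<union> ?I2"
        using closure_mono cl12(2) by blast
      moreover obtain x where x: "x \<in> closure K" "x \<in> path_image c1" "x \<noteq> a" "x \<noteq> b" using cl(1) by blast
      ultimately have "x \<in> inside ?C" using int split(2) by blast
      then show False using x inside_no_overlap[of ?C] by blast
    qed
  next
    case 2
    have "closure (outside ?C) \<subseteq> ?C \<union> outside ?C"
      using closed arcs by (intro closure_outside_subset) auto
    then have "closure K \<subseteq> ?C \<union> outside ?C" using 2 closure_mono by blast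
    moreover obtain x where x: "x \<in> closure K" "x \<in> path_image c3" "x \<noteq> a" "x \<noteq> b" using cl(3) by blast
    moreover have "x \<in> inside ?C" using split(2) x by blast
    ultimately show False
      using inside_no_overlap[of ?C] inside_Int_outside[of ?C] by blast
  qed
qed

text \<open>Inversion at \<open>p\<close> exchanges the two sides of the curve. Otherwise the image
  of the outside stays outside; the image of the punctured inside is unbounded near
  \<open>p\<close>, hence outside as well. Only the point 0 is left for the inside of the image
  curve, which is open and nonempty.\<close>

lemma inversion_outside_to_inside:
  fixes c :: "real \<Rightarrow> complex"
  assumes c: "simple_path c" "pathfinish c = pathstart c" and p: "p \<in> inside (path_image c)"
  defines "f \<equiv> \<lambda>z. inverse (z - p)"
  assumes z: "z \<in> outside (path_image c)"
  shows "f z \<in> inside (f ` path_image c)"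
proof (rule ccontr)
  let ?C = "path_image c"
  have J: "open (inside ?C)" "connected (inside ?C)" "connected (outside ?C)"
    using Jordan_inside_outside[OF c] by simp_all
  have pC: "p \<notin> ?C" "p \<notin> outside ?C"
    using p inside_no_overlap[of ?C] inside_Int_outside[of ?C] by blast+
  \<comment> \<open>As \<open>inverse 0 = 0\<close>, the pole \<open>p\<close> is sent to 0, a value
    taken nowhere else.\<close>
  have inj: "inj_on f UNIV" by (auto simp: inj_on_def f_def)
  have cont: "continuous_on S f" if "p \<notin> S" for S
    unfolding f_def using that by (intro continuous_intros) auto
  have disj: "f ` A \<inter> f ` ?C = {}" if "A \<inter> ?C = {}" for A
    using that inj by (metis image_Int image_empty)
  have c': "simple_path (f \<circ> c)" "pathfinish (f \<circ> c) = pathstart (f \<circ> c)"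
  proof -
    show "simple_path (f \<circ> c)"
      using c(1) pC inj cont
      by (intro simple_path_continuous_image) (auto simp: inj_on_def)
    show "pathfinish (f \<circ> c) = pathstart (f \<circ> c)" using c(2) by (simp add: pathfinish_compose pathstart_compose)
  qed
  have J': "bounded (inside (f ` ?C))" "open (inside (f ` ?C))" "inside (f ` ?C) \<noteq> {}"
    using Jordan_inside_outside[OF c'] by (simp_all add: path_image_compose)
  assume "f z \<notin> inside (f ` ?C)"
  moreover have "connected (f ` outside ?C)"
    using J pC cont by (intro connected_continuous_image) auto
  moreover have "f ` outside ?C \<inter> f ` ?C = {}" using outside_no_overlap[of ?C] by (intro disj)
  ultimately have out: "f ` outside ?C \<subseteq> outside (f ` ?C)"
    using connected_inside_or_outside z by blast
  have conn_in: "connected (f ` (inside ?C - {p}))"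
    using J cont by (intro connected_continuous_image connected_open_delete) auto
  have "f ` (inside ?C - {p}) \<inter> f ` ?C = {}" using inside_no_overlap[of ?C] by (intro disj) blast
  \<comment> \<open>If the image were bounded by \<open>B\<close>, a point of the inside at distance
    \<open>e < 1 / B\<close> from \<open>p\<close> would be sent to norm
    \<open>1 / e > B\<close>.\<close>
  moreover have "\<not> f ` (inside ?C - {p}) \<subseteq> inside (f ` ?C)"
  proof
    assume sub: "f ` (inside ?C - {p}) \<subseteq> inside (f ` ?C)"
    obtain B where B: "B > 0" "\<And>w. w \<in> inside (f ` ?C) \<Longrightarrow> norm w \<le> B"
      using J'(1) unfolding bounded_pos by blast
    obtain r where r: "r > 0" "ball p r \<subseteq> inside ?C" using J(1) p open_contains_ball by blast
    define e where "e = min (r / 2) (1 / (2 * B))"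
    have e: "0 < e" "e < r" "e < 1 / B" using r B by (auto simp: e_def min_less_iff_disj field_simps)
    have "p + of_real e \<in> inside ?C - {p}" using r(2) e by (auto simp: dist_norm)
    then have "f (p + of_real e) \<in> inside (f ` ?C)" using sub by blast
    then have "norm (f (p + of_real e)) \<le> B" by (rule B(2))
    then have "1 / e \<le> B" using e by (simp add: f_def norm_inverse divide_inverse)
    then show False using e B by (simp add: field_simps)
  qed
  ultimately have "f ` (inside ?C - {p}) \<subseteq> outside (f ` ?C)"
    using connected_inside_or_outside[OF conn_in] by blast
  moreover have "w \<in> f ` outside ?C \<union> f ` (inside ?C - {p})" if "w \<notin> f ` ?C" "w \<noteq> 0" for w
  proof -
    have w: "w = f (inverse w + p)" using that by (simp add: f_def)
    then have "inverse w + p \<notin> ?C" using that by blast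
    moreover have "inverse w + p \<noteq> p" using that by simp
    ultimately have "inverse w + p \<in> outside ?C \<union> (inside ?C - {p})"
      using inside_Un_outside[of ?C] by blast
    then show ?thesis using w by blast
  qed
  ultimately have "inside (f ` ?C) \<subseteq> {0}"
    using out inside_Int_outside[of "f ` ?C"] inside_no_overlap[of "f ` ?C"] by blast
  then show False using J'(2,3) by (metis not_open_singleton subset_singletonD)
qed

text \<open>If \<open>c3\<close> does not run inside the closed curve formed by the other two arcs,
  an inversion at a point inside that curve brings it there, and the previous case applies to the
  images.\<close>

lemma theta_no_connected:
  fixes c1 c2 c3 :: "real \<Rightarrow> complex"
  assumes arcs: "arc c1" "arc c2" "arc c3"
    and ends: "pathstart c1 = a" "pathfinish c1 = b" "pathstart c2 = a" "pathfinish c2 = b"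
      "pathstart c3 = a" "pathfinish c3 = b"
    and int: "path_image c1 \<inter> path_image c2 = {a, b}" "path_image c1 \<inter> path_image c3 = {a, b}"
      "path_image c2 \<inter> path_image c3 = {a, b}"
    and K: "connected K" "K \<inter> (path_image c1 \<union> path_image c2 \<union> path_image c3) = {}"
    and cl: "closure K \<inter> (path_image c1 - {a, b}) \<noteq> {}" "closure K \<inter> (path_image c2 - {a, b}) \<noteq> {}"
      "closure K \<inter> (path_image c3 - {a, b}) \<noteq> {}"
  shows False
proof (cases "path_image c3 \<inter> inside (path_image c1 \<union> path_image c2) = {}")
  case False
  then show False using theta_inside_no_connected[OF arcs ends int K cl] by blast
next
  case True
  let ?C = "path_image c1 \<union> path_image c2"
  note sp = simple_path_arcs[OF arcs(1,2) ends(1-4) int(1)]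
  have opens: "open (inside ?C)" and "inside ?C \<noteq> {}"
    using Jordan_inside_outside[OF sp(1,2)] unfolding sp(3) by simp_all
  then obtain p where p: "p \<in> inside ?C" by blast
  define f where "f = (\<lambda>z. inverse (z - p))"
  have inj: "inj f" by (auto simp: inj_on_def f_def)
  have cont: "continuous_on S f" if "p \<notin> S" for S
    unfolding f_def using that by (intro continuous_intros) auto
  have pc: "p \<notin> path_image c1" "p \<notin> path_image c2" "p \<notin> path_image c3"
    using p True inside_no_overlap[of ?C] by blast+
  obtain x3 where x3: "x3 \<in> closure K" "x3 \<in> path_image c3" "x3 \<noteq> a" "x3 \<noteq> b" using cl(3) by blast
  have "x3 \<notin> ?C" using x3 int by blast
  moreover have "x3 \<notin> inside ?C" using x3(2) True by blast
  ultimately have x3out: "x3 \<in> outside ?C" using inside_Un_outside[of ?C] by blast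
  have "closed ?C" using arcs arc_imp_path closed_path_image by blast
  then have "closure (inside ?C) \<subseteq> ?C \<union> inside ?C" by (rule closure_inside_subset)
  \<comment> \<open>A \<open>K\<close> inside the curve could not have \<open>x3\<close> in its
    closure. Being outside keeps the closure of \<open>K\<close> away from the pole
    \<open>p\<close>, so limit points are carried over by continuity.\<close>
  then have "\<not> K \<subseteq> inside ?C"
    using x3(1) x3out closure_mono[of K "inside ?C"] inside_Int_outside[of ?C]
      outside_no_overlap[of ?C] by blast
  then have "K \<subseteq> outside ?C" using connected_inside_or_outside[OF K(1), of ?C] K(2) by blast
  then have "K \<inter> inside ?C = {}" using inside_Int_outside[of ?C] by blast
  then have pK: "p \<notin> closure K" using opens p open_Int_closure_eq_empty[of "inside ?C" K] by blast
  then have pK': "p \<notin> K" using closure_subset by blast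
  have arc: "arc (f \<circ> c)" if "arc c" "p \<notin> path_image c" for c
    using that inj cont by (auto simp: arc_def inj_on_def intro!: path_continuous_image)
  have intf: "f ` A \<inter> f ` B = {f a, f b}" if "A \<inter> B = {a, b}" for A B
    using that inj by (metis image_Int image_empty image_insert)
  have clf: "closure (f ` K) \<inter> (f ` A - {f a, f b}) \<noteq> {}" if A: "closure K \<inter> (A - {a, b}) \<noteq> {}" for A
  proof -
    obtain x where x: "x \<in> closure K" "x \<in> A" "x \<noteq> a" "x \<noteq> b" using A by blast
    have "f ` closure K \<subseteq> closure (f ` K)"
      using cont[OF pK] by (intro image_closure_subset closed_closure closure_subset)
    then have "f x \<in> closure (f ` K)" using x by blast
    moreover have "f x \<noteq> f a" "f x \<noteq> f b" using x inj by (auto simp: inj_on_def)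
    ultimately show ?thesis using x(2) by blast
  qed
  show False
  proof (rule theta_inside_no_connected[of "f \<circ> c1" "f \<circ> c2" "f \<circ> c3" "f a" "f b" "f ` K"];
      (unfold path_image_compose)?)
    show "connected (f ` K)" using K(1) cont[OF pK'] by (intro connected_continuous_image)
    show "f ` K \<inter> (f ` path_image c1 \<union> f ` path_image c2 \<union> f ` path_image c3) = {}"
      using K(2) inj by (auto simp: inj_on_def)
    have "f x3 \<in> inside (f ` path_image (c1 +++ reversepath c2))"
      unfolding f_def
      by (rule inversion_outside_to_inside) (use sp p x3out in simp_all)
    then show "f ` path_image c3 \<inter> inside (f ` path_image c1 \<union> f ` path_image c2) \<noteq> {}"
      using x3(2) sp(3) by (auto simp: image_Un)
  qed (use arc arcs pc ends intf int clf cl in \<open>auto simp: pathstart_compose pathfinish_compose\<close>)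
qed

section \<open>From K_{3,3} to a theta curve\<close>

lemma path_first_hit:
  fixes g :: "real \<Rightarrow> 'a::metric_space"
  assumes "path g" "closed S" "pathfinish g \<in> S"
  obtains u where "u \<in> {0..1}" "g u \<in> S" "\<And>t. t \<in> {0..<u} \<Longrightarrow> g t \<notin> S"
proof -
  have cont: "continuous_on {0..1} g" using assms(1) by (simp add: path_def)
  define Z where "Z = {0..1} \<inter> g -` S"
  have "closed Z" unfolding Z_def using cont assms(2) by (intro continuous_closed_preimage) auto
  moreover have "bounded Z" unfolding Z_def by (rule bounded_subset[of "{0..1}"]) auto
  ultimately have "compact Z" by (simp add: compact_eq_bounded_closed)
  moreover have "1 \<in> Z" using assms(3) by (simp add: Z_def pathfinish_def)
  ultimately obtain u where "u \<in> Z" "\<And>t. t \<in> Z \<Longrightarrow> u \<le> t"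
    using compact_attains_inf[of Z] by blast
  then show thesis by (intro that[of u]) (force simp: Z_def)+
qed

lemma less_3_cases: "i < (3::nat) \<longleftrightarrow> i = 0 \<or> i = 1 \<or> i = 2"
  by auto

text \<open>An arc \<open>g\<close> joins \<open>p 0\<close> to \<open>p 1\<close>; a path
  \<open>h\<close> from \<open>p 2\<close> towards a point of \<open>g\<close> in \<open>A\<close>
  is stopped at its first hit \<open>a\<close> with \<open>g\<close>. The legs are the two pieces of
  \<open>g\<close> at \<open>a\<close> and the initial piece of \<open>h\<close>.\<close>

lemma tripod:
  fixes A :: "complex set" and G :: "nat \<Rightarrow> complex set"
  assumes A: "path_connected A" "closed A"
    and G: "\<And>i. i < 3 \<Longrightarrow> path_connected (G i) \<and> closed (G i) \<and> G i \<inter> A \<noteq> {}"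
    and p: "\<And>i. i < 3 \<Longrightarrow> p i \<in> G i \<and> p i \<notin> A"
    and pG: "\<And>i j. i < 3 \<Longrightarrow> j < 3 \<Longrightarrow> i \<noteq> j \<Longrightarrow> p j \<notin> G i"
    and GG: "\<And>i j. i < 3 \<Longrightarrow> j < 3 \<Longrightarrow> i \<noteq> j \<Longrightarrow> G i \<inter> G j \<subseteq> A"
  obtains a T where "a \<in> A"
    "\<And>i. i < 3 \<Longrightarrow> path_connected (T i) \<and> closed (T i) \<and> a \<in> T i \<and> p i \<in> T i \<and> T i \<subseteq> A \<union> (\<Union>j<3. G j)"
    "\<And>i j. i < 3 \<Longrightarrow> j < 3 \<Longrightarrow> i \<noteq> j \<Longrightarrow> T i \<inter> T j = {a} \<and> p j \<notin> T i"
proof -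
  have p0: "p 0 \<in> G 0 \<and> p 0 \<notin> A" and p1: "p 1 \<in> G 1 \<and> p 1 \<notin> A" and p2: "p 2 \<in> G 2 \<and> p 2 \<notin> A"
    by (rule p; simp)+
  have G0: "path_connected (G 0) \<and> closed (G 0) \<and> G 0 \<inter> A \<noteq> {}"
    and G1: "path_connected (G 1) \<and> closed (G 1) \<and> G 1 \<inter> A \<noteq> {}"
    and G2: "path_connected (G 2) \<and> closed (G 2) \<and> G 2 \<inter> A \<noteq> {}"
    by (rule G; simp)+
  have pG': "p 0 \<notin> G 1" "p 0 \<notin> G 2" "p 1 \<notin> G 0" "p 1 \<notin> G 2" "p 2 \<notin> G 0" "p 2 \<notin> G 1"
    using pG by simp_all
  have GG': "G 0 \<inter> G 1 \<subseteq> A" "G 2 \<inter> G 0 \<subseteq> A" "G 2 \<inter> G 1 \<subseteq> A"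
    using GG[of 0 1] GG[of 2 0] GG[of 2 1] by simp_all
  have "path_connected (A \<union> G 0)" by (rule path_connected_Un) (use A G0 in auto)
  then have pc: "path_connected (A \<union> G 0 \<union> G 1)" by (rule path_connected_Un) (use G1 in auto)
  have "p 0 \<noteq> p 1" using p0 pG' by auto
  then obtain g where g: "arc g" "path_image g \<subseteq> A \<union> G 0 \<union> G 1" "pathstart g = p 0" "pathfinish g = p 1"
    using pc[unfolded path_connected_arcwise, rule_format, of "p 0" "p 1"] p0 p1 by auto
  have g01: "p 0 \<in> path_image g" "p 1 \<in> path_image g"
    using g pathstart_in_path_image pathfinish_in_path_image by metis+
  \<comment> \<open>Off \<open>A\<close> the closed sets \<open>G 0\<close> and \<open>G 1\<close>
    are disjoint, so they would disconnect \<open>g\<close>.\<close>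
  have "path_image g \<inter> A \<noteq> {}"
  proof
    assume no: "path_image g \<inter> A = {}"
    have "connected (path_image g)" using g arc_imp_path connected_path_image by blast
    moreover have "path_image g \<inter> G 0 \<inter> G 1 = {}" using no GG' by blast
    moreover have "path_image g \<subseteq> G 0 \<union> G 1" using no g(2) by blast
    ultimately have "G 0 \<inter> path_image g = {} \<or> G 1 \<inter> path_image g = {}"
      using G0 G1 by (intro connected_closedD) auto
    then show False using g01 p0 p1 by auto
  qed
  then obtain q where q: "q \<in> path_image g" "q \<in> A" by blast
  have "path_connected (A \<union> G 2)" by (rule path_connected_Un) (use A G2 in auto)
  then obtain h where h: "path h" "path_image h \<subseteq> A \<union> G 2" "pathstart h = p 2" "pathfinish h = q"
    using p2 q(2) unfolding path_connected_def by (meson UnI1 UnI2)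
  obtain u where u: "u \<in> {0..1}" "h u \<in> path_image g" "\<And>t. t \<in> {0..<u} \<Longrightarrow> h t \<notin> path_image g"
    using path_first_hit[of h "path_image g"] h q g closed_path_image arc_imp_path by metis
  define a where "a = h u"
  have "h u \<in> A \<union> G 2" using h(2) u(1) unfolding path_image_def by blast
  \<comment> \<open>The hit lies in \<open>A \<union> G 2\<close> and in
    \<open>A \<union> G 0 \<union> G 1\<close>, and \<open>G 2\<close> meets the other two only in
    \<open>A\<close>.\<close>
  then have aA: "a \<in> A" using u(2) g(2) GG' unfolding a_def by blast
  obtain s where s: "s \<in> {0..1}" "g s = a" using u(2) by (auto simp: a_def path_image_def)
  have ginj: "inj_on g {0..1}" and gcont: "continuous_on {0..1} g" and hcont: "continuous_on {0..1} h"
    using g(1) h(1) by (auto simp: arc_def path_def)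
  have g0: "g 0 = p 0" "g 1 = p 1" using g by (auto simp: pathstart_def pathfinish_def)
  have s': "s \<noteq> 0" "s \<noteq> 1" using s g0 aA p0 p1 by auto
  define T where "T i = (if i = 0 then g ` {0..s} else if i = 1 then g ` {s..1} else h ` {0..u})"
    for i :: nat
  have pcT: "path_connected (f ` {x..y}) \<and> closed (f ` {x..y})"
    if "continuous_on {0..1} f" "{x..y} \<subseteq> {0..1}" for f :: "real \<Rightarrow> complex" and x y
  proof -
    have "continuous_on {x..y} f" using that continuous_on_subset by blast
    then show ?thesis
      by (meson compact_Icc compact_continuous_image compact_imp_closed convex_imp_path_connected
          convex_real_interval(5) path_connected_continuous_image)
  qed
  have T01: "g ` {0..s} \<subseteq> path_image g" "g ` {s..1} \<subseteq> path_image g" using s by (auto simp: path_image_def)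
  have "{0..u} \<subseteq> {0..1}" using u(1) by auto
  then have T2: "h ` {0..u} \<subseteq> A \<union> G 2" using h(2) unfolding path_image_def by blast
  have hg: "h ` {0..u} \<inter> path_image g = {a}"
  proof (intro equalityI subsetI)
    fix z assume "z \<in> h ` {0..u} \<inter> path_image g"
    then obtain t where t: "t \<in> {0..u}" "z = h t" "h t \<in> path_image g" by blast
    then have "t = u" using u(3)[of t] by force
    then show "z \<in> {a}" using t by (simp add: a_def)
  qed (use u in \<open>auto simp: a_def\<close>)
  have gg: "g ` {0..s} \<inter> g ` {s..1} = {a}"
  proof -
    have "g ` {0..s} \<inter> g ` {s..1} = g ` ({0..s} \<inter> {s..1})"
      using s by (intro inj_on_image_Int[OF ginj, symmetric]) auto
    also have "{0..s} \<inter> {s..1} = {s}" using s by auto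
    finally show ?thesis using s by simp
  qed
  have T02: "g ` {0..s} \<inter> h ` {0..u} = {a}" and T12: "g ` {s..1} \<inter> h ` {0..u} = {a}"
    using hg T01 gg by blast+
  have no1: "p 1 \<notin> g ` {0..s}"
  proof
    assume "p 1 \<in> g ` {0..s}"
    then have "p 1 \<in> g ` {0..s} \<inter> g ` {s..1}" using s g0 by (auto intro!: image_eqI[of _ _ 1])
    then show False using gg aA p1 by auto
  qed
  have no0: "p 0 \<notin> g ` {s..1}"
  proof
    assume "p 0 \<in> g ` {s..1}"
    then have "p 0 \<in> g ` {0..s} \<inter> g ` {s..1}" using s g0 by (auto intro!: image_eqI[of _ _ 0])
    then show False using gg aA p0 by auto
  qed
  have no2: "p 2 \<notin> path_image g" using g(2) p2 pG' by auto
  have no2': "p 0 \<notin> h ` {0..u}" "p 1 \<notin> h ` {0..u}"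
    using subsetD[OF T2, of "p 0"] subsetD[OF T2, of "p 1"] p0 p1 pG'(2,4) by blast+
  have U: "(\<Union>j<3. G j) = G 0 \<union> G 1 \<union> G 2" by (auto simp: less_3_cases)
  show thesis
  proof (rule that[of a T])
    show "path_connected (T i) \<and> closed (T i) \<and> a \<in> T i \<and> p i \<in> T i \<and> T i \<subseteq> A \<union> (\<Union>j<3. G j)"
      if "i < 3" for i
    proof -
      have "a \<in> g ` {0..s}" "a \<in> g ` {s..1}" "a \<in> h ` {0..u}" using gg hg by blast+
      moreover have "p 0 \<in> g ` {0..s}" "p 1 \<in> g ` {s..1}" using s g0 by force+
      moreover have "p 2 \<in> h ` {0..u}" using h(3) u by (force simp: pathstart_def)
      moreover have "g ` {0..s} \<subseteq> A \<union> (\<Union>j<3. G j)" "g ` {s..1} \<subseteq> A \<union> (\<Union>j<3. G j)"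
        "h ` {0..u} \<subseteq> A \<union> (\<Union>j<3. G j)"
        unfolding U using T01 T2 g(2) by blast+
      ultimately show ?thesis
        using that[unfolded less_3_cases] pcT[OF gcont, of 0 s] pcT[OF gcont, of s 1] pcT[OF hcont, of 0 u] s u
        by (elim disjE) (simp_all add: T_def)
    qed
    show "T i \<inter> T j = {a} \<and> p j \<notin> T i" if "i < 3" "j < 3" "i \<noteq> j" for i j
      using that(3) that(1)[unfolded less_3_cases] that(2)[unfolded less_3_cases]
        gg T02 T12 no0 no1 no2 no2' T01
      by (elim disjE) (auto simp: T_def Int_commute)
  qed (rule aA)
qed

text \<open>Nonplanarity of $K_{3,3}$: the sides are the families $A$ and $B$, and $G_{ri}$ is the edge from
  $A_r$ to $B_i$. Two tripods in $A_0$ and $A_1$ and the sets $B_i$ give a theta curve, whose three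
  arcs cannot all be reached from $A_2$.\<close>
lemma no_K33_in_plane:
  fixes A B :: "nat \<Rightarrow> complex set" and G :: "nat \<Rightarrow> nat \<Rightarrow> complex set"
  assumes A: "\<And>r. r < 3 \<Longrightarrow> path_connected (A r) \<and> closed (A r)"
    and B: "\<And>i. i < 3 \<Longrightarrow> path_connected (B i) \<and> closed (B i)"
    and G: "\<And>r i. r < 3 \<Longrightarrow> i < 3 \<Longrightarrow> path_connected (G r i) \<and> closed (G r i) \<and>
      G r i \<inter> A r \<noteq> {} \<and> G r i \<inter> B i = {p r i}"
    and AA: "\<And>r s. r < 3 \<Longrightarrow> s < 3 \<Longrightarrow> r \<noteq> s \<Longrightarrow> A r \<inter> A s = {}"
    and BB: "\<And>r s. r < 3 \<Longrightarrow> s < 3 \<Longrightarrow> r \<noteq> s \<Longrightarrow> B r \<inter> B s = {}"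
    and AB: "\<And>r i. r < 3 \<Longrightarrow> i < 3 \<Longrightarrow> A r \<inter> B i = {}"
    and GA: "\<And>r s i. r < 3 \<Longrightarrow> s < 3 \<Longrightarrow> i < 3 \<Longrightarrow> r \<noteq> s \<Longrightarrow> G r i \<inter> A s = {}"
    and GB: "\<And>r i j. r < 3 \<Longrightarrow> i < 3 \<Longrightarrow> j < 3 \<Longrightarrow> i \<noteq> j \<Longrightarrow> G r i \<inter> B j = {}"
    and GG: "\<And>r i j. r < 3 \<Longrightarrow> i < 3 \<Longrightarrow> j < 3 \<Longrightarrow> i \<noteq> j \<Longrightarrow> G r i \<inter> G r j \<subseteq> A r"
    and GG': "\<And>r s i j. r < 3 \<Longrightarrow> s < 3 \<Longrightarrow> i < 3 \<Longrightarrow> j < 3 \<Longrightarrow> r \<noteq> s \<Longrightarrow> G r i \<inter> G s j \<subseteq> B i"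
  shows False
proof -
  have pB: "p r i \<in> B i" "p r i \<in> G r i" if "r < 3" "i < 3" for r i
    using G[OF that] by blast+
  have "\<exists>a T. a \<in> A r \<and>
     (\<forall>i<3. path_connected (T i) \<and> closed (T i) \<and> a \<in> T i \<and> p r i \<in> T i \<and> T i \<subseteq> A r \<union> (\<Union>j<3. G r j)) \<and>
     (\<forall>i<3. \<forall>j<3. i \<noteq> j \<longrightarrow> T i \<inter> T j = {a} \<and> p r j \<notin> T i)" if r: "r < 3" for r
  proof (rule tripod[of "A r" "G r" "p r"])
    show "path_connected (A r)" "closed (A r)" using A r by blast+
    show "path_connected (G r i) \<and> closed (G r i) \<and> G r i \<inter> A r \<noteq> {}" if "i < 3" for i
      using G[OF r that] by blast
    show "p r i \<in> G r i \<and> p r i \<notin> A r" if "i < 3" for i using pB[OF r that] AB[OF r that] by blast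
    show "p r j \<notin> G r i" if "i < 3" "j < 3" "i \<noteq> j" for i j using pB[OF r that(2)] GB[OF r that] by blast
    show "G r i \<inter> G r j \<subseteq> A r" if "i < 3" "j < 3" "i \<noteq> j" for i j using GG[OF r that] .
  qed blast
  then obtain a T where aA: "\<And>r. r < 3 \<Longrightarrow> a r \<in> A r"
    and T: "\<And>r i. r < 3 \<Longrightarrow> i < 3 \<Longrightarrow> path_connected (T r i) \<and> closed (T r i) \<and> a r \<in> T r i \<and> p r i \<in> T r i \<and>
        T r i \<subseteq> A r \<union> (\<Union>j<3. G r j)"
    and TT: "\<And>r i j. r < 3 \<Longrightarrow> i < 3 \<Longrightarrow> j < 3 \<Longrightarrow> i \<noteq> j \<Longrightarrow> T r i \<inter> T r j = {a r} \<and> p r j \<notin> T r i"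
    by metis
  have TB: "T r i \<inter> B k = {}" if "r < 3" "i < 3" "k < 3" "i \<noteq> k" for r i k
  proof -
    have "z = p r k" if z: "z \<in> T r i" "z \<in> B k" for z
    proof -
      have "z \<notin> A r" using AB[OF \<open>r < 3\<close> \<open>k < 3\<close>] z(2) by blast
      then have "z \<in> (\<Union>j<3. G r j)" using T[OF \<open>r < 3\<close> \<open>i < 3\<close>] z(1) by blast
      then obtain j where j: "j < 3" "z \<in> G r j" by blast
      then have "j = k" using GB[OF \<open>r < 3\<close> j(1) \<open>k < 3\<close>] z(2) by blast
      then show ?thesis using G[OF \<open>r < 3\<close> \<open>k < 3\<close>] j(2) z(2) by blast
    qed
    then show ?thesis using TT[OF that(1-3)] that(4) by blast
  qed
  have TA: "T r i \<inter> A s = {}" if "r < 3" "s < 3" "i < 3" "r \<noteq> s" for r s i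
  proof -
    have "(\<Union>j<3. G r j) \<inter> A s = {}" using GA[OF that(1,2) _ that(4)] by blast
    then show ?thesis using T[OF that(1,3)] AA[OF that(1,2,4)] by blast
  qed
  have TG: "T r i \<inter> G s k \<subseteq> B k" if "r < 3" "s < 3" "i < 3" "k < 3" "r \<noteq> s" for r s i k
  proof -
    have "G s k \<inter> (\<Union>j<3. G r j) \<subseteq> B k" using GG'[OF that(2,1,4)] that(5) by blast
    moreover have "G s k \<inter> A r = {}" using GA[OF that(2,1,4)] that(5) by blast
    ultimately show ?thesis using T[OF that(1,3)] by blast
  qed
  \<comment> \<open>Legs of different tripods can meet only in the sets \<open>B k\<close>; as a leg
    with index \<open>i\<close> avoids every \<open>B k\<close> with \<open>k \<noteq> i\<close>,
    legs with different indices do not meet at all.\<close>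
  have T01: "T 0 i \<inter> T 1 j \<subseteq> (\<Union>k<3. B k)" if "i < 3" "j < 3" for i j
  proof
    fix z assume z: "z \<in> T 0 i \<inter> T 1 j"
    then have "z \<notin> A 1" using TA[of 0 1 i] that by auto
    moreover have "T 1 j \<subseteq> A 1 \<union> (\<Union>k<3. G 1 k)" using T[of 1 j] that by simp
    ultimately obtain k where k: "k < 3" "z \<in> G 1 k" using z by blast
    then show "z \<in> (\<Union>k<3. B k)" using TG[of 0 1 i k] z that by auto
  qed
  have T01': "T 0 i \<inter> T 1 j = {}" if "i < 3" "j < 3" "i \<noteq> j" for i j
  proof -
    have "z \<notin> T 0 i \<or> z \<notin> T 1 j" if z: "k < 3" "z \<in> B k" for z k
      using TB[of 0 i k] TB[of 1 j k] that \<open>i < 3\<close> \<open>j < 3\<close> \<open>i \<noteq> j\<close> by (cases "i = k") auto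
    then show ?thesis using T01[OF that(1,2)] by blast
  qed
  \<comment> \<open>The three sets \<open>M i\<close> pairwise share only the two centres, so arcs
    between the centres inside them form a theta curve.\<close>
  define M where "M i = T 0 i \<union> B i \<union> T 1 i" for i
  have "a 0 \<noteq> a 1" using aA[of 0] aA[of 1] AA[of 0 1] by auto
  have MM: "M i \<inter> M j = {a 0, a 1}" if "i < 3" "j < 3" "i \<noteq> j" for i j
  proof -
    have "T 0 i \<inter> T 0 j = {a 0}" "T 1 i \<inter> T 1 j = {a 1}" "T 0 i \<inter> T 1 j = {}" "T 1 i \<inter> T 0 j = {}"
      "T 0 i \<inter> B j = {}" "T 1 i \<inter> B j = {}" "B i \<inter> T 0 j = {}" "B i \<inter> T 1 j = {}" "B i \<inter> B j = {}"
      using TT[of 0 i j] TT[of 1 i j] T01'[of i j] T01'[of j i] TB[of 0 i j] TB[of 1 i j]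
        TB[of 0 j i] TB[of 1 j i] BB[of i j] that by auto
    then show ?thesis unfolding M_def Int_Un_distrib Int_Un_distrib2 by (simp add: insert_commute)
  qed
  have "\<exists>c. arc c \<and> path_image c \<subseteq> M i \<and> pathstart c = a 0 \<and> pathfinish c = a 1" if "i < 3" for i
  proof -
    have "path_connected (T 0 i \<union> B i)"
      by (rule path_connected_Un) (use T[of 0 i] B[of i] pB[of 0 i] that in auto)
    then have "path_connected (M i)" unfolding M_def
      by (rule path_connected_Un) (use T[of 1 i] pB[of 1 i] that in auto)
    moreover have "a 0 \<in> M i" "a 1 \<in> M i" using T[of 0 i] T[of 1 i] that by (auto simp: M_def)
    ultimately show ?thesis using \<open>a 0 \<noteq> a 1\<close> unfolding path_connected_arcwise by blast
  qed
  then obtain c where c: "\<And>i. i < 3 \<Longrightarrow> arc (c i) \<and> path_image (c i) \<subseteq> M i \<and>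
      pathstart (c i) = a 0 \<and> pathfinish (c i) = a 1" by metis
  have cend: "a 0 \<in> path_image (c i)" "a 1 \<in> path_image (c i)" if "i < 3" for i
    using c[OF that] pathstart_in_path_image pathfinish_in_path_image by metis+
  have cc: "path_image (c i) \<inter> path_image (c j) = {a 0, a 1}" if "i < 3" "j < 3" "i \<noteq> j" for i j
    using c[OF that(1)] c[OF that(2)] MM[OF that] cend[OF that(1)] cend[OF that(2)] by blast
  have A2M: "A 2 \<inter> M i = {}" if "i < 3" for i
    unfolding M_def using TA[of 0 2 i] TA[of 1 2 i] AB[of 2 i] that by auto
  \<comment> \<open>A path from \<open>A 2\<close> through \<open>G 2 i \<union> B i\<close> is cut
    off just before its first hit with \<open>c i\<close>: the half-open piece \<open>k\<close> is
    connected and misses the arc, while the hit \<open>x\<close> lies in its closure.\<close>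
  have "\<exists>k x. connected k \<and> k \<inter> A 2 \<noteq> {} \<and> k \<inter> path_image (c i) = {} \<and> k \<subseteq> G 2 i \<union> B i \<and>
      x \<in> closure k \<and> x \<in> path_image (c i) \<and> x \<in> G 2 i \<union> B i" if i: "i < 3" for i
  proof -
    \<comment> \<open>The arc runs from \<open>T 0 i\<close> to \<open>T 1 i\<close>, closed sets
      that meet only in \<open>B i\<close>, so by connectedness it must enter
      \<open>B i\<close>.\<close>
    have "path_image (c i) \<inter> B i \<noteq> {}"
    proof
      assume no: "path_image (c i) \<inter> B i = {}"
      have "connected (path_image (c i))" using c[OF i] arc_imp_path connected_path_image by blast
      moreover have "path_image (c i) \<subseteq> T 0 i \<union> T 1 i" using c[OF i] no unfolding M_def by blast
      moreover have "path_image (c i) \<inter> T 0 i \<inter> T 1 i = {}"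
      proof -
        have "z \<in> B i" if z: "z \<in> T 0 i" "z \<in> T 1 i" for z
        proof -
          obtain k where "k < 3" "z \<in> B k" using T01[OF i i] z by blast
          then show ?thesis using TB[of 0 i k] i z by (cases "i = k") auto
        qed
        then show ?thesis using no by blast
      qed
      ultimately have "T 0 i \<inter> path_image (c i) = {} \<or> T 1 i \<inter> path_image (c i) = {}"
        using T[of 0 i] T[of 1 i] i by (intro connected_closedD) auto
      then show False using cend[OF i] T[of 0 i] T[of 1 i] i by auto
    qed
    then obtain y where y: "y \<in> path_image (c i)" "y \<in> B i" by blast
    obtain q where q: "q \<in> G 2 i" "q \<in> A 2" using G[of 2 i] i by auto
    have "path_connected (G 2 i \<union> B i)"
      by (rule path_connected_Un) (use G[of 2 i] B[of i] i in auto)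
    then obtain h where h: "path h" "path_image h \<subseteq> G 2 i \<union> B i" "pathstart h = q" "pathfinish h = y"
      using q y unfolding path_connected_def by (meson UnCI)
    have "closed (path_image (c i))" using c[OF i] arc_imp_path closed_path_image by blast
    then obtain u where u: "u \<in> {0..1}" "h u \<in> path_image (c i)" "\<And>t. t \<in> {0..<u} \<Longrightarrow> h t \<notin> path_image (c i)"
      using path_first_hit[OF h(1), of "path_image (c i)"] h(4) y(1) by metis
    have h0: "h 0 = q" using h(3) by (simp add: pathstart_def)
    have "q \<notin> path_image (c i)" using q A2M[OF i] c[OF i] by blast
    then have "0 < u" using u h0 by (cases "u = 0") auto
    have hcont: "continuous_on {0..1} h" using h(1) by (simp add: path_def)
    have cl: "closure {0..<u} = {0..u}" using \<open>0 < u\<close> by simp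
    have "h ` closure {0..<u} \<subseteq> closure (h ` {0..<u})"
      by (rule image_closure_subset)
         (use hcont u cl continuous_on_subset[of "{0..1}" h "{0..u}"] in \<open>auto intro: closure_subset[THEN subsetD]\<close>)
    then have "h u \<in> closure (h ` {0..<u})" using cl \<open>0 < u\<close> by auto
    moreover have "connected (h ` {0..<u})"
      using u by (intro connected_continuous_image continuous_on_subset[OF hcont]) auto
    moreover have "q \<in> h ` {0..<u}" using h0 \<open>0 < u\<close> by force
    moreover have "h ` {0..<u} \<subseteq> G 2 i \<union> B i" "h u \<in> G 2 i \<union> B i"
      using h(2) u(1) unfolding path_image_def by (force dest: subsetD)+
    moreover have "h ` {0..<u} \<inter> path_image (c i) = {}" using u(3) by blast
    ultimately show ?thesis using q(2) u(2) by blast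
  qed
  then obtain k x where k: "\<And>i. i < 3 \<Longrightarrow> connected (k i) \<and> k i \<inter> A 2 \<noteq> {} \<and>
      k i \<inter> path_image (c i) = {} \<and> k i \<subseteq> G 2 i \<union> B i"
    and x: "\<And>i. i < 3 \<Longrightarrow> x i \<in> closure (k i) \<and> x i \<in> path_image (c i) \<and> x i \<in> G 2 i \<union> B i"
    by metis
  define K where "K = A 2 \<union> k 0 \<union> k 1 \<union> k 2"
  have "connected (A 2)" using A[of 2] path_connected_imp_connected by auto
  then have connK: "connected K" unfolding K_def
    using k[of 0] k[of 1] k[of 2] by (intro connected_Un) auto
  have GM: "(G 2 i \<union> B i) \<inter> M j = {}" if "i < 3" "j < 3" "i \<noteq> j" for i j
  proof -
    have "B i \<inter> M j = {}"
      using TB[of 0 j i] TB[of 1 j i] BB[of i j] that unfolding M_def by auto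
    moreover have "G 2 i \<inter> M j \<subseteq> B i"
      using TG[of 0 2 j i] TG[of 1 2 j i] GB[of 2 i j] that unfolding M_def by auto
    ultimately show ?thesis by blast
  qed
  have Kc: "K \<inter> path_image (c j) = {}" if j: "j < 3" for j
  proof -
    have kc: "k i \<inter> path_image (c j) = {}" if "i < 3" for i
    proof (cases "i = j")
      case False
      then show ?thesis using k[OF that] c[OF j] GM[OF that j] by blast
    qed (use k that in blast)
    have "A 2 \<inter> path_image (c j) = {}" using A2M[OF j] c[OF j] by blast
    then show ?thesis unfolding K_def Int_Un_distrib2 using kc[of 0] kc[of 1] kc[of 2] by simp
  qed
  have xcl: "closure K \<inter> (path_image (c i) - {a 0, a 1}) \<noteq> {}" if i: "i < 3" for i
  proof -
    have "k i \<subseteq> K" using i unfolding less_3_cases K_def by auto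
    then have "x i \<in> closure K" using x[OF i] closure_mono by blast
    \<comment> \<open>The centres lie in \<open>A 0\<close> and \<open>A 1\<close>, which
      \<open>G 2 i \<union> B i\<close> avoids; so the hit is an interior point of the arc.\<close>
    moreover have "x i \<notin> A 0" "x i \<notin> A 1"
      using x[OF i] GA[of 2 0 i] GA[of 2 1 i] AB[of 0 i] AB[of 1 i] i by auto
    then have "x i \<noteq> a 0" "x i \<noteq> a 1" using aA[of 0] aA[of 1] by auto
    ultimately show ?thesis using x[OF i] by blast
  qed
  show False
  proof (rule theta_no_connected[of "c 0" "c 1" "c 2" "a 0" "a 1" K])
    show "K \<inter> (path_image (c 0) \<union> path_image (c 1) \<union> path_image (c 2)) = {}"
      using Kc[of 0] Kc[of 1] Kc[of 2] by auto
  qed (use c cc xcl connK in auto)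
qed

text \<open>The drawings of the branch sets are disjoint, closed and path-connected. Three of them
  against the other three, with one linking edge for each of the nine pairs, form a K_{3,3} in the
  plane.\<close>

lemma planar_no_K6_minor:
  fixes V :: "'a set"
  assumes planar: "planar V E" and simple: "simple_graph V E" and fin: "finite V"
  shows "\<not> clique_minor 6 V E"
proof
  assume "clique_minor 6 V E"
  then obtain \<B> where \<B>: "card \<B> = 6" "finite \<B>" "\<And>B. B \<in> \<B> \<Longrightarrow> B \<subseteq> V \<and> connected_in E B"
    and adj: "\<And>B B'. B \<in> \<B> \<Longrightarrow> B' \<in> \<B> \<Longrightarrow> B \<noteq> B' \<Longrightarrow>
      B \<inter> B' = {} \<and> (\<exists>x\<in>B. \<exists>y\<in>B'. {x, y} \<in> E)"
    unfolding clique_minor_def by metis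
  from planar[unfolded planar_def] obtain pos :: "'a \<Rightarrow> complex" and \<gamma> :: "'a set \<Rightarrow> real \<Rightarrow> complex"
    where drawing: "inj_on pos V \<and>
        (\<forall>e\<in>E. arc (\<gamma> e) \<and> {pathstart (\<gamma> e), pathfinish (\<gamma> e)} = pos ` e) \<and>
        (\<forall>e\<in>E. \<forall>v\<in>V. pos v \<in> path_image (\<gamma> e) \<longrightarrow> v \<in> e) \<and>
        (\<forall>e\<in>E. \<forall>e'\<in>E. e \<noteq> e' \<longrightarrow>
            path_image (\<gamma> e) \<inter> path_image (\<gamma> e') \<subseteq> pos ` (e \<inter> e'))"
    by (elim exE) (rule that)
  have inj: "inj_on pos V"
    and arc: "\<And>e. e \<in> E \<Longrightarrow> arc (\<gamma> e) \<and> {pathstart (\<gamma> e), pathfinish (\<gamma> e)} = pos ` e"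
    and inc: "\<And>e v. e \<in> E \<Longrightarrow> v \<in> V \<Longrightarrow> pos v \<in> path_image (\<gamma> e) \<Longrightarrow> v \<in> e"
    and cross: "\<And>e e'. e \<in> E \<Longrightarrow> e' \<in> E \<Longrightarrow> e \<noteq> e' \<Longrightarrow>
      path_image (\<gamma> e) \<inter> path_image (\<gamma> e') \<subseteq> pos ` (e \<inter> e')"
    using drawing by simp_all
  have EV: "e \<subseteq> V" "card e = 2" if "e \<in> E" for e using simple that by (auto simp: simple_graph_def)
  have ends: "pos ` e \<subseteq> path_image (\<gamma> e)" if "e \<in> E" for e
    using pathstart_in_path_image[of "\<gamma> e"] pathfinish_in_path_image[of "\<gamma> e"]
    unfolding arc[OF that, THEN conjunct2, symmetric] by simp
  define X where "X B = pos ` B \<union> (\<Union>e\<in>edges_in E B. path_image (\<gamma> e))" for B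
  \<comment> \<open>An edge that leaves \<open>B\<close> touches the drawing of \<open>B\<close>
    only at a vertex of its own; disjointness of the drawings and all incidences of the linking
    edges rest on this.\<close>
  have edge_Int: "path_image (\<gamma> e) \<inter> X B \<subseteq> pos ` (e \<inter> B)"
    if e: "e \<in> E" "B \<subseteq> V" "\<not> e \<subseteq> B" for e B
  proof
    fix z assume z: "z \<in> path_image (\<gamma> e) \<inter> X B"
    then consider v where "v \<in> B" "z = pos v" | e' where "e' \<in> E" "e' \<subseteq> B" "z \<in> path_image (\<gamma> e')"
      by (auto simp: X_def edges_in_def)
    then show "z \<in> pos ` (e \<inter> B)"
    proof cases
      case 1
      then show ?thesis using inc[OF e(1), of v] z e(2) by blast
    next
      case 2
      then have "e \<noteq> e'" using e(3) by blast
      then show ?thesis using cross[OF e(1) 2(1)] z 2 by blast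
    qed
  qed
  have X_disj: "X B \<inter> X C = {}" if BC: "B \<subseteq> V" "C \<subseteq> V" "B \<inter> C = {}" for B C
  proof -
    have "pos v \<notin> X C" if v: "v \<in> B" for v
    proof
      assume "pos v \<in> X C"
      then consider w where "w \<in> C" "pos v = pos w" | e where "e \<in> E" "e \<subseteq> C" "pos v \<in> path_image (\<gamma> e)"
        by (auto simp: X_def edges_in_def)
      then show False
      proof cases
        case 1
        then have "v = w" using inj_onD[OF inj] v BC by blast
        then show False using 1 v BC by blast
      next
        case 2
        then show False using inc[OF 2(1), of v] v BC by blast
      qed
    qed
    moreover have "path_image (\<gamma> e) \<inter> X C = {}" if e: "e \<in> edges_in E B" for e
    proof -
      have e': "e \<in> E" "e \<subseteq> B" using e by (auto simp: edges_in_def)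
      then have "e \<noteq> {}" using EV(2) by fastforce
      then have "\<not> e \<subseteq> C" using e' BC by blast
      then show ?thesis using edge_Int[OF e'(1) BC(2)] e' BC by blast
    qed
    ultimately show ?thesis unfolding X_def[of B] by blast
  qed
  have X_closed: "closed (X B)" if "B \<subseteq> V" for B
  proof -
    have finB: "finite B" using that fin finite_subset by blast
    have "closed (path_image (\<gamma> e))" if "e \<in> edges_in E B" for e
      using that arc arc_imp_path closed_path_image by (auto simp: edges_in_def)
    then have "closed (\<Union>e\<in>edges_in E B. path_image (\<gamma> e))"
      using finite_edges_in[OF finB] by (intro closed_UN) auto
    then show ?thesis unfolding X_def using finB by (simp add: closed_Un finite_imp_closed)
  qed
  have X_pc: "path_connected (X B)" if B: "B \<subseteq> V" "connected_in E B" for B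
  proof -
    obtain v where v: "v \<in> B" using B(2) by (auto simp: connected_in_def)
    have im: "path_component (X B) z w" if "e \<in> edges_in E B" "z \<in> path_image (\<gamma> e)" "w \<in> path_image (\<gamma> e)"
      for e z w
    proof -
      have "path (\<gamma> e)" using that(1) arc arc_imp_path by (auto simp: edges_in_def)
      then have "path_connected (path_image (\<gamma> e))" by (rule path_connected_path_image)
      then have "path_component (path_image (\<gamma> e)) z w"
        using that path_connected_component by blast
      then show ?thesis by (rule path_component_of_subset[rotated]) (use that(1) in \<open>auto simp: X_def\<close>)
    qed
    define S where "S = {w \<in> B. path_component (X B) (pos v) (pos w)}"
    have "S = B"
    proof (rule ccontr)
      assume "S \<noteq> B"
      moreover have "v \<in> S" using v by (auto simp: S_def X_def intro!: path_component_refl)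
      moreover have "S \<subseteq> B" by (auto simp: S_def)
      ultimately obtain x y where xy: "x \<in> S" "y \<in> B - S" "{x, y} \<in> E"
        using B(2) unfolding connected_in_def by (metis empty_iff)
      have e: "{x, y} \<in> edges_in E B" using xy \<open>S \<subseteq> B\<close> by (auto simp: edges_in_def)
      have "path_component (X B) (pos x) (pos y)"
        using im[OF e] ends[OF xy(3)] by simp
      then have "y \<in> S" using xy by (auto simp: S_def intro: path_component_trans)
      then show False using xy by blast
    qed
    have all: "path_component (X B) (pos v) z" if z: "z \<in> X B" for z
    proof -
      from z consider w where "w \<in> B" "z = pos w" | e where "e \<in> edges_in E B" "z \<in> path_image (\<gamma> e)"
        by (auto simp: X_def)
      then show ?thesis
      proof cases
        case 1
        then show ?thesis using \<open>S = B\<close> by (auto simp: S_def)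
      next
        case 2
        then have e: "e \<in> E" "e \<subseteq> B" by (auto simp: edges_in_def)
        then obtain w where w: "w \<in> e" using EV(2) by fastforce
        then have "path_component (X B) (pos w) z" using im[OF 2(1) _ 2(2)] ends[OF e(1)] by blast
        moreover have "path_component (X B) (pos v) (pos w)" using \<open>S = B\<close> w e by (auto simp: S_def)
        ultimately show ?thesis by (rule path_component_trans[rotated])
      qed
    qed
    then show ?thesis unfolding path_connected_component
      by (meson path_component_sym path_component_trans)
  qed
  obtain f :: "nat \<Rightarrow> 'a set" where f: "bij_betw f {0..<6} \<B>"
    using ex_bij_betw_nat_finite[OF \<B>(2)] \<B>(1) by auto
  have fB: "f k \<in> \<B>" if "k < 6" for k using f that by (auto simp: bij_betw_def)
  have fV: "f k \<subseteq> V" "connected_in E (f k)" if "k < 6" for k using \<B>(3) fB that by blast+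
  have fadj: "f k \<inter> f l = {} \<and> (\<exists>x\<in>f k. \<exists>y\<in>f l. {x, y} \<in> E)" if "k < 6" "l < 6" "k \<noteq> l" for k l
  proof -
    have "f k \<noteq> f l" using f that by (auto simp: bij_betw_def inj_on_def)
    then show ?thesis using adj fB that by blast
  qed
  have "\<forall>r i. \<exists>x y. r < 3 \<and> i < 3 \<longrightarrow> x \<in> f r \<and> y \<in> f (3 + i) \<and> {x, y} \<in> E"
  proof (intro allI)
    fix r i :: nat
    show "\<exists>x y. r < 3 \<and> i < 3 \<longrightarrow> x \<in> f r \<and> y \<in> f (3 + i) \<and> {x, y} \<in> E"
      using fadj[of r "3 + i"] by fastforce
  qed
  then obtain x y where xy: "\<And>r i. r < 3 \<Longrightarrow> i < 3 \<Longrightarrow> x r i \<in> f r \<and> y r i \<in> f (3 + i) \<and> {x r i, y r i} \<in> E"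
    by metis
  define e where "e r i = {x r i, y r i}" for r i
  have eE: "e r i \<in> E" "x r i \<in> f r" "y r i \<in> f (3 + i)" if "r < 3" "i < 3" for r i
    using xy[OF that] by (auto simp: e_def)
  have dis: "f k \<inter> f l = {}" if "k < 6" "l < 6" "k \<noteq> l" for k l using fadj[OF that] by blast
  have eA: "e r i \<inter> f s = (if s = r then {x r i} else {})" if "r < 3" "i < 3" "s < 3" for r i s
    using eE[OF that(1,2)] dis[of r s] dis[of "3 + i" s] that by (auto simp: e_def)
  have eB: "e r i \<inter> f (3 + j) = (if j = i then {y r i} else {})" if "r < 3" "i < 3" "j < 3" for r i j
    using eE[OF that(1,2)] dis[of r "3 + j"] dis[of "3 + i" "3 + j"] that by (auto simp: e_def)
  have notsub: "\<not> e r i \<subseteq> f k" if "r < 3" "i < 3" "k < 6" for r i k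
    using eE[OF that(1,2)] dis[of r k] dis[of "3 + i" k] that by (cases "k = r") (auto simp: e_def)
  have GX: "path_image (\<gamma> (e r i)) \<inter> X (f k) \<subseteq> pos ` (e r i \<inter> f k)" if "r < 3" "i < 3" "k < 6" for r i k
    using edge_Int[OF eE(1)[OF that(1,2)] fV(1)[OF that(3)] notsub[OF that]] .
  have posG: "pos (x r i) \<in> path_image (\<gamma> (e r i))" "pos (y r i) \<in> path_image (\<gamma> (e r i))"
    if "r < 3" "i < 3" for r i
    using ends[OF eE(1)[OF that]] by (auto simp: e_def)
  have posX: "pos (x r i) \<in> X (f r)" "pos (y r i) \<in> X (f (3 + i))" if "r < 3" "i < 3" for r i
    using eE[OF that] by (auto simp: X_def)
  show False
  proof (rule no_K33_in_plane[of "\<lambda>r. X (f r)" "\<lambda>i. X (f (3 + i))" "\<lambda>r i. path_image (\<gamma> (e r i))"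
        "\<lambda>r i. pos (y r i)"])
    show "path_connected (X (f r)) \<and> closed (X (f r))" if "r < 3" for r
      using X_pc X_closed fV[of r] that by simp
    show "path_connected (X (f (3 + i))) \<and> closed (X (f (3 + i)))" if "i < 3" for i
      using X_pc X_closed fV[of "3 + i"] that by simp
    show "path_connected (path_image (\<gamma> (e r i))) \<and> closed (path_image (\<gamma> (e r i))) \<and>
      path_image (\<gamma> (e r i)) \<inter> X (f r) \<noteq> {} \<and> path_image (\<gamma> (e r i)) \<inter> X (f (3 + i)) = {pos (y r i)}"
      if ri: "r < 3" "i < 3" for r i
    proof -
      have "path (\<gamma> (e r i))" using arc[OF eE(1)[OF ri]] arc_imp_path by blast
      moreover have "path_image (\<gamma> (e r i)) \<inter> X (f (3 + i)) = {pos (y r i)}"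
        using GX[OF ri, of "3 + i"] eB[OF ri ri(2)] posG[OF ri] posX[OF ri] ri by auto
      moreover have "path_image (\<gamma> (e r i)) \<inter> X (f r) \<noteq> {}" using posG[OF ri] posX[OF ri] by blast
      ultimately show ?thesis by (simp add: path_connected_path_image closed_path_image)
    qed
    show "X (f r) \<inter> X (f s) = {}" if "r < 3" "s < 3" "r \<noteq> s" for r s
      using fV(1)[of r] fV(1)[of s] dis[of r s] that by (intro X_disj) auto
    show "X (f (3 + r)) \<inter> X (f (3 + s)) = {}" if "r < 3" "s < 3" "r \<noteq> s" for r s
      using fV(1)[of "3 + r"] fV(1)[of "3 + s"] dis[of "3 + r" "3 + s"] that by (intro X_disj) auto
    show "X (f r) \<inter> X (f (3 + i)) = {}" if "r < 3" "i < 3" for r i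
      using fV(1)[of r] fV(1)[of "3 + i"] dis[of r "3 + i"] that by (intro X_disj) auto
    show "path_image (\<gamma> (e r i)) \<inter> X (f s) = {}" if "r < 3" "s < 3" "i < 3" "r \<noteq> s" for r s i
      using GX[of r i s] eA[of r i s] that by simp
    show "path_image (\<gamma> (e r i)) \<inter> X (f (3 + j)) = {}" if "r < 3" "i < 3" "j < 3" "i \<noteq> j" for r i j
      using GX[of r i "3 + j"] eB[of r i j] that by simp
    show "path_image (\<gamma> (e r i)) \<inter> path_image (\<gamma> (e r j)) \<subseteq> X (f r)"
      if "r < 3" "i < 3" "j < 3" "i \<noteq> j" for r i j
    proof -
      have "y r j \<notin> e r i" "y r i \<notin> e r j"
        using eB[of r i j] eB[of r j i] eE[of r i] eE[of r j] that by auto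
      then have "e r i \<noteq> e r j" "e r i \<inter> e r j \<subseteq> f r"
        using eE[of r i] that by (auto simp: e_def)
      then show ?thesis using cross[OF eE(1) eE(1), of r i r j] that
        unfolding X_def by blast
    qed
    show "path_image (\<gamma> (e r i)) \<inter> path_image (\<gamma> (e s j)) \<subseteq> X (f (3 + i))"
      if "r < 3" "s < 3" "i < 3" "j < 3" "r \<noteq> s" for r s i j
    proof -
      have "x s j \<notin> e r i" "x r i \<notin> e s j"
        using eA[of r i s] eA[of s j r] eE[of r i] eE[of s j] that by auto
      then have "e r i \<noteq> e s j" "e r i \<inter> e s j \<subseteq> f (3 + i)"
        using eE[of r i] that by (auto simp: e_def)
      then show ?thesis using cross[OF eE(1) eE(1), of r i s j] that
        unfolding X_def by blast
    qed
  qed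
qed

section \<open>The threshold\<close>

text \<open>First moment: a union bound over all maximal planar bipartite graphs on the vertex set,
  each contained in the random graph with probability \<open>p ^ (2 * n - 4)\<close>.\<close>

lemma gnp_prob_has_spanning_mpb_le:
  assumes p: "0 \<le> p" "p \<le> 1" and n: "2 \<le> n"
  shows "gnp_prob n p (has_spanning_mpb {0..<n}) \<le> real (growth_rate ^ n * n ^ n) * p ^ (2 * n - 4)"
proof -
  define \<H> where "\<H> = {H. maximal_planar_bipartite {0..<n} H}"
  have H: "H \<subseteq> all_edges n" "card H = 2 * n - 4" "H \<in> minor_free {0..<n}" if "H \<in> \<H>" for H
  proof -
    have m: "simple_graph {0..<n} H" "planar {0..<n} H" "int (card H) = 2 * int n - 4"
      using that by (auto simp: \<H>_def maximal_planar_bipartite_def)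
    show "card H = 2 * n - 4" using m(3) n by linarith
    show "H \<in> minor_free {0..<n}" using m planar_no_K6_minor by (auto simp: minor_free_def)
    show "H \<subseteq> all_edges n"
    proof
      fix e assume "e \<in> H"
      then have "e \<subseteq> {0..<n}" "card e = 2" using m(1) by (auto simp: simple_graph_def)
      then obtain i j where "e = {i, j}" "i \<noteq> j" "i < n" "j < n"
        by (metis atLeastLessThan_iff card_2_iff insert_subset)
      then show "e \<in> all_edges n" by (auto simp: all_edges_def)
    qed
  qed
  have fin: "finite (all_edges n)" by (rule finite_subset[of _ "Pow {0..<n}"]) (auto simp: all_edges_def)
  have sub: "\<H> \<subseteq> minor_free {0..<n}" using H(3) by blast
  have fin\<H>: "finite \<H>" using sub finite_minor_free finite_subset by blast
  have "gnp_prob n p (has_spanning_mpb {0..<n}) = subset_prob p (all_edges n) (\<lambda>E. \<exists>H\<in>\<H>. H \<subseteq> E)"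
    unfolding gnp_prob_eq by (rule arg_cong[of _ _ "subset_prob p (all_edges n)"])
      (auto simp: fun_eq_iff has_spanning_mpb_def \<H>_def)
  also have "\<dots> \<le> (\<Sum>H\<in>\<H>. subset_prob p (all_edges n) (\<lambda>E. H \<subseteq> E))"
    by (rule subset_prob_Ex[OF p fin\<H>])
  also have "\<dots> = (\<Sum>H\<in>\<H>. p ^ (2 * n - 4))"
    by (intro sum.cong refl) (simp add: subset_prob_subset[OF fin] H)
  also have "\<dots> = real (card \<H>) * p ^ (2 * n - 4)" by simp
  also have "\<dots> \<le> real (growth_rate ^ n * n ^ n) * p ^ (2 * n - 4)"
  proof (rule mult_right_mono)
    have "card \<H> \<le> card (minor_free {0..<n})"
      using sub finite_minor_free[of "{0..<n}"] by (intro card_mono) auto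
    also have "\<dots> \<le> growth_rate ^ n * n ^ n" using card_minor_free_le[of "{0..<n}"] by simp
    finally show "real (card \<H>) \<le> real (growth_rate ^ n * n ^ n)" by (simp only: of_nat_le_iff)
  qed (use p in simp)
  finally show ?thesis .
qed

text \<open>With \<open>g\<close> for \<open>growth_rate\<close>, the constant gives
  \<open>g n p^2 \<le> 1/2\<close>, so the first moment is at most
  \<open>(g n)^2 (1/2)^(n - 2)\<close>; the factor \<open>(g n)^2\<close> is the price of having
  \<open>2n - 4\<close> edges and not \<open>2n\<close>.\<close>

lemma gnp_prob_has_spanning_mpb_tendsto_0:
  fixes p :: "nat \<Rightarrow> real"
  assumes p: "\<And>n. 0 \<le> p n \<and> p n \<le> 1"
    and small: "eventually (\<lambda>n. p n \<le> sqrt (1 / (2 * real growth_rate)) * real n powr (-1/2)) sequentially"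
  shows "(\<lambda>n. gnp_prob n (p n) (has_spanning_mpb {0..<n})) \<longlonglongrightarrow> 0"
proof -
  define g where "g = real growth_rate"
  have g: "0 < g" by (simp add: g_def growth_rate_def)
  have bound: "eventually (\<lambda>n. gnp_prob n (p n) (has_spanning_mpb {0..<n})
      \<le> 4 * g\<^sup>2 * (real n ^ 2 * (1 / 2) ^ n)) sequentially"
    using small eventually_ge_at_top[of 2]
  proof eventually_elim
    case (elim n)
    define m where "m = n - 2"
    have nm: "n = m + 2" "2 * n - 4 = 2 * m" using elim(2) by (auto simp: m_def)
    have "0 < real n" using elim(2) by simp
    have "(p n)\<^sup>2 \<le> (sqrt (1 / (2 * g)) * real n powr (-1/2))\<^sup>2"
      using elim(1) p[of n] unfolding g_def by (intro power_mono) auto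
    also have "\<dots> = 1 / (2 * g * real n)"
      using g \<open>0 < real n\<close> by (simp add: power_mult_distrib powr_minus_divide powr_half_sqrt power_divide)
    finally have p2: "(p n)\<^sup>2 \<le> 1 / (2 * g * real n)" .
    have "gnp_prob n (p n) (has_spanning_mpb {0..<n}) \<le> g ^ n * real n ^ n * p n ^ (2 * n - 4)"
      using gnp_prob_has_spanning_mpb_le[of "p n" n] p[of n] elim(2) by (simp add: g_def)
    also have "\<dots> = g ^ n * real n ^ n * ((p n)\<^sup>2) ^ m" by (simp add: nm(2) power_mult)
    also have "\<dots> \<le> g ^ n * real n ^ n * (1 / (2 * g * real n)) ^ m"
      using p2 g by (intro mult_left_mono power_mono) auto
    also have "\<dots> = g\<^sup>2 * real n ^ 2 * (1 / 2) ^ m"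
    proof -
      have "g ^ n * real n ^ n = g\<^sup>2 * real n ^ 2 * (g * real n) ^ m"
        by (subst (1 3) nm(1)) (simp add: power_add power_mult_distrib power2_eq_square)
      then show ?thesis using g \<open>0 < real n\<close> by (simp add: power_divide power_mult_distrib field_simps)
    qed
    also have "\<dots> = 4 * g\<^sup>2 * (real n ^ 2 * (1 / 2) ^ n)"
    proof -
      have "(1 / 2 :: real) ^ n = (1 / 2) ^ m / 4" by (subst nm(1)) (simp add: power_add)
      then show ?thesis by simp
    qed
    finally show ?case .
  qed
  \<comment> \<open>The square reduces the quadratic factor \<open>n^2\<close> to the known limit of
    \<open>n x^n\<close>, at \<open>x = sqrt (1/2)\<close>.\<close>
  have "(\<lambda>n. (real n * sqrt (1 / 2) ^ n)\<^sup>2) \<longlonglongrightarrow> 0\<^sup>2"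
    by (intro tendsto_power powser_times_n_limit_0) (simp add: real_sqrt_divide)
  moreover have "(real n * sqrt (1 / 2) ^ n)\<^sup>2 = real n ^ 2 * (1 / 2) ^ n" for n
  proof -
    have "(sqrt (1 / 2) ^ n)\<^sup>2 = ((sqrt (1 / 2))\<^sup>2) ^ n"
      by (simp only: power_mult[symmetric] mult.commute)
    also have "(sqrt (1 / 2))\<^sup>2 = (1 / 2 :: real)" by (rule real_sqrt_pow2) simp
    finally show ?thesis by (simp only: power_mult_distrib)
  qed
  ultimately have "(\<lambda>n. real n ^ 2 * (1 / 2 :: real) ^ n) \<longlonglongrightarrow> 0" by simp
  then have lim: "(\<lambda>n. 4 * g\<^sup>2 * (real n ^ 2 * (1 / 2 :: real) ^ n)) \<longlonglongrightarrow> 0"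
    using tendsto_mult_right_zero by blast
  show ?thesis
    by (rule tendsto_sandwich[OF _ bound tendsto_const lim])
       (use p in \<open>simp add: gnp_prob_eq subset_prob_nonneg\<close>)
qed

theorem theorem1:
  shows "\<exists>c1 c2 :: real. c1 > 0 \<and> c2 > 0 \<and>
    (\<forall>p :: nat \<Rightarrow> real. (\<forall>n. 0 \<le> p n \<and> p n \<le> 1) \<longrightarrow>
       (eventually (\<lambda>n. p n \<le> c1 * real n powr (-1/2)) sequentially) \<longrightarrow>
       (\<lambda>n. gnp_prob n (p n) (has_spanning_mpb {0..<n})) \<longlonglongrightarrow> 0) \<and>
    (\<forall>p :: nat \<Rightarrow> real. (\<forall>n. 0 \<le> p n \<and> p n \<le> 1) \<longrightarrow>
       (eventually (\<lambda>n. p n \<ge> c2 * ln (real n) powr (1/2) * real n powr (-1/2)) sequentially) \<longrightarrow>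
       (\<lambda>n. gnp_prob n (p n) (has_spanning_mpb {0..<n})) \<longlonglongrightarrow> 1)"
proof (intro exI conjI allI impI)
  show "0 < sqrt (1 / (2 * real growth_rate))" by (simp add: growth_rate_def)
  show "(0 :: real) < 8" by simp
qed (auto intro: gnp_prob_has_spanning_mpb_tendsto_0 gnp_prob_has_spanning_mpb_tendsto_1)

end
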